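(* Let $f^-,f^+:\mathbb R\to\mathbb R$ be twice differentiable and consider the state coupling $\theta_-=\theta_+=\mathrm{Id}$, so that $w(u,v)=u$ and $f(w,v)=(1-v)f^-(w)+vf^+(w)$. Let $v\in L^\infty(\mathbb R)$ take values in $[0,1]$, and let $w_0\in L^\infty(\mathbb R)\cap BV(\mathbb R)$ be the initial datum. Let $0<\epsilon<\frac12$ and assume the strengthened CFL condition $$\frac{\Delta t}{\Delta x}\max_{|w|\le\|w_0\|_{L^\infty(\mathbb R)},\ 0\le v\le1}|\partial_wf(w,v)|\le\frac12-\epsilon.$$ Then the finite volume scheme described in the context, with the Godunov numerical flux, is total variation diminishing: $TV(w_{\Delta x}(t^{n+1},\cdot))\le TV(w_{\Delta x}(t^n,\cdot))$ for all $n$, and in particular $TV(w_{\Delta x}(t^n,\cdot))\le TV(w_0)$ for all $n$.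
   Context: Mesh $\Delta t,\Delta x>0$, $t^n=n\Delta t$, $x_j=j\Delta x$, $x_{j+1/2}=(j+1/2)\Delta x$. Set $w^0_j=\frac1{\Delta x}\int_{x_{j-1/2}}^{x_{j+1/2}}w_0$ and $v_{j+1/2}=\frac1{\Delta x}\int_{x_j}^{x_{j+1}}v$. Godunov flux: for $v\in[0,1]$, $g(a,b;v)=f(\omega(0^+;a,b,v),v)$, where $\omega(x/t;a,b,v)$ is the self-similar entropy solution of the Riemann problem $\partial_t\omega+\partial_xf(\omega,v)=0$ with $\omega(0,x)=a$ for $x<0$ and $b$ for $x>0$. Scheme (which here has $u^n_j=w^n_j$): reconstruction $w^n_{j-1/2,+}=w^n_{j+1/2,-}=w^n_j$, $w^n_{j+1/2,+}=w^n_{j+1}$; $g^n_{j+1/2}=g(w^n_j,w^n_{j+1};v_{j+1/2})$; $w^{n+1}_j=w^n_j-\frac{\Delta t}{\Delta x}\big((g^n_{j+1/2}-f(w^n_j,v_{j+1/2}))-(g^n_{j-1/2}-f(w^n_j,v_{j-1/2}))\big)$. The approximate solution is $w_{\Delta x}(t,x)=w^n_j$ for $x\in(x_{j-1/2},x_{j+1/2})$, $t\in[t^n,t^{n+1})$, and $TV$ denotes total variation on $\mathbb R$. *)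

theory Defs
  imports "HOL-Analysis.Analysis"
begin

definition Linf_norm :: "(real \<Rightarrow> real) \<Rightarrow> real" where
  "Linf_norm u = Inf {C. AE x in lborel. \<bar>u x\<bar> \<le> C}"

definition pvar :: "(real \<Rightarrow> real) \<Rightarrow> ereal" where
  "pvar g = (SUP xs \<in> {xs :: real list. sorted xs}.
      (\<Sum>(a, b)\<leftarrow>zip xs (tl xs). ereal \<bar>g b - g a\<bar>))"

definition TV :: "(real \<Rightarrow> real) \<Rightarrow> ereal" where
  "TV u = (INF g \<in> {g. AE x in lborel. g x = u x}. pvar g)"

definition test_fun ::
  "(real \<times> real \<Rightarrow> real) \<Rightarrow> (real \<times> real \<Rightarrow> real) \<Rightarrow> (real \<times> real \<Rightarrow> real) \<Rightarrow> bool" where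
  "test_fun \<phi> \<phi>t \<phi>x \<longleftrightarrow>
     (\<forall>p. \<phi> p \<ge> 0) \<and>
     continuous_on UNIV \<phi>t \<and> continuous_on UNIV \<phi>x \<and>
     (\<forall>p. (\<phi> has_derivative (\<lambda>(dt, dx). \<phi>t p * dt + \<phi>x p * dx)) (at p)) \<and>
     (\<exists>K. compact K \<and> K \<subseteq> {p. fst p > 0} \<and> (\<forall>p. p \<notin> K \<longrightarrow> \<phi> p = 0))"

text \<open>\<open>\<omega>\<close> is the profile of a self-similar Kruzhkov entropy solution
  u(t,x) = \<open>\<omega>\<close>(x/t) of the Riemann problem for u_t + F(u)_x = 0 with left state a and
  right state b.\<close>
definition riemann_entropy_sol ::
  "(real \<Rightarrow> real) \<Rightarrow> real \<Rightarrow> real \<Rightarrow> (real \<Rightarrow> real) \<Rightarrow> bool" where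
  "riemann_entropy_sol F a b \<omega> \<longleftrightarrow>
     \<omega> \<in> borel_measurable borel \<and> (\<exists>C. \<forall>\<xi>. \<bar>\<omega> \<xi>\<bar> \<le> C) \<and>
     (\<forall>k \<phi> \<phi>t \<phi>x. test_fun \<phi> \<phi>t \<phi>x \<longrightarrow>
        integral\<^sup>L lborel (\<lambda>(t, x).
           \<bar>\<omega> (x / t) - k\<bar> * \<phi>t (t, x)
           + sgn (\<omega> (x / t) - k) * (F (\<omega> (x / t)) - F k) * \<phi>x (t, x)) \<ge> 0) \<and>
     (\<forall>R>0. ((\<lambda>t. LBINT x:{-R..R}. \<bar>\<omega> (x / t) - (if x < 0 then a else b)\<bar>)
               \<longlongrightarrow> 0) (at_right 0))"

definition ess_right_lim0 :: "(real \<Rightarrow> real) \<Rightarrow> real \<Rightarrow> bool" where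
  "ess_right_lim0 \<omega> l \<longleftrightarrow>
     (\<forall>e>0. \<exists>\<delta>>0. AE \<xi> in lborel. 0 < \<xi> \<and> \<xi> < \<delta> \<longrightarrow> \<bar>\<omega> \<xi> - l\<bar> < e)"

definition godunov :: "(real \<Rightarrow> real) \<Rightarrow> real \<Rightarrow> real \<Rightarrow> real" where
  "godunov F a b = F (THE l. \<exists>\<omega>. riemann_entropy_sol F a b \<omega> \<and> ess_right_lim0 \<omega> l)"

definition fluxf :: "(real \<Rightarrow> real) \<Rightarrow> (real \<Rightarrow> real) \<Rightarrow> real \<Rightarrow> real \<Rightarrow> real" where
  "fluxf fm fp w v = (1 - v) * fm w + v * fp w"

definition cell_avg :: "real \<Rightarrow> (real \<Rightarrow> real) \<Rightarrow> int \<Rightarrow> real" where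
  "cell_avg dx w0 j = (1 / dx) * (LBINT x:{(real_of_int j - 1/2) * dx .. (real_of_int j + 1/2) * dx}. w0 x)"

text \<open>\<open>vface dx v j\<close> = v_{j+1/2}, the average of v over (x_j, x_{j+1}).\<close>
definition vface :: "real \<Rightarrow> (real \<Rightarrow> real) \<Rightarrow> int \<Rightarrow> real" where
  "vface dx v j = (1 / dx) * (LBINT x:{real_of_int j * dx .. (real_of_int j + 1) * dx}. v x)"

primrec scheme ::
  "(real \<Rightarrow> real) \<Rightarrow> (real \<Rightarrow> real) \<Rightarrow> (real \<Rightarrow> real) \<Rightarrow> (real \<Rightarrow> real) \<Rightarrow> real \<Rightarrow> real
   \<Rightarrow> nat \<Rightarrow> int \<Rightarrow> real" where
  "scheme fm fp v w0 dt dx 0 = cell_avg dx w0"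
| "scheme fm fp v w0 dt dx (Suc n) =
     (\<lambda>j. let u = scheme fm fp v w0 dt dx n;
              vr = vface dx v j; vl = vface dx v (j - 1);
              gr = godunov (\<lambda>w. fluxf fm fp w vr) (u j) (u (j + 1));
              gl = godunov (\<lambda>w. fluxf fm fp w vl) (u (j - 1)) (u j)
          in u j - dt / dx * ((gr - fluxf fm fp (u j) vr) - (gl - fluxf fm fp (u j) vl)))"

text \<open>Piecewise constant approximate solution at time t^n: equal to w^n_j on
  [x_{j-1/2}, x_{j+1/2}) (values on cell interfaces are irrelevant for TV).\<close>
definition wdx ::
  "(real \<Rightarrow> real) \<Rightarrow> (real \<Rightarrow> real) \<Rightarrow> (real \<Rightarrow> real) \<Rightarrow> (real \<Rightarrow> real) \<Rightarrow> real \<Rightarrow> real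
   \<Rightarrow> nat \<Rightarrow> real \<Rightarrow> real" where
  "wdx fm fp v w0 dt dx n x = scheme fm fp v w0 dt dx n \<lfloor>x / dx + 1/2\<rfloor>"

end

theory Submission
  imports Defs
begin

text \<open>The Godunov flux is the minimum of the flux over the interval between the two states if they
  increase and the maximum if they decrease. Hence, under the CFL condition, the scheme has Harten's
  incremental form with coefficients in \<open>{0..1/2}\<close>, which keeps the cell values bounded by the
  sup norm of \<open>w0\<close> and does not increase the total variation.

  The formula for the flux needs existence of a self-similar entropy solution and uniqueness of its
  trace at \<open>0\<^sup>+\<close>. In the variable \<open>\<xi> = x / t\<close> the entropy inequality reads \<open>Q' + \<eta> \<le> 0\<close> with
  \<open>Q = q - \<xi> * \<eta>\<close>. For existence take \<open>\<omega> \<xi>\<close> to be a minimiser of \<open>F u - \<xi> * u\<close>. For uniqueness no doubling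
  of variables is needed: since \<open>\<bar>Q\<bar> \<le> (\<bar>\<xi>\<bar> + M) * \<eta>\<close>, testing with the weight \<open>1 / (M + sqrt (1 + \<xi>\<^sup>2))\<close>
  confines any solution to the interval between the states, and switching the weight off on one side of
  a small interval \<open>{0<..<\<delta>}\<close> shows that the trace is the largest minimiser of \<open>F\<close> between the states.\<close>

subsection \<open>Cutoff functions and null sets\<close>

text \<open>\<open>godunov\<close> is a definite description, so its value is determined only once a
  trace exists and is unique; that F takes the same value at all candidate traces would not be
  enough. The trace has to be pinned down even where F has several minimisers, and there the
  first-order term \<open>x * (\<omega> x - k)\<close> decides.

  The initial condition enters only through a mean: taken at time 1/S and rescaled, it says that the
  distance of \<omega> from the jump data averages to 0 over [-S,S]. This fixes the weight: decay
  like 1/|x| balances the growth of Q, while M, a Lipschitz constant of F, and the strict inequality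
  |x| < sqrt(1 + x^2) leave a positive margin.

  Decreasing data are reflected by u -> -u, which turns F into -F(-u) and a minimum into a maximum.
  The bound 1/2 is the share of each face flux: every cell, and every jump, meets two incremental
  coefficients, whose sum must not exceed 1.\<close>

lemma max0_square_has_real_derivative:
  "((\<lambda>x::real. (max 0 x)\<^sup>2) has_real_derivative 2 * max 0 x) (at x)"
proof -
  have bound: "\<bar>((max 0 (x + h))\<^sup>2 - (max 0 x)\<^sup>2) / h - 2 * max 0 x\<bar> \<le> \<bar>h\<bar>" if "h \<noteq> 0" for h
  proof -
    have "\<bar>(max 0 (x + h))\<^sup>2 - (max 0 x)\<^sup>2 - 2 * max 0 x * h\<bar> \<le> h\<^sup>2"
    proof (cases "x \<le> 0")
      case True
      then have "max 0 (x + h) \<le> \<bar>h\<bar>" "max 0 x = 0" by auto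
      then show ?thesis
        using power_mono[of "max 0 (x + h)" "\<bar>h\<bar>" 2] by auto
    next
      case False
      show ?thesis
      proof (cases "x + h \<ge> 0")
        case True
        then show ?thesis using False by (simp add: power2_eq_square algebra_simps)
      next
        case neg: False
        then have "x\<^sup>2 + 2 * x * h = - (x * (- x - 2 * h))" by (simp add: power2_eq_square algebra_simps)
        moreover have "0 \<le> x * (- x - 2 * h)" using False neg by simp
        moreover have "x * (- x - 2 * h) \<le> h\<^sup>2"
          using zero_le_power2[of "x + h"] by (simp add: power2_eq_square algebra_simps)
        moreover have "max 0 (x + h) = 0" "max 0 x = x" using False neg by auto
        ultimately show ?thesis by (metis abs_le_iff abs_of_nonneg abs_minus_cancel add_diff_cancel_left' diff_0 diff_diff_eq zero_power2)
      qed
    qed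
    moreover have "((max 0 (x + h))\<^sup>2 - (max 0 x)\<^sup>2) / h - 2 * max 0 x
        = ((max 0 (x + h))\<^sup>2 - (max 0 x)\<^sup>2 - 2 * max 0 x * h) / h"
      using that by (simp add: field_simps)
    ultimately show ?thesis
      using that by (simp add: abs_divide pos_divide_le_eq power2_eq_square abs_mult_self)
  qed
  have "((\<lambda>h. ((max 0 (x + h))\<^sup>2 - (max 0 x)\<^sup>2) / h - 2 * max 0 x) \<longlongrightarrow> 0) (at 0)"
  proof (rule Lim_null_comparison[where g = "\<lambda>h. \<bar>h\<bar>"])
    show "\<forall>\<^sub>F h in at 0. norm (((max 0 (x + h))\<^sup>2 - (max 0 x)\<^sup>2) / h - 2 * max 0 x) \<le> \<bar>h\<bar>"
      using bound by (simp add: eventually_at_filter)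
    show "((\<lambda>h::real. \<bar>h\<bar>) \<longlongrightarrow> 0) (at 0)"
      by (auto intro!: tendsto_eq_intros)
  qed
  then show ?thesis
    unfolding DERIV_def using Lim_null by blast
qed

lemma DERIV_imp_continuous_on_UNIV:
  assumes "\<And>x::real. (f has_real_derivative f' x) (at x)"
  shows "continuous_on UNIV f"
  by (rule DERIV_continuous_on[where D = f']) (rule assms)

text \<open>The quotient p(x) / (p(x) + p(1-x)), with p the squared positive part, is C1 because p
  is, and its denominator never vanishes since x and 1-x are not both nonpositive. The bound on
  \<sigma>' pays for cutoffs; its strict positivity inside (0,1) yields the strict signs in the
  trace argument.\<close>

lemma C1_step_function:
  obtains \<sigma> \<sigma>' :: "real \<Rightarrow> real" and B
  where "\<And>x. (\<sigma> has_real_derivative \<sigma>' x) (at x)" "continuous_on UNIV \<sigma>'"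
    "\<And>x. 0 \<le> \<sigma> x" "\<And>x. \<sigma> x \<le> 1" "\<And>x. x \<le> 0 \<Longrightarrow> \<sigma> x = 0" "\<And>x. x \<ge> 1 \<Longrightarrow> \<sigma> x = 1"
    "\<And>x. 0 \<le> \<sigma>' x" "\<And>x. \<sigma>' x \<le> B" "\<And>x. 0 < x \<Longrightarrow> x < 1 \<Longrightarrow> 0 < \<sigma>' x"
    "\<And>x. x \<le> 0 \<Longrightarrow> \<sigma>' x = 0" "\<And>x. x \<ge> 1 \<Longrightarrow> \<sigma>' x = 0"
proof -
  define p where "p x = (max 0 x)\<^sup>2" for x :: real
  define q where "q x = p x + p (1 - x)" for x
  define \<sigma> where "\<sigma> x = p x / q x" for x
  define \<sigma>' where "\<sigma>' x = (2 * max 0 x * p (1 - x) + p x * (2 * max 0 (1 - x))) / (q x * q x)" for x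
  have p0: "p x \<ge> 0" for x by (simp add: p_def)
  have q0: "q x > 0" for x
    by (cases "x > 0") (auto simp: q_def p_def add_pos_nonneg add_nonneg_pos)
  have dp: "(p has_real_derivative 2 * max 0 x) (at x)" for x
    unfolding p_def[abs_def] by (rule max0_square_has_real_derivative)
  have dp1: "((\<lambda>x. p (1 - x)) has_real_derivative - (2 * max 0 (1 - x))) (at x)" for x
    using DERIV_chain'[of "\<lambda>x. 1 - x" "-1" x UNIV p "2 * max 0 (1 - x)", OF _ dp]
    by (simp add: DERIV_const DERIV_ident DERIV_diff[of "\<lambda>x. 1" 0 _ _ "\<lambda>x. x" 1, simplified])
  have deriv: "(\<sigma> has_real_derivative \<sigma>' x) (at x)" for x
  proof -
    have "(q has_real_derivative 2 * max 0 x - 2 * max 0 (1 - x)) (at x)"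
      unfolding q_def[abs_def] using DERIV_add[OF dp dp1] by simp
    from DERIV_divide[OF dp this] q0[of x]
    have "(\<sigma> has_real_derivative (2 * max 0 x * q x - p x * (2 * max 0 x - 2 * max 0 (1 - x))) / (q x * q x)) (at x)"
      by (simp add: \<sigma>_def[abs_def])
    moreover have "2 * max 0 x * q x - p x * (2 * max 0 x - 2 * max 0 (1 - x))
        = 2 * max 0 x * p (1 - x) + p x * (2 * max 0 (1 - x))"
      by (simp add: q_def algebra_simps)
    ultimately show ?thesis by (simp add: \<sigma>'_def)
  qed
  have cont: "continuous_on UNIV \<sigma>'"
    unfolding \<sigma>'_def[abs_def] using q0
    by (auto intro!: continuous_intros simp: q_def p_def less_imp_neq)
  have 0: "\<sigma>' x = 0" if "x \<le> 0" for x using that by (simp add: \<sigma>'_def p_def)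
  have 1: "\<sigma>' x = 0" if "x \<ge> 1" for x using that by (simp add: \<sigma>'_def p_def)
  have pos: "0 \<le> \<sigma>' x" for x
    using p0 q0[of x] by (simp add: \<sigma>'_def)
  have "compact (\<sigma>' ` {0..1})"
    by (rule compact_continuous_image) (auto intro: continuous_on_subset[OF cont])
  then obtain B where B: "\<And>x. x \<in> {0..1} \<Longrightarrow> \<bar>\<sigma>' x\<bar> \<le> B"
    using compact_imp_bounded bounded_iff by (metis imageI real_norm_def)
  have bd: "\<sigma>' x \<le> B" for x
    using B[of x] B[of 0] 0[of x] 1[of x] by (cases "x \<in> {0..1}") auto
  show thesis
  proof (rule that[of \<sigma> \<sigma>' B])
    show "0 < \<sigma>' x" if "0 < x" "x < 1" for x
      using that q0[of x] by (simp add: \<sigma>'_def p_def add_pos_pos)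
    show "0 \<le> \<sigma> x" for x using p0 q0[of x] by (simp add: \<sigma>_def)
    show "\<sigma> x \<le> 1" for x using p0[of "1 - x"] q0[of x] by (simp add: \<sigma>_def q_def)
    show "\<sigma> x = 0" if "x \<le> 0" for x using that by (simp add: \<sigma>_def p_def)
    show "\<sigma> x = 1" if "1 \<le> x" for x using that by (simp add: \<sigma>_def q_def p_def)
  qed (use deriv cont 0 1 pos bd in auto)
qed

lemma AE_ex_in_Ioo:
  fixes a b :: real
  assumes "AE x in lborel. P x" "a < b"
  shows "\<exists>x. a < x \<and> x < b \<and> P x"
proof (rule ccontr)
  assume c: "\<nexists>x. a < x \<and> x < b \<and> P x"
  from AE_E[OF assms(1)] obtain N where N: "{x \<in> space lborel. \<not> P x} \<subseteq> N" "emeasure lborel N = 0" "N \<in> sets lborel" .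
  have "{a<..<b} \<subseteq> N" using c N(1) by auto
  then have "emeasure lborel {a<..<b} \<le> emeasure lborel N" by (rule emeasure_mono) (use N in auto)
  then show False using N assms(2) by simp
qed

subsection \<open>Reduction to the self-similar variable\<close>

lemma integrable_lborel_bounded_support:
  fixes f :: "'a::euclidean_space \<Rightarrow> real"
  assumes "f \<in> borel_measurable borel" "\<And>p. \<bar>f p\<bar> \<le> C" "\<And>p. p \<notin> cbox a b \<Longrightarrow> f p = 0"
  shows "integrable lborel f"
proof (rule Bochner_Integration.integrable_bound[where f = "\<lambda>p. C * indicator (cbox a b) p"])
  show "integrable lborel (\<lambda>p. C * indicator (cbox a b) p)"
    using emeasure_lborel_cbox_finite[of a b]
    by (intro integrable_mult_right integrable_real_indicator) (simp_all add: less_top[symmetric])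
  show "AE p in lborel. norm (f p) \<le> norm (C * indicator (cbox a b) p)"
    using assms(2,3) by (intro always_eventually allI) (auto simp: indicator_def intro: order_trans[OF _ abs_ge_self])
qed (use assms in simp)

lemma set_integrable_AE_bounded:
  fixes f :: "real \<Rightarrow> real"
  assumes "f \<in> borel_measurable borel" "AE x in lborel. \<bar>f x\<bar> \<le> C"
  shows "set_integrable lborel {a..b} f"
  unfolding set_integrable_def
proof (rule Bochner_Integration.integrable_bound[where f = "\<lambda>x. C * indicator {a..b} x"])
  show "integrable lborel (\<lambda>x. C * indicator {a..b} x)"
    by (intro integrable_mult_right integrable_real_indicator) (simp_all add: emeasure_lborel_Icc_eq)
  show "(\<lambda>x. indicator {a..b} x *\<^sub>R f x) \<in> borel_measurable lborel" using assms(1) by measurable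
  show "AE x in lborel. norm (indicator {a..b} x *\<^sub>R f x) \<le> norm (C * indicator {a..b} x)"
    using assms(2) by eventually_elim (auto simp: indicator_def)
qed

lemma set_integrable_bounded:
  fixes h :: "real \<Rightarrow> real"
  assumes "h \<in> borel_measurable borel" "\<And>x. \<bar>h x\<bar> \<le> c"
  shows "set_integrable lborel {a..b} h"
  by (rule set_integrable_AE_bounded[of h c]) (use assms in auto)

text \<open>\<open>test_fun\<close> only makes \<phi> vanish off K; the complement of K is open, so
  the partial derivatives vanish there too. Compactness of K inside t > 0 gives the positive
  distance t0 from t = 0, which keeps x/t bounded on the support.\<close>

lemma test_fun_support:
  assumes "test_fun \<phi> \<phi>t \<phi>x"
  obtains t0 B C where "t0 > 0" "B \<ge> 0"
    "\<And>t x. \<not> (t0 \<le> t \<and> t \<le> B \<and> \<bar>x\<bar> \<le> B) \<Longrightarrow> \<phi> (t, x) = 0 \<and> \<phi>t (t, x) = 0 \<and> \<phi>x (t, x) = 0"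
    "\<And>p. \<bar>\<phi> p\<bar> \<le> C \<and> \<bar>\<phi>t p\<bar> \<le> C \<and> \<bar>\<phi>x p\<bar> \<le> C"
proof -
  from assms obtain K where contt: "continuous_on UNIV \<phi>t" and contx: "continuous_on UNIV \<phi>x"
    and der: "\<And>p. (\<phi> has_derivative (\<lambda>(dt, dx). \<phi>t p * dt + \<phi>x p * dx)) (at p)"
    and K: "compact K" "K \<subseteq> {p. fst p > 0}" and out: "\<And>p. p \<notin> K \<Longrightarrow> \<phi> p = 0"
    unfolding test_fun_def by blast
  have cont: "continuous_on UNIV \<phi>"
    by (meson continuous_at_imp_continuous_on der has_derivative_continuous)
  have out': "\<phi>t p = 0 \<and> \<phi>x p = 0" if "p \<notin> K" for p
  proof -
    have "((\<lambda>_. 0) has_derivative (\<lambda>(dt, dx). \<phi>t p * dt + \<phi>x p * dx)) (at p)"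
      by (rule has_derivative_transform_within_open[OF der, of "- K"])
        (use that K out in \<open>auto simp: compact_imp_closed open_Compl\<close>)
    then have *: "(\<lambda>(dt, dx). \<phi>t p * dt + \<phi>x p * dx) = (\<lambda>_. 0)"
      by (rule has_derivative_unique) simp
    show ?thesis using fun_cong[OF *, of "(1, 0)"] fun_cong[OF *, of "(0, 1)"] by simp
  qed
  obtain t0 where t0: "t0 > 0" "\<And>p. p \<in> K \<Longrightarrow> t0 \<le> fst p"
  proof (cases "K = {}")
    case False
    have "continuous_on K (fst :: real \<times> real \<Rightarrow> real)" by (intro continuous_intros)
    from continuous_attains_inf[OF K(1) False this]
    obtain p0 where "p0 \<in> K" "\<And>p. p \<in> K \<Longrightarrow> fst p0 \<le> fst p" by blast
    then show ?thesis using that[of "fst p0"] K(2) by auto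
  qed (use that[of 1] in auto)
  obtain B where B: "\<And>p. p \<in> K \<Longrightarrow> norm p \<le> B"
    using compact_imp_bounded[OF K(1)] bounded_iff by blast
  have "\<exists>c. \<forall>p. \<bar>g p\<bar> \<le> c" if g: "continuous_on UNIV g" "\<And>p. p \<notin> K \<Longrightarrow> g p = 0" for g :: "real \<times> real \<Rightarrow> real"
  proof -
    have "compact (g ` K)"
      by (rule compact_continuous_image) (use g K in \<open>auto intro: continuous_on_subset\<close>)
    then obtain c where "\<And>y. y \<in> g ` K \<Longrightarrow> \<bar>y\<bar> \<le> c"
      using compact_imp_bounded bounded_iff by (metis real_norm_def)
    then have "\<bar>g p\<bar> \<le> max c 0" for p using g(2)[of p] by (cases "p \<in> K") (auto simp: le_max_iff_disj)
    then show ?thesis by blast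
  qed
  then obtain c1 c2 c3 where c: "\<And>p. \<bar>\<phi> p\<bar> \<le> c1" "\<And>p. \<bar>\<phi>t p\<bar> \<le> c2" "\<And>p. \<bar>\<phi>x p\<bar> \<le> c3"
    using cont contt contx out out' by (metis (no_types, lifting))
  show thesis
  proof (rule that[of t0 "max B 0" "max c1 (max c2 c3)"])
    fix t x assume n: "\<not> (t0 \<le> t \<and> t \<le> max B 0 \<and> \<bar>x\<bar> \<le> max B 0)"
    have "(t, x) \<notin> K"
    proof
      assume "(t, x) \<in> K"
      then show False
        using n t0(2)[of "(t, x)"] B[of "(t, x)"] norm_fst_le[of t x] norm_snd_le[of x t]
        by (auto simp: le_max_iff_disj)
    qed
    then show "\<phi> (t, x) = 0 \<and> \<phi>t (t, x) = 0 \<and> \<phi>x (t, x) = 0" using out out' by blast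
  next
    show "\<bar>\<phi> p\<bar> \<le> max c1 (max c2 c3) \<and> \<bar>\<phi>t p\<bar> \<le> max c1 (max c2 c3) \<and> \<bar>\<phi>x p\<bar> \<le> max c1 (max c2 c3)" for p
      using c[of p] by (auto simp: le_max_iff_disj)
  qed (use t0 in auto)
qed

text \<open>The substitution \<open>x = t * \<xi>\<close> turns \<open>\<phi>\<^sub>t\<close> into \<open>d/dt [\<phi>(t, t * \<xi>)] - \<xi> * \<phi>\<^sub>x\<close>;
  the total \<open>t\<close>-derivative is then integrated by parts.\<close>

lemma selfsimilar_weak_integral:
  fixes \<eta> q :: "real \<Rightarrow> real"
  assumes \<eta>[measurable]: "\<eta> \<in> borel_measurable borel" and q[measurable]: "q \<in> borel_measurable borel"
    and \<eta>b: "\<And>x. \<bar>\<eta> x\<bar> \<le> C" and qb: "\<And>x. \<bar>q x\<bar> \<le> C"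
    and test: "test_fun \<phi> \<phi>t \<phi>x"
  shows "integral\<^sup>L lborel (\<lambda>(t, x). \<eta> (x / t) * \<phi>t (t, x) + q (x / t) * \<phi>x (t, x))
    = (\<integral>t. (\<integral>\<xi>. (q \<xi> - \<xi> * \<eta> \<xi>) * (t * \<phi>x (t, t * \<xi>)) - \<eta> \<xi> * \<phi> (t, t * \<xi>) \<partial>lborel) \<partial>lborel)"
proof -
  from test_fun_support[OF test] obtain t0 B D where t0: "t0 > 0" and B: "B \<ge> 0"
    and zero: "\<And>t x. \<not> (t0 \<le> t \<and> t \<le> B \<and> \<bar>x\<bar> \<le> B) \<Longrightarrow> \<phi> (t, x) = 0 \<and> \<phi>t (t, x) = 0 \<and> \<phi>x (t, x) = 0"
    and D: "\<And>p. \<bar>\<phi> p\<bar> \<le> D \<and> \<bar>\<phi>t p\<bar> \<le> D \<and> \<bar>\<phi>x p\<bar> \<le> D" by metis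
  from test have contt: "continuous_on UNIV \<phi>t" and contx: "continuous_on UNIV \<phi>x"
    and der: "\<And>p. (\<phi> has_derivative (\<lambda>(dt, dx). \<phi>t p * dt + \<phi>x p * dx)) (at p)"
    unfolding test_fun_def by blast+
  have cont: "continuous_on UNIV \<phi>"
    by (meson continuous_at_imp_continuous_on der has_derivative_continuous)
  have C0: "C \<ge> 0" using \<eta>b[of 0] by linarith
  have D0: "D \<ge> 0" using D[of 0] by linarith
  have [measurable]: "\<phi> \<in> borel_measurable (borel \<Otimes>\<^sub>M borel)" "\<phi>t \<in> borel_measurable (borel \<Otimes>\<^sub>M borel)"
    "\<phi>x \<in> borel_measurable (borel \<Otimes>\<^sub>M borel)"
    using cont contt contx by (auto simp: borel_prod intro: borel_measurable_continuous_onI)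
  \<comment> \<open>On the support t \<ge> t0 and |x| \<le> B, hence |\<xi>| = |x|/t \<le>
    B/t0.\<close>
  define R where "R = B / t0"
  have R: "R \<ge> 0" using B t0 by (simp add: R_def)
  have zero': "\<phi> (t, t * \<xi>) = 0 \<and> \<phi>t (t, t * \<xi>) = 0 \<and> \<phi>x (t, t * \<xi>) = 0"
    if "\<not> (t0 \<le> t \<and> t \<le> B \<and> \<bar>\<xi>\<bar> \<le> R)" for t \<xi>
  proof (rule zero, rule notI)
    assume *: "t0 \<le> t \<and> t \<le> B \<and> \<bar>t * \<xi>\<bar> \<le> B"
    then have "t0 * \<bar>\<xi>\<bar> \<le> t * \<bar>\<xi>\<bar>" using t0 by (intro mult_right_mono) auto
    also have "\<dots> = \<bar>t * \<xi>\<bar>" using * t0 by (simp add: abs_mult)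
    also have "\<dots> \<le> B" using * by blast
    finally have "\<bar>\<xi>\<bar> \<le> R" using t0 by (simp add: R_def field_simps)
    with that * show False by blast
  qed
  have int: "integrable lborel (\<lambda>(t, \<xi>). g t \<xi> :: real)"
    if g: "(\<lambda>(t, \<xi>). g t \<xi>) \<in> borel_measurable (borel \<Otimes>\<^sub>M borel)"
      and gb: "\<And>t \<xi>. t0 \<le> t \<Longrightarrow> t \<le> B \<Longrightarrow> \<bar>\<xi>\<bar> \<le> R \<Longrightarrow> \<bar>g t \<xi>\<bar> \<le> c"
      and g0: "\<And>t \<xi>. \<not> (t0 \<le> t \<and> t \<le> B \<and> \<bar>\<xi>\<bar> \<le> R) \<Longrightarrow> g t \<xi> = 0" for g c
  proof (rule integrable_lborel_bounded_support[where a = "(t0, - R)" and b = "(B, R)" and C = "max c 0"])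
    show "(\<lambda>(t, \<xi>). g t \<xi>) \<in> borel_measurable borel" using g by (simp add: borel_prod)
    show "\<bar>case p of (t, \<xi>) \<Rightarrow> g t \<xi>\<bar> \<le> max c 0" for p
      using gb[of "fst p" "snd p"] g0[of "fst p" "snd p"]
      by (cases "t0 \<le> fst p \<and> fst p \<le> B \<and> \<bar>snd p\<bar> \<le> R") (auto simp: case_prod_beta le_max_iff_disj)
    show "(case p of (t, \<xi>) \<Rightarrow> g t \<xi>) = 0" if "p \<notin> cbox (t0, - R) (B, R)" for p
      using that g0[of "fst p" "snd p"]
      by (cases p) (auto simp: mem_box Basis_prod_def inner_prod_def abs_le_iff)
  qed
  \<comment> \<open>The Jacobian t is included. \<open>c\<close> is the term that completes
    \<open>a\<close> to \<eta>(\<xi>) times d/dt (t \<phi>(t, t \<xi>)); it is added to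
    \<open>a\<close> and subtracted from \<open>b\<close>.\<close>
  define a where "a t \<xi> = \<eta> \<xi> * (t * (\<phi>t (t, t * \<xi>) + \<xi> * \<phi>x (t, t * \<xi>)))" for t \<xi>
  define b where "b t \<xi> = (q \<xi> - \<xi> * \<eta> \<xi>) * (t * \<phi>x (t, t * \<xi>))" for t \<xi>
  define c where "c t \<xi> = \<eta> \<xi> * \<phi> (t, t * \<xi>)" for t \<xi>
  have inta: "integrable lborel (\<lambda>(t, \<xi>). a t \<xi>)"
  proof (rule int[where c = "C * (B * (D + R * D))"])
    show "(\<lambda>(t, \<xi>). a t \<xi>) \<in> borel_measurable (borel \<Otimes>\<^sub>M borel)"
      unfolding a_def by measurable
    fix t \<xi> assume "t0 \<le> t" "t \<le> B" "\<bar>\<xi>\<bar> \<le> R"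
    then show "\<bar>a t \<xi>\<bar> \<le> C * (B * (D + R * D))"
      using t0 B R D0 C0 \<eta>b D unfolding a_def abs_mult
      by (intro mult_mono order_trans[OF abs_triangle_ineq] add_mono)
        (auto simp: abs_mult intro!: mult_mono)
  qed (use zero' in \<open>auto simp: a_def\<close>)
  have intb: "integrable lborel (\<lambda>(t, \<xi>). b t \<xi>)"
  proof (rule int[where c = "(C + R * C) * (B * D)"])
    show "(\<lambda>(t, \<xi>). b t \<xi>) \<in> borel_measurable (borel \<Otimes>\<^sub>M borel)"
      unfolding b_def by measurable
    fix t \<xi> assume "t0 \<le> t" "t \<le> B" "\<bar>\<xi>\<bar> \<le> R"
    then show "\<bar>b t \<xi>\<bar> \<le> (C + R * C) * (B * D)"
      using t0 B R D0 C0 \<eta>b qb D unfolding b_def abs_mult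
      by (intro mult_mono order_trans[OF abs_triangle_ineq4] add_mono)
        (auto simp: abs_mult intro!: mult_mono)
  qed (use zero' in \<open>auto simp: b_def\<close>)
  have intc: "integrable lborel (\<lambda>(t, \<xi>). c t \<xi>)"
  proof (rule int[where c = "C * D"])
    show "(\<lambda>(t, \<xi>). c t \<xi>) \<in> borel_measurable (borel \<Otimes>\<^sub>M borel)"
      unfolding c_def by measurable
    fix t \<xi> show "\<bar>c t \<xi>\<bar> \<le> C * D"
      using D0 C0 \<eta>b D unfolding c_def abs_mult by (intro mult_mono) auto
  qed (use zero' in \<open>auto simp: c_def\<close>)
  let ?f = "\<lambda>(t, x). \<eta> (x / t) * \<phi>t (t, x) + q (x / t) * \<phi>x (t, x)"
  have intf: "integrable lborel ?f"
  proof (rule integrable_lborel_bounded_support[where a = "(t0, - B)" and b = "(B, B)" and C = "C * D + C * D"])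
    have "?f \<in> borel_measurable (borel \<Otimes>\<^sub>M borel)" by measurable
    then show "?f \<in> borel_measurable borel" by (simp add: borel_prod)
    show "\<bar>?f p\<bar> \<le> C * D + C * D" for p
    proof -
      obtain t x where p: "p = (t, x)" by (cases p)
      have "\<bar>\<eta> (x / t) * \<phi>t p\<bar> \<le> C * D" "\<bar>q (x / t) * \<phi>x p\<bar> \<le> C * D"
        unfolding abs_mult using D0 C0 \<eta>b qb D[of p] by (auto intro!: mult_mono)
      then show ?thesis using abs_triangle_ineq[of "\<eta> (x / t) * \<phi>t p" "q (x / t) * \<phi>x p"] by (simp add: p)
    qed
    show "?f p = 0" if "p \<notin> cbox (t0, - B) (B, B)" for p
      using that zero[of "fst p" "snd p"]
      by (cases p) (auto simp: mem_box Basis_prod_def inner_prod_def abs_le_iff)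
  qed
  have iter: "integral\<^sup>L lborel (\<lambda>(t, x). g t x) = (\<integral>t. (\<integral>x. g t x \<partial>lborel) \<partial>lborel)"
    "integral\<^sup>L lborel (\<lambda>(t, x). g t x) = (\<integral>x. (\<integral>t. g t x \<partial>lborel) \<partial>lborel)"
    if "integrable lborel (\<lambda>(t, x). g t x)" for g :: "real \<Rightarrow> real \<Rightarrow> real"
  proof -
    have *: "integrable (lborel \<Otimes>\<^sub>M lborel) (\<lambda>(t, x). g t x)" using that by (simp add: lborel_prod)
    show "integral\<^sup>L lborel (\<lambda>(t, x). g t x) = (\<integral>t. (\<integral>x. g t x \<partial>lborel) \<partial>lborel)"
      using lborel_pair.integral_fst[OF *] by (simp add: lborel_prod)
    then show "integral\<^sup>L lborel (\<lambda>(t, x). g t x) = (\<integral>x. (\<integral>t. g t x \<partial>lborel) \<partial>lborel)"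
      using lborel_pair.Fubini_integral[OF *] by simp
  qed
  have "integral\<^sup>L lborel ?f = (\<integral>t. (\<integral>x. \<eta> (x / t) * \<phi>t (t, x) + q (x / t) * \<phi>x (t, x) \<partial>lborel) \<partial>lborel)"
    by (rule iter(1)[OF intf])
  also have "\<dots> = (\<integral>t. (\<integral>\<xi>. a t \<xi> + b t \<xi> \<partial>lborel) \<partial>lborel)"
  proof (rule Bochner_Integration.integral_cong[OF refl])
    fix t :: real
    show "(\<integral>x. \<eta> (x / t) * \<phi>t (t, x) + q (x / t) * \<phi>x (t, x) \<partial>lborel) = (\<integral>\<xi>. a t \<xi> + b t \<xi> \<partial>lborel)"
    proof (cases "t > 0")
      case True
      have "(\<integral>x. \<eta> (x / t) * \<phi>t (t, x) + q (x / t) * \<phi>x (t, x) \<partial>lborel)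
         = \<bar>t\<bar> *\<^sub>R (\<integral>\<xi>. \<eta> ((0 + t * \<xi>) / t) * \<phi>t (t, 0 + t * \<xi>) + q ((0 + t * \<xi>) / t) * \<phi>x (t, 0 + t * \<xi>) \<partial>lborel)"
        by (rule lborel_integral_real_affine) (use True in simp)
      also have "\<dots> = (\<integral>\<xi>. t * (\<eta> \<xi> * \<phi>t (t, t * \<xi>) + q \<xi> * \<phi>x (t, t * \<xi>)) \<partial>lborel)"
        using True by simp
      also have "\<dots> = (\<integral>\<xi>. a t \<xi> + b t \<xi> \<partial>lborel)"
        by (rule Bochner_Integration.integral_cong) (simp_all add: a_def b_def algebra_simps)
      finally show ?thesis .
    next
      case False
      then have "\<not> t0 \<le> t" using t0 by linarith
      then show ?thesis using zero zero' by (simp add: a_def b_def)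
    qed
  qed
  also have "\<dots> = integral\<^sup>L lborel (\<lambda>(t, \<xi>). a t \<xi> + b t \<xi>)"
    by (rule iter(1)[symmetric]) (use Bochner_Integration.integrable_add[OF inta intb] in \<open>simp add: case_prod_beta'\<close>)
  also have "\<dots> = integral\<^sup>L lborel (\<lambda>(t, \<xi>). a t \<xi> + c t \<xi>) + integral\<^sup>L lborel (\<lambda>(t, \<xi>). b t \<xi> - c t \<xi>)"
    using inta intb intc by (simp add: case_prod_beta')
  \<comment> \<open>With t as the inner variable, \<eta>(\<xi>) is a constant factor and a total
    t-derivative remains.\<close>
  also have "integral\<^sup>L lborel (\<lambda>(t, \<xi>). a t \<xi> + c t \<xi>) = (\<integral>\<xi>. (\<integral>t. a t \<xi> + c t \<xi> \<partial>lborel) \<partial>lborel)"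
    by (rule iter(2)) (use Bochner_Integration.integrable_add[OF inta intc] in \<open>simp add: case_prod_beta'\<close>)
  also have "\<dots> = (LINT \<xi>::real|lborel. 0 :: real)"
  proof (rule Bochner_Integration.integral_cong[OF refl])
    fix \<xi> :: real
    define g where "g t = \<phi> (t, t * \<xi>) + t * (\<phi>t (t, t * \<xi>) + \<xi> * \<phi>x (t, t * \<xi>))" for t
    have G: "((\<lambda>t. t * \<phi> (t, t * \<xi>)) has_vector_derivative g t) (at t within {0..B + 1})" for t
    proof -
      have "((\<lambda>t. (t, t * \<xi>)) has_derivative (\<lambda>d. (d, d * \<xi>))) (at t)"
        by (auto intro!: derivative_eq_intros)
      from diff_chain_at[OF this der]
      have "((\<lambda>t. \<phi> (t, t * \<xi>)) has_derivative (\<lambda>d. (\<phi>t (t, t * \<xi>) + \<xi> * \<phi>x (t, t * \<xi>)) * d)) (at t)"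
        by (simp add: o_def algebra_simps)
      then have "((\<lambda>t. \<phi> (t, t * \<xi>)) has_real_derivative (\<phi>t (t, t * \<xi>) + \<xi> * \<phi>x (t, t * \<xi>))) (at t)"
        by (simp add: has_field_derivative_def)
      from DERIV_mult[OF DERIV_ident this]
      have "((\<lambda>t. t * \<phi> (t, t * \<xi>)) has_real_derivative g t) (at t)"
        by (simp add: g_def algebra_simps)
      then show ?thesis
        by (simp add: has_real_derivative_iff_has_vector_derivative has_vector_derivative_at_within)
    qed
    have "continuous_on {0..B + 1} g"
      unfolding g_def by (intro continuous_intros continuous_on_compose2[OF cont] continuous_on_compose2[OF contt]
        continuous_on_compose2[OF contx]) auto
    \<comment> \<open>At t = B + 1 the test function has vanished, and at t = 0 the factor t
      does.\<close>
    from integral_FTC_atLeastAtMost[OF _ G this] zero'[of "B + 1" \<xi>] B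
    have "(\<integral>t. indicator {0..B + 1} t *\<^sub>R g t \<partial>lborel) = 0" by simp
    moreover have "a t \<xi> + c t \<xi> = \<eta> \<xi> * (indicator {0..B + 1} t *\<^sub>R g t)" for t
    proof (cases "t \<in> {0..B + 1}")
      case True
      then show ?thesis by (simp add: a_def c_def g_def algebra_simps)
    next
      case False
      then show ?thesis using zero'[of t \<xi>] t0 by (auto simp: a_def c_def)
    qed
    ultimately show "(\<integral>t. a t \<xi> + c t \<xi> \<partial>lborel) = 0" by simp
  qed
  also have "integral\<^sup>L lborel (\<lambda>(t, \<xi>). b t \<xi> - c t \<xi>) = (\<integral>t. (\<integral>\<xi>. b t \<xi> - c t \<xi> \<partial>lborel) \<partial>lborel)"
    by (rule iter(1)) (use Bochner_Integration.integrable_diff[OF intb intc] in \<open>simp add: case_prod_beta'\<close>)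
  finally show ?thesis by (simp add: b_def c_def)
qed

subsection \<open>Weighted entropy estimates\<close>

definition decay_weight :: "real \<Rightarrow> real \<Rightarrow> real" where
  "decay_weight M x = 1 / (M + sqrt (1 + x\<^sup>2))"

definition decay_weight' :: "real \<Rightarrow> real \<Rightarrow> real" where
  "decay_weight' M x = - (x / sqrt (1 + x\<^sup>2)) / (M + sqrt (1 + x\<^sup>2))\<^sup>2"

text \<open>sqrt(1 + x^2) is a smooth replacement of |x| that exceeds it strictly. With L the
  weight, this gives (|x| + M) L \<le> 1, which controls the cutoff term, and, as |x| / sqrt(1 +
  x^2) \<le> 1, also (|x| + M) |L'| < L, the margin by which the term with L' is absorbed.\<close>

lemma decay_weight:
  assumes M: "M \<ge> 0"
  shows "(decay_weight M has_real_derivative decay_weight' M x) (at x)"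
    "continuous_on UNIV (decay_weight' M)"
    "0 < decay_weight M x" "decay_weight M x \<le> 1" "(\<bar>x\<bar> + M) * decay_weight M x \<le> 1"
    "(\<bar>x\<bar> + M) * \<bar>decay_weight' M x\<bar> < decay_weight M x"
proof -
  have s1: "sqrt (1 + y\<^sup>2) \<ge> 1" for y :: real by simp
  have sx: "\<bar>x\<bar> < sqrt (1 + x\<^sup>2)" by (simp add: real_less_rsqrt)
  have pos: "M + sqrt (1 + y\<^sup>2) > 0" for y using s1[of y] M by linarith
  have ds: "((\<lambda>x. sqrt (1 + x\<^sup>2)) has_real_derivative x / sqrt (1 + x\<^sup>2)) (at x)"
  proof -
    have d: "((\<lambda>x. 1 + x\<^sup>2) has_real_derivative 2 * x) (at x)" by (auto intro!: derivative_eq_intros)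
    have "0 < 1 + x\<^sup>2" by (simp add: add_pos_nonneg)
    then have "(sqrt has_real_derivative inverse (sqrt (1 + x\<^sup>2)) / 2) (at (1 + x\<^sup>2))"
      by (rule DERIV_real_sqrt)
    from DERIV_chain2[where g = "\<lambda>x. 1 + x\<^sup>2" and x = x, OF this d] show ?thesis
      by (rule DERIV_cong) (simp add: inverse_eq_divide)
  qed
  have "M + sqrt (1 + x\<^sup>2) \<noteq> 0" using pos[of x] by linarith
  from DERIV_inverse_fun[OF DERIV_add[OF DERIV_const ds] this]
  show "(decay_weight M has_real_derivative decay_weight' M x) (at x)"
    unfolding decay_weight_def[abs_def] decay_weight'_def inverse_eq_divide[symmetric]
    by (rule DERIV_cong) (simp add: inverse_eq_divide power2_eq_square)
  have "sqrt (1 + y\<^sup>2) \<noteq> 0" "M + sqrt (1 + y\<^sup>2) \<noteq> 0" for y using pos[of y] s1[of y] by linarith+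
  then show "continuous_on UNIV (decay_weight' M)"
    unfolding decay_weight'_def[abs_def] by (intro continuous_intros) (simp_all del: real_sqrt_eq_0_iff)
  show "0 < decay_weight M x" using pos by (simp add: decay_weight_def)
  have "1 \<le> M + sqrt (1 + x\<^sup>2)" using s1[of x] M by linarith
  then show "decay_weight M x \<le> 1" unfolding decay_weight_def by (rule divide_le_eq_1_pos[THEN iffD2, rotated]) (rule pos)
  show "(\<bar>x\<bar> + M) * decay_weight M x \<le> 1" using pos[of x] sx by (simp add: decay_weight_def)
  define s where "s = sqrt (1 + x\<^sup>2)"
  have s: "\<bar>x\<bar> < s" "s \<ge> 1" using sx s1 by (auto simp: s_def)
  have "\<bar>decay_weight' M x\<bar> = (\<bar>x\<bar> / s) / (M + s)\<^sup>2"
    using s by (simp add: decay_weight'_def s_def[symmetric] abs_divide)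
  moreover have "(\<bar>x\<bar> + M) * ((\<bar>x\<bar> / s) / (M + s)\<^sup>2) < 1 / (M + s)"
  proof -
    have "(\<bar>x\<bar> + M) * (\<bar>x\<bar> / s) \<le> (\<bar>x\<bar> + M) * 1"
      using s M by (intro mult_left_mono) auto
    also have "\<dots> < M + s" using s by simp
    finally have "(\<bar>x\<bar> + M) * (\<bar>x\<bar> / s) / (M + s)\<^sup>2 < (M + s) / (M + s)\<^sup>2"
      using s M by (intro divide_strict_right_mono) auto
    then show ?thesis using s M by (simp add: power2_eq_square)
  qed
  ultimately show "(\<bar>x\<bar> + M) * \<bar>decay_weight' M x\<bar> < decay_weight M x"
    by (simp add: decay_weight_def s_def[symmetric])
qed

text \<open>Admissible test functions in the similarity variable, with the derivative carried along
  as in \<open>test_fun\<close>.\<close>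

definition C1c_nonneg :: "(real \<Rightarrow> real) \<Rightarrow> (real \<Rightarrow> real) \<Rightarrow> bool" where
  "C1c_nonneg \<psi> \<psi>' \<longleftrightarrow> (\<forall>x. 0 \<le> \<psi> x) \<and> (\<forall>x. (\<psi> has_real_derivative \<psi>' x) (at x)) \<and>
     continuous_on UNIV \<psi>' \<and> (\<exists>r. \<forall>x. \<bar>x\<bar> > r \<longrightarrow> \<psi> x = 0)"

lemma C1c_nonneg_bounds:
  assumes "C1c_nonneg \<psi> \<psi>'"
  obtains r C where "r > 0" "\<And>x. \<bar>x\<bar> > r \<Longrightarrow> \<psi> x = 0 \<and> \<psi>' x = 0" "\<And>x. \<bar>\<psi> x\<bar> \<le> C \<and> \<bar>\<psi>' x\<bar> \<le> C" "C \<ge> 0"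
proof -
  from assms obtain r where d: "\<And>x. (\<psi> has_real_derivative \<psi>' x) (at x)" and c': "continuous_on UNIV \<psi>'"
    and r: "\<And>x. \<bar>x\<bar> > r \<Longrightarrow> \<psi> x = 0" unfolding C1c_nonneg_def by blast
  note c = DERIV_imp_continuous_on_UNIV[of \<psi> \<psi>', OF d]
  have z: "\<psi>' x = 0" if "\<bar>x\<bar> > r" for x
  proof -
    have "((\<lambda>_. 0) has_real_derivative \<psi>' x) (at x)"
      by (rule has_field_derivative_transform_within_open[OF d, of "{x. \<bar>x\<bar> > r}"])
        (use that r in \<open>auto intro!: open_Collect_less continuous_intros\<close>)
    then show ?thesis using DERIV_unique DERIV_const by blast
  qed
  define \<rho> where "\<rho> = max r 1"
  have bd: "\<exists>c\<ge>0. \<forall>x. \<bar>g x\<bar> \<le> c" if "continuous_on UNIV g" "\<And>x. \<bar>x\<bar> > \<rho> \<Longrightarrow> g x = 0" for g :: "real \<Rightarrow> real"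
  proof -
    have "compact (g ` {-\<rho>..\<rho>})"
      by (rule compact_continuous_image) (use that in \<open>auto intro: continuous_on_subset\<close>)
    then obtain c where c: "\<And>y. y \<in> g ` {-\<rho>..\<rho>} \<Longrightarrow> \<bar>y\<bar> \<le> c"
      using compact_imp_bounded bounded_iff by (metis real_norm_def)
    have "\<bar>g x\<bar> \<le> max c 0" for x
    proof (cases "\<bar>x\<bar> > \<rho>")
      case False
      then have "g x \<in> g ` {-\<rho>..\<rho>}" by (intro imageI) auto
      then show ?thesis using c by (simp add: le_max_iff_disj)
    qed (simp add: that(2))
    then show ?thesis by (intro exI[of _ "max c 0"]) auto
  qed
  obtain c1 c2 where "\<And>x. \<bar>\<psi> x\<bar> \<le> c1" "\<And>x. \<bar>\<psi>' x\<bar> \<le> c2" "c1 \<ge> 0"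
    using bd[OF c] bd[OF c'] r z by (auto simp: \<rho>_def)
  then show thesis
    using that[of \<rho> "max c1 c2"] r z by (auto simp: \<rho>_def le_max_iff_disj)
qed

text \<open>Linear growth of h has to be allowed because the flux in the similarity variable
  contains the term \<open>x * \<eta> x\<close>.\<close>

lemma integrable_C1c_mult:
  fixes h :: "real \<Rightarrow> real"
  assumes psi: "C1c_nonneg \<psi> \<psi>'" and h: "h \<in> borel_measurable borel" "\<And>x. \<bar>h x\<bar> \<le> A + B * \<bar>x\<bar>"
  shows "integrable lborel (\<lambda>x. h x * \<psi> x)" "integrable lborel (\<lambda>x. h x * \<psi>' x)"
proof -
  from C1c_nonneg_bounds[OF psi] obtain r C where r: "r > 0" "\<And>x. \<bar>x\<bar> > r \<Longrightarrow> \<psi> x = 0 \<and> \<psi>' x = 0"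
    "\<And>x. \<bar>\<psi> x\<bar> \<le> C \<and> \<bar>\<psi>' x\<bar> \<le> C" "C \<ge> 0" by metis
  from psi have "continuous_on UNIV \<psi>" "continuous_on UNIV \<psi>'"
    unfolding C1c_nonneg_def using DERIV_imp_continuous_on_UNIV[of \<psi> \<psi>'] by blast+
  then have [measurable]: "\<psi> \<in> borel_measurable borel" "\<psi>' \<in> borel_measurable borel"
    by (auto intro: borel_measurable_continuous_onI)
  have "integrable lborel (\<lambda>x. h x * g x)" if g: "g \<in> borel_measurable borel" "\<And>x. \<bar>x\<bar> > r \<Longrightarrow> g x = 0" "\<And>x. \<bar>g x\<bar> \<le> C" for g
  proof (rule integrable_lborel_bounded_support[where a = "-r" and b = r and C = "(\<bar>A\<bar> + \<bar>B\<bar> * r) * C"])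
    show "(\<lambda>x. h x * g x) \<in> borel_measurable borel" using h g by measurable
    show "\<bar>h x * g x\<bar> \<le> (\<bar>A\<bar> + \<bar>B\<bar> * r) * C" for x
    proof (cases "\<bar>x\<bar> > r")
      case True
      then show ?thesis using g(2)[of x] r by simp
    next
      case False
      have "\<bar>h x\<bar> \<le> \<bar>A\<bar> + \<bar>B\<bar> * \<bar>x\<bar>"
        using h(2)[of x] mult_right_mono[OF abs_ge_self[of B] abs_ge_zero[of x]] by linarith
      also have "\<dots> \<le> \<bar>A\<bar> + \<bar>B\<bar> * r" using False by (intro add_left_mono mult_left_mono) auto
      finally show ?thesis unfolding abs_mult using g(3)[of x] r by (intro mult_mono) auto
    qed
    show "h x * g x = 0" if "x \<notin> cbox (-r) r" for x
    proof -
      have "\<bar>x\<bar> > r" using that by auto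
      then show ?thesis using g(2) by simp
    qed
  qed
  then show "integrable lborel (\<lambda>x. h x * \<psi> x)" "integrable lborel (\<lambda>x. h x * \<psi>' x)"
    using r by auto
qed

text \<open>A weak form of \<open>P' + \<eta> \<le> 0\<close>, as satisfied by the entropy defects of a self-similar solution.\<close>

locale weak_entropy_pair =
  fixes P \<eta> :: "real \<Rightarrow> real" and C M :: real
  assumes P_measurable [measurable]: "P \<in> borel_measurable borel"
    and \<eta>_measurable [measurable]: "\<eta> \<in> borel_measurable borel"
    and \<eta>0: "0 \<le> \<eta> x" and \<eta>C: "\<eta> x \<le> C"
    and M: "0 \<le> M" and PM: "\<bar>P x\<bar> \<le> (\<bar>x\<bar> + M) * \<eta> x"
    and ent: "C1c_nonneg \<psi> \<psi>' \<Longrightarrow> 0 \<le> (\<integral>x. P x * \<psi>' x - \<eta> x * \<psi> x \<partial>lborel)"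
begin

lemma C0: "0 \<le> C"
  using \<eta>0[of 0] \<eta>C[of 0] by linarith

text \<open>The growth |x| + M of P relative to \<eta> is exactly what the weight compensates: P
  times the weight is bounded by C, uniformly in x.\<close>

lemma integrable_weighted_defect:
  assumes R': "continuous_on UNIV R'" "\<And>x. \<bar>x\<bar> > r \<Longrightarrow> R' x = 0"
  shows "integrable lborel (\<lambda>x. P x * decay_weight M x * R' x)"
proof -
  let ?L = "decay_weight M"
  note contL = DERIV_imp_continuous_on_UNIV[of ?L "decay_weight' M", OF decay_weight(1)[OF M]]
  have [measurable]: "R' \<in> borel_measurable borel" "?L \<in> borel_measurable borel"
    using contL R'(1) by (auto intro: borel_measurable_continuous_onI)
  have "continuous_on {-\<bar>r\<bar>..\<bar>r\<bar>} R'" using R'(1) continuous_on_subset by blast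
  from compact_imp_bounded[OF compact_continuous_image[OF this compact_Icc]]
  obtain b where b: "\<And>x. \<bar>x\<bar> \<le> \<bar>r\<bar> \<Longrightarrow> \<bar>R' x\<bar> \<le> b" by (force simp: bounded_iff abs_le_iff)
  show ?thesis
  proof (rule integrable_lborel_bounded_support[where a = "-\<bar>r\<bar>" and b = "\<bar>r\<bar>" and C = "C * \<bar>b\<bar>"])
    show "\<bar>P x * ?L x * R' x\<bar> \<le> C * \<bar>b\<bar>" for x
    proof (cases "\<bar>x\<bar> \<le> \<bar>r\<bar>")
      case True
      have "\<bar>P x * ?L x\<bar> \<le> ((\<bar>x\<bar> + M) * \<eta> x) * ?L x"
        unfolding abs_mult using PM[of x] decay_weight(3)[OF M, of x] by (intro mult_mono) auto
      also have "\<dots> = ((\<bar>x\<bar> + M) * ?L x) * \<eta> x" by simp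
      also have "\<dots> \<le> 1 * C" using decay_weight(3,5)[OF M, of x] \<eta>0 \<eta>C M by (intro mult_mono) auto
      finally show ?thesis using b[OF True] C0 unfolding abs_mult[of _ "R' x"] by (intro mult_mono) auto
    next
      case False
      then show ?thesis using R'(2)[of x] C0 by simp
    qed
  next
    show "P x * ?L x * R' x = 0" if "x \<notin> cbox (-\<bar>r\<bar>) \<bar>r\<bar>" for x
      using that R'(2)[of x] by (auto simp: abs_if split: if_splits)
  qed measurable
qed

text \<open>Testing with \<open>decay_weight M * R\<close>, cut off far away, makes \<open>P * decay_weight' M\<close> absorbable by
  \<open>\<eta> * decay_weight M\<close>; the cutoff costs only an average of \<open>\<eta> * R\<close>.\<close>

lemma weighted_entropy_estimate:
  assumes R: "\<And>x. (R has_real_derivative R' x) (at x)" "continuous_on UNIV R'" "\<And>x. 0 \<le> R x" "\<And>x. R x \<le> 1"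
    and R': "\<And>x. \<bar>x\<bar> > r \<Longrightarrow> R' x = 0"
    and avg: "((\<lambda>S. (1 / S) * (LBINT x:{-S..S}. \<eta> x * R x)) \<longlongrightarrow> 0) at_top"
  shows "(LBINT x:{-n..n}. \<eta> x * R x * (decay_weight M x - (\<bar>x\<bar> + M) * \<bar>decay_weight' M x\<bar>))
     \<le> (\<integral>x. P x * decay_weight M x * R' x \<partial>lborel)" (is "?lhs \<le> ?rhs")
proof -
  let ?L = "decay_weight M" and ?L' = "decay_weight' M"
  obtain \<sigma> \<sigma>' :: "real \<Rightarrow> real" and B where \<sigma>: "\<And>x. (\<sigma> has_real_derivative \<sigma>' x) (at x)" "continuous_on UNIV \<sigma>'"
    "\<And>x. 0 \<le> \<sigma> x" "\<And>x. \<sigma> x \<le> 1" "\<And>x. x \<le> 0 \<Longrightarrow> \<sigma> x = 0" "\<And>x. x \<ge> 1 \<Longrightarrow> \<sigma> x = 1"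
    "\<And>x. 0 \<le> \<sigma>' x" "\<And>x. \<sigma>' x \<le> B" "\<And>x. x \<le> 0 \<Longrightarrow> \<sigma>' x = 0" "\<And>x. x \<ge> 1 \<Longrightarrow> \<sigma>' x = 0"
    using C1_step_function by metis
  have B0: "B \<ge> 0" using \<sigma>(7,8)[of 0] by linarith
  note contR = DERIV_imp_continuous_on_UNIV[of R R', OF R(1)]
    and contL = DERIV_imp_continuous_on_UNIV[of ?L ?L', OF decay_weight(1)[OF M]]
  note contL' = decay_weight(2)[OF M]
  have [measurable]: "R \<in> borel_measurable borel" "R' \<in> borel_measurable borel" "?L \<in> borel_measurable borel" "?L' \<in> borel_measurable borel"
    using contR contL contL' R(2) by (auto intro: borel_measurable_continuous_onI)
  note Rint = integrable_weighted_defect[of R' r, OF R(2) R']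
  \<comment> \<open>The margin left once the term with L' has been absorbed by means of |P| \<le>
    (|x| + M) \<eta>.\<close>
  define d where "d x = ?L x - (\<bar>x\<bar> + M) * \<bar>?L' x\<bar>" for x
  have d0: "0 \<le> d x" "d x \<le> 1" for x
    using decay_weight(4,6)[OF M, of x] M by (auto simp: d_def) (smt (verit) mult_nonneg_nonneg)
  have [measurable]: "d \<in> borel_measurable borel" unfolding d_def[abs_def] by measurable
  have \<eta>Rint: "set_integrable lborel {-S..S} (\<lambda>x. \<eta> x * R x * g x)"
    if "g \<in> borel_measurable borel" "\<And>x. 0 \<le> g x" "\<And>x. g x \<le> 1" for S g
    unfolding set_integrable_def
  proof (rule integrable_lborel_bounded_support[where a = "-S" and b = S and C = "C * 1 * 1"])
    show "(\<lambda>x. indicator {- S..S} x *\<^sub>R (\<eta> x * R x * g x)) \<in> borel_measurable borel" using that by measurable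
    have "\<bar>\<eta> x * R x * g x\<bar> \<le> C * 1 * 1" for x
      unfolding abs_mult using that \<eta>0 \<eta>C R(3,4) C0 by (intro mult_mono) auto
    then show "\<bar>indicator {- S..S} x *\<^sub>R (\<eta> x * R x * g x)\<bar> \<le> C * 1 * 1" for x
      using C0 by (auto simp: indicator_def)
  qed (auto simp: indicator_def)
  \<comment> \<open>The price of the cutoff: its slope is at most 2B/S, it acts within [-2S,2S], and
    |P L| \<le> \<eta>.\<close>
  define e where "e S = (2 * B / S) * (LBINT x:{-(2*S)..2*S}. \<eta> x * R x)" for S
  have main: "?lhs \<le> ?rhs + e S" if S: "S > 0" "S > \<bar>n\<bar>" "S > \<bar>r\<bar>" for S
  proof -
    have Snz: "S \<noteq> 0" using S by simp
    \<comment> \<open>The cutoff is 1 on [-S,S] and 0 outside [-2S,2S]. As S exceeds |n| and |r|, it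
      is invisible both on \<open>{-n..n}\<close> and where R' is nonzero.\<close>
    define X where "X x = \<sigma> (2 - x / S) * \<sigma> (2 + x / S)" for x
    define X' where "X' x = (\<sigma> (2 - x / S) * \<sigma>' (2 + x / S) - \<sigma>' (2 - x / S) * \<sigma> (2 + x / S)) / S" for x
    have dX: "(X has_real_derivative X' x) (at x)" for x
    proof -
      have 1: "((\<lambda>x. \<sigma> (2 + x / S)) has_real_derivative \<sigma>' (2 + x / S) * (1 / S)) (at x)"
        by (rule DERIV_chain2[OF \<sigma>(1)]) (auto intro!: derivative_eq_intros simp: Snz)
      have 2: "((\<lambda>x. \<sigma> (2 - x / S)) has_real_derivative \<sigma>' (2 - x / S) * (- (1 / S))) (at x)"
        by (rule DERIV_chain2[OF \<sigma>(1)]) (auto intro!: derivative_eq_intros simp: Snz)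
      show ?thesis unfolding X_def[abs_def] X'_def
        by (rule DERIV_cong[OF DERIV_mult[OF 2 1]]) (simp add: diff_divide_distrib algebra_simps)
    qed
    have X01: "0 \<le> X x" "X x \<le> 1" for x using \<sigma>(3,4) by (auto simp: X_def mult_le_one)
    have X1: "X x = 1" "X' x = 0" if "\<bar>x\<bar> \<le> S" for x
    proof -
      have "2 - x / S \<ge> 1" "2 + x / S \<ge> 1" using that S by (auto simp: field_simps abs_le_iff)
      then show "X x = 1" "X' x = 0" using \<sigma> by (auto simp: X_def X'_def)
    qed
    have X0: "X x = 0 \<and> X' x = 0" if "\<bar>x\<bar> > 2 * S" for x
    proof -
      have "2 - x / S \<le> 0 \<or> 2 + x / S \<le> 0" using that S by (auto simp: field_simps abs_if split: if_splits)
      then show ?thesis using \<sigma> by (auto simp: X_def X'_def)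
    qed
    have X'B: "\<bar>X' x\<bar> \<le> 2 * B / S" for x
    proof -
      have "\<bar>\<sigma> u * \<sigma>' w\<bar> \<le> 1 * B" for u w unfolding abs_mult using \<sigma>(3,4,7,8) by (intro mult_mono) auto
      from this[of "2 - x / S" "2 + x / S"] this[of "2 + x / S" "2 - x / S"]
      have "\<bar>\<sigma> (2 - x / S) * \<sigma>' (2 + x / S) - \<sigma>' (2 - x / S) * \<sigma> (2 + x / S)\<bar> \<le> 2 * B"
        by (simp add: mult.commute)
      then show ?thesis using S by (simp add: X'_def abs_divide divide_right_mono)
    qed
    note contX = DERIV_imp_continuous_on_UNIV[of X X', OF dX]
      and cont\<sigma> = DERIV_imp_continuous_on_UNIV[of \<sigma> \<sigma>', OF \<sigma>(1)]
    have contX': "continuous_on UNIV X'"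
      unfolding X'_def[abs_def]
      by (intro continuous_intros continuous_on_compose2[OF cont\<sigma>] continuous_on_compose2[OF \<sigma>(2)])
        (simp_all add: Snz)
    define \<psi> where "\<psi> x = ?L x * (X x * R x)" for x
    define \<psi>' where "\<psi>' x = ?L x * (X x * R' x + X' x * R x) + ?L' x * (X x * R x)" for x
    have C1: "C1c_nonneg \<psi> \<psi>'"
      unfolding C1c_nonneg_def
    proof (intro conjI allI)
      show "0 \<le> \<psi> x" for x using decay_weight(3)[OF M, of x] X01 R(3) by (simp add: \<psi>_def)
      show "(\<psi> has_real_derivative \<psi>' x) (at x)" for x
        unfolding \<psi>_def[abs_def] \<psi>'_def
        by (rule DERIV_cong[OF DERIV_mult[OF decay_weight(1)[OF M] DERIV_mult[OF dX R(1)]]]) (simp add: algebra_simps)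
      show "continuous_on UNIV \<psi>'" unfolding \<psi>'_def[abs_def]
        by (intro continuous_intros contL contL' contX contX' contR R(2))
      show "\<exists>r. \<forall>x. \<bar>x\<bar> > r \<longrightarrow> \<psi> x = 0" using X0 by (auto simp: \<psi>_def)
    qed
    have Pb: "\<bar>P x\<bar> \<le> M * C + C * \<bar>x\<bar>" for x
    proof -
      have "(\<bar>x\<bar> + M) * \<eta> x \<le> (\<bar>x\<bar> + M) * C" using \<eta>C M by (intro mult_left_mono) auto
      then show ?thesis using PM[of x] by (simp add: algebra_simps)
    qed
    have "\<And>x. \<bar>\<eta> x\<bar> \<le> C + 0 * \<bar>x\<bar>" using \<eta>0 \<eta>C by auto
    note int1 = integrable_C1c_mult(2)[OF C1 P_measurable Pb] integrable_C1c_mult(1)[OF C1 \<eta>_measurable this]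
    note int2 = \<eta>Rint[OF \<open>d \<in> _\<close> d0, of n] \<eta>Rint[of "\<lambda>_. 1" "2 * S", simplified]
    have "0 \<le> (\<integral>x. P x * \<psi>' x - \<eta> x * \<psi> x \<partial>lborel)" by (rule ent[OF C1])
    also have "\<dots> \<le> (\<integral>x. P x * ?L x * R' x - indicator {-n..n} x *\<^sub>R (\<eta> x * R x * d x)
        + (2 * B / S) * (indicator {-(2*S)..2*S} x *\<^sub>R (\<eta> x * R x)) \<partial>lborel)"
    proof (rule integral_mono)
      show "integrable lborel (\<lambda>x. P x * \<psi>' x - \<eta> x * \<psi> x)" using int1 by (rule Bochner_Integration.integrable_diff)
      show "integrable lborel (\<lambda>x. P x * ?L x * R' x - indicator {-n..n} x *\<^sub>R (\<eta> x * R x * d x)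
        + (2 * B / S) * (indicator {-(2*S)..2*S} x *\<^sub>R (\<eta> x * R x)))"
        using Rint int2 unfolding set_integrable_def
        by (intro Bochner_Integration.integrable_add Bochner_Integration.integrable_diff integrable_mult_right)
      fix x
      have e: "P x * \<psi>' x - \<eta> x * \<psi> x = P x * ?L x * R' x * X x + P x * ?L x * X' x * R x
          + (P x * ?L' x - \<eta> x * ?L x) * (X x * R x)"
        by (simp add: \<psi>_def \<psi>'_def algebra_simps)
      have e1: "P x * ?L x * R' x * X x = P x * ?L x * R' x"
        using R'[of x] X1(1)[of x] S by (cases "\<bar>x\<bar> \<le> S") auto
      have e2: "P x * ?L x * X' x * R x \<le> (2 * B / S) * (indicator {-(2*S)..2*S} x *\<^sub>R (\<eta> x * R x))"
      proof (cases "x \<in> {-(2*S)..2*S}")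
        case True
        have "P x * ?L x * X' x * R x \<le> \<bar>P x\<bar> * ?L x * \<bar>X' x\<bar> * R x"
          using abs_ge_self[of "P x * ?L x * X' x * R x"] decay_weight(3)[OF M, of x] R(3)[of x] by (simp add: abs_mult)
        also have "\<dots> \<le> ((\<bar>x\<bar> + M) * \<eta> x) * ?L x * (2 * B / S) * R x"
          using PM X'B R(3) decay_weight(3)[OF M, of x] \<eta>0 M B0 S(1) by (intro mult_mono mult_nonneg_nonneg) auto
        also have "\<dots> = ((\<bar>x\<bar> + M) * ?L x) * (\<eta> x * (2 * B / S) * R x)" by simp
        also have "\<dots> \<le> 1 * (\<eta> x * (2 * B / S) * R x)"
          using decay_weight(5)[OF M, of x] \<eta>0 B0 S R(3) by (intro mult_right_mono) auto
        finally show ?thesis using True by (simp add: mult_ac)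
      next
        case False
        then have "X' x = 0" using X0[of x] by (auto simp: abs_if split: if_splits)
        then show ?thesis using False by simp
      qed
      have "P x * ?L' x - \<eta> x * ?L x \<le> - (\<eta> x * d x)"
      proof -
        have "P x * ?L' x \<le> \<bar>P x\<bar> * \<bar>?L' x\<bar>" by (metis abs_ge_self abs_mult)
        also have "\<dots> \<le> ((\<bar>x\<bar> + M) * \<eta> x) * \<bar>?L' x\<bar>" using PM by (intro mult_right_mono) auto
        finally show ?thesis by (simp add: d_def algebra_simps)
      qed
      from mult_right_mono[OF this, of "X x * R x"]
      have "(P x * ?L' x - \<eta> x * ?L x) * (X x * R x) \<le> - (\<eta> x * d x) * (X x * R x)"
        using X01 R(3) by simp
      also have "\<dots> \<le> - (indicator {-n..n} x *\<^sub>R (\<eta> x * R x * d x))"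
      proof (cases "x \<in> {-n..n}")
        case True
        then have "\<bar>x\<bar> \<le> S" using S by auto
        then show ?thesis using True X1 by simp
      next
        case False
        then show ?thesis using \<eta>0 d0 X01 R(3) by simp
      qed
      finally show "P x * \<psi>' x - \<eta> x * \<psi> x \<le> P x * ?L x * R' x - indicator {-n..n} x *\<^sub>R (\<eta> x * R x * d x)
        + (2 * B / S) * (indicator {-(2*S)..2*S} x *\<^sub>R (\<eta> x * R x))"
        unfolding e e1 using e2 by linarith
    qed
    also have "\<dots> = ?rhs - ?lhs + e S"
      using Rint int2 unfolding set_integrable_def
      by (simp add: set_lebesgue_integral_def e_def d_def)
    finally show ?thesis by simp
  qed
  \<comment> \<open>Since 2B/S = 4B/(2S), the price \<open>e S\<close> is 4B times the quantity in
    \<open>avg\<close> taken at 2S.\<close>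
  have "filterlim (\<lambda>S::real. 2 * S) at_top at_top"
    by (rule filterlim_tendsto_pos_mult_at_top[OF tendsto_const _ filterlim_ident]) simp
  from tendsto_mult[OF tendsto_const[of "4 * B"] filterlim_compose[OF avg this]]
  have "((\<lambda>S. (4 * B) * ((1 / (2 * S)) * (LBINT x:{-(2*S)..2*S}. \<eta> x * R x))) \<longlongrightarrow> 0) at_top" by simp
  moreover have "(\<lambda>S. (4 * B) * ((1 / (2 * S)) * (LBINT x:{-(2*S)..2*S}. \<eta> x * R x))) = e"
    by (auto simp: e_def)
  ultimately have "(e \<longlongrightarrow> 0) at_top" by simp
  then have "((\<lambda>S. ?rhs + e S) \<longlongrightarrow> ?rhs + 0) at_top" by (intro tendsto_intros)
  moreover have "\<forall>\<^sub>F S in at_top. ?lhs \<le> ?rhs + e S"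
    using eventually_gt_at_top[of "\<bar>n\<bar> + \<bar>r\<bar>"] by eventually_elim (rule main; linarith)
  ultimately have "?lhs \<le> ?rhs + 0" by (rule tendsto_lowerbound) simp
  then show ?thesis by simp
qed

end

subsection \<open>Weak entropy inequalities of Riemann solutions\<close>

lemma integral_deriv_compact_support:
  fixes g g' :: "real \<Rightarrow> real"
  assumes d: "\<And>x. (g has_real_derivative g' x) (at x)" and c: "continuous_on UNIV g'"
    and z: "\<And>x. \<bar>x\<bar> > r \<Longrightarrow> g x = 0 \<and> g' x = 0"
  shows "(\<integral>x. g' x \<partial>lborel) = 0"
proof -
  define s where "s = \<bar>r\<bar> + 1"
  have "(\<integral>x. indicator {-s..s} x *\<^sub>R g' x \<partial>lborel) = g s - g (-s)"
    by (rule integral_FTC_atLeastAtMost)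
      (use d c in \<open>auto simp: s_def has_real_derivative_iff_has_vector_derivative[symmetric]
        intro: has_field_derivative_at_within continuous_on_subset\<close>)
  also have "\<dots> = 0" using z[of s] z[of "-s"] by (simp add: s_def)
  also have "(\<lambda>x. indicator {-s..s} x *\<^sub>R g' x) = g'"
  proof
    fix x show "indicator {-s..s} x *\<^sub>R g' x = g' x"
      using z[of x] by (cases "x \<in> {-s..s}") (auto simp: s_def)
  qed
  finally show ?thesis .
qed

text \<open>Products \<beta>(t) \<psi>(x/t) serve as test functions: the double integral factors
  into the integral of \<beta> and the integral over \<xi>, and the former is positive and can be
  divided out.\<close>

lemma riemann_entropy_sol_weak:
  fixes k :: real
  assumes sol: "riemann_entropy_sol F a b \<omega>" and F: "continuous_on UNIV F" and psi: "C1c_nonneg \<psi> \<psi>'"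
  defines "\<eta> \<equiv> \<lambda>x. \<bar>\<omega> x - k\<bar>" and "q \<equiv> \<lambda>x. sgn (\<omega> x - k) * (F (\<omega> x) - F k)"
  shows "0 \<le> (\<integral>x. (q x - x * \<eta> x) * \<psi>' x - \<eta> x * \<psi> x \<partial>lborel)" (is "0 \<le> ?I")
proof -
  from sol obtain C where [measurable]: "\<omega> \<in> borel_measurable borel" and C: "\<And>x. \<bar>\<omega> x\<bar> \<le> C"
    and ent: "\<And>k \<phi> \<phi>t \<phi>x. test_fun \<phi> \<phi>t \<phi>x \<Longrightarrow> 0 \<le> integral\<^sup>L lborel (\<lambda>(t, x).
           \<bar>\<omega> (x / t) - k\<bar> * \<phi>t (t, x) + sgn (\<omega> (x / t) - k) * (F (\<omega> (x / t)) - F k) * \<phi>x (t, x))"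
    unfolding riemann_entropy_sol_def by blast
  have [measurable]: "F \<in> borel_measurable borel" using F by (rule borel_measurable_continuous_onI)
  have "continuous_on {-C..C} F" using F continuous_on_subset by blast
  from compact_imp_bounded[OF compact_continuous_image[OF this compact_Icc]]
  obtain B where B: "\<And>y. \<bar>y\<bar> \<le> C \<Longrightarrow> \<bar>F y\<bar> \<le> B" by (force simp: bounded_iff abs_le_iff)
  have \<eta>C: "\<bar>\<eta> x\<bar> \<le> C + \<bar>k\<bar> + B + \<bar>F k\<bar>" for x
    using C[of x] B[OF C[of x]] by (simp add: \<eta>_def)
  have qC: "\<bar>q x\<bar> \<le> C + \<bar>k\<bar> + B + \<bar>F k\<bar>" for x
  proof -
    have "\<bar>F (\<omega> x) - F k\<bar> \<le> C + \<bar>k\<bar> + B + \<bar>F k\<bar>" using C[of x] B[OF C[of x]] by linarith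
    then show ?thesis by (auto simp: q_def abs_mult sgn_if)
  qed
  obtain \<sigma> \<sigma>' :: "real \<Rightarrow> real" and S where \<sigma>: "\<And>x. (\<sigma> has_real_derivative \<sigma>' x) (at x)" "continuous_on UNIV \<sigma>'"
    "\<And>x. 0 \<le> \<sigma> x" "\<And>x. \<sigma> x \<le> 1" "\<And>x. x \<le> 0 \<Longrightarrow> \<sigma> x = 0" "\<And>x. x \<ge> 1 \<Longrightarrow> \<sigma> x = 1"
    "\<And>x. 0 \<le> \<sigma>' x" "\<And>x. \<sigma>' x \<le> S" "\<And>x. x \<le> 0 \<Longrightarrow> \<sigma>' x = 0" "\<And>x. x \<ge> 1 \<Longrightarrow> \<sigma>' x = 0"
    using C1_step_function by metis
  note cont\<sigma> = DERIV_imp_continuous_on_UNIV[of \<sigma> \<sigma>', OF \<sigma>(1)]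
  \<comment> \<open>A bump supported in [1,4] and equal to 1 on [2,3]: its integral is at least 1,
    and its support stays away from t = 0.\<close>
  define \<beta> where "\<beta> t = \<sigma> (t - 1) * \<sigma> (4 - t)" for t
  define \<beta>' where "\<beta>' t = \<sigma>' (t - 1) * \<sigma> (4 - t) - \<sigma> (t - 1) * \<sigma>' (4 - t)" for t
  have d\<beta>: "(\<beta> has_real_derivative \<beta>' t) (at t)" for t
  proof -
    have 1: "((\<lambda>t. \<sigma> (t - 1)) has_real_derivative \<sigma>' (t - 1) * 1) (at t)"
      by (rule DERIV_chain2[OF \<sigma>(1)]) (auto intro!: derivative_eq_intros)
    have 2: "((\<lambda>t. \<sigma> (4 - t)) has_real_derivative \<sigma>' (4 - t) * (- 1)) (at t)"
      by (rule DERIV_chain2[OF \<sigma>(1)]) (auto intro!: derivative_eq_intros)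
    show ?thesis unfolding \<beta>_def[abs_def] \<beta>'_def
      by (rule DERIV_cong[OF DERIV_mult[OF 1 2]]) simp
  qed
  note cont\<beta> = DERIV_imp_continuous_on_UNIV[of \<beta> \<beta>', OF d\<beta>]
  have cont\<beta>': "continuous_on UNIV \<beta>'" unfolding \<beta>'_def[abs_def]
    by (intro continuous_intros continuous_on_compose2[OF cont\<sigma>] continuous_on_compose2[OF \<sigma>(2)]) auto
  have \<beta>01: "0 \<le> \<beta> t" "\<beta> t \<le> 1" for t using \<sigma>(3,4) by (auto simp: \<beta>_def mult_le_one)
  have \<beta>0: "\<beta> t = 0 \<and> \<beta>' t = 0" if "t \<le> 1 \<or> t \<ge> 4" for t using that \<sigma>(5,9) by (auto simp: \<beta>_def \<beta>'_def)
  have \<beta>1: "\<beta> t = 1" if "2 \<le> t" "t \<le> 3" for t using that \<sigma>(6) by (simp add: \<beta>_def)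
  from psi have psi0: "\<And>x. 0 \<le> \<psi> x" and d\<psi>: "\<And>x. (\<psi> has_real_derivative \<psi>' x) (at x)" and cont\<psi>': "continuous_on UNIV \<psi>'"
    unfolding C1c_nonneg_def by blast+
  note cont\<psi> = DERIV_imp_continuous_on_UNIV[of \<psi> \<psi>', OF d\<psi>]
  from C1c_nonneg_bounds[OF psi] obtain r where r: "r > 0" "\<And>x. \<bar>x\<bar> > r \<Longrightarrow> \<psi> x = 0 \<and> \<psi>' x = 0" by metis
  define \<phi> where "\<phi> p = \<beta> (fst p) * \<psi> (snd p / fst p)" for p
  define \<phi>t where "\<phi>t p = \<beta>' (fst p) * \<psi> (snd p / fst p) - \<beta> (fst p) * \<psi>' (snd p / fst p) * (snd p / (fst p)\<^sup>2)" for p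
  define \<phi>x where "\<phi>x p = \<beta> (fst p) * \<psi>' (snd p / fst p) / fst p" for p
  \<comment> \<open>Two open half planes covering the plane. On U the quotient x/t is regular; on V,
    which contains t = 0, the factors \<beta> and \<beta>' annihilate everything.\<close>
  define U where "U = {p :: real \<times> real. fst p > 0}"
  define V where "V = {p :: real \<times> real. fst p < 1}"
  have oU: "open U" and oV: "open V" and UV: "U \<union> V = UNIV"
    unfolding U_def V_def by (auto intro!: open_Collect_less continuous_intros)
  have V0: "\<phi> p = 0" "\<phi>t p = 0" "\<phi>x p = 0" if "p \<in> V" for p
    using that \<beta>0[of "fst p"] by (auto simp: V_def \<phi>_def \<phi>t_def \<phi>x_def)
  have "test_fun \<phi> \<phi>t \<phi>x"
    unfolding test_fun_def
  proof (intro conjI allI)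
    show "0 \<le> \<phi> p" for p using \<beta>01 psi0 by (simp add: \<phi>_def)
    have "continuous_on U \<phi>t" unfolding \<phi>t_def[abs_def]
      by (intro continuous_intros continuous_on_compose2[OF cont\<beta>] continuous_on_compose2[OF cont\<beta>']
          continuous_on_compose2[OF cont\<psi>] continuous_on_compose2[OF cont\<psi>']) (auto simp: U_def)
    moreover have "continuous_on V \<phi>t" using V0 by (simp cong: continuous_on_cong)
    ultimately show "continuous_on UNIV \<phi>t" using continuous_on_open_Un[OF oU oV] UV by metis
    have "continuous_on U \<phi>x" unfolding \<phi>x_def[abs_def]
      by (intro continuous_intros continuous_on_compose2[OF cont\<beta>] continuous_on_compose2[OF cont\<beta>']
          continuous_on_compose2[OF cont\<psi>] continuous_on_compose2[OF cont\<psi>']) (auto simp: U_def)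
    moreover have "continuous_on V \<phi>x" using V0 by (simp cong: continuous_on_cong)
    ultimately show "continuous_on UNIV \<phi>x" using continuous_on_open_Un[OF oU oV] UV by metis
  next
    fix p :: "real \<times> real"
    show "(\<phi> has_derivative (\<lambda>(dt, dx). \<phi>t p * dt + \<phi>x p * dx)) (at p)"
    proof (cases "p \<in> V")
      case True
      then have "(\<lambda>(dt, dx). \<phi>t p * dt + \<phi>x p * dx) = (\<lambda>_. 0)" using V0 by auto
      moreover have "(\<phi> has_derivative (\<lambda>_. 0)) (at p)"
        by (rule has_derivative_transform_within_open[of "\<lambda>_. 0", OF _ oV True]) (use V0 in auto)
      ultimately show ?thesis by simp
    next
      case False
      then have p: "fst p \<noteq> 0" by (auto simp: V_def)
      have 1: "(\<beta> has_derivative (\<lambda>h. \<beta>' (fst p) * h)) (at (fst p))"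
        using d\<beta> unfolding has_field_derivative_def .
      have 2: "(\<psi> has_derivative (\<lambda>h. \<psi>' (snd p / fst p) * h)) (at (snd p / fst p))"
        using d\<psi> unfolding has_field_derivative_def .
      have 3: "((\<lambda>p. \<beta> (fst p)) has_derivative (\<lambda>h. \<beta>' (fst p) * fst h)) (at p)"
        by (rule has_derivative_compose[OF has_derivative_fst[OF has_derivative_ident] 1])
      have "((\<lambda>p. snd p / fst p) has_derivative (\<lambda>h. - snd p * (inverse (fst p) * fst h * inverse (fst p)) + snd h / fst p)) (at p)"
        by (rule has_derivative_divide[OF has_derivative_snd[OF has_derivative_ident] has_derivative_fst[OF has_derivative_ident] p])
      from has_derivative_compose[OF this 2]
      have 4: "((\<lambda>p. \<psi> (snd p / fst p)) has_derivative (\<lambda>h. \<psi>' (snd p / fst p) * (- snd p * (inverse (fst p) * fst h * inverse (fst p)) + snd h / fst p))) (at p)" .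
      show ?thesis
        unfolding \<phi>_def[abs_def]
        by (rule has_derivative_eq_rhs[OF has_derivative_mult[OF 3 4]])
          (use p in \<open>auto simp: fun_eq_iff \<phi>t_def \<phi>x_def field_simps power2_eq_square\<close>)
    qed
  next
    show "\<exists>K. compact K \<and> K \<subseteq> {p. 0 < fst p} \<and> (\<forall>p. p \<notin> K \<longrightarrow> \<phi> p = 0)"
    proof (intro exI conjI allI impI)
      \<comment> \<open>The spatial bound comes from |x/t| \<le> r and t \<le> 4.\<close>
      show "compact ({1..4::real} \<times> {-(4*r)..4*r})" by (intro compact_Times compact_Icc)
      show "{1..4::real} \<times> {-(4*r)..4*r} \<subseteq> {p. 0 < fst p}" by auto
      fix p :: "real \<times> real" assume p: "p \<notin> {1..4::real} \<times> {-(4*r)..4*r}"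
      show "\<phi> p = 0"
      proof (cases "fst p \<le> 1 \<or> fst p \<ge> 4")
        case True
        then show ?thesis using \<beta>0 by (simp add: \<phi>_def)
      next
        case False
        with p have s: "\<bar>snd p\<bar> > 4 * r" by (cases p) (auto simp: abs_if split: if_splits)
        have "r * fst p \<le> r * 4" using False r by (intro mult_left_mono) auto
        then have "\<bar>snd p / fst p\<bar> > r" using s False by (simp add: abs_divide pos_less_divide_eq)
        then show ?thesis using r by (simp add: \<phi>_def)
      qed
    qed
  qed
  note test = this
  have "0 \<le> integral\<^sup>L lborel (\<lambda>(t, x). \<eta> (x / t) * \<phi>t (t, x) + q (x / t) * \<phi>x (t, x))"
    using ent[OF test, of k] by (simp add: \<eta>_def q_def)
  also have "\<dots> = (\<integral>t. (\<integral>\<xi>. (q \<xi> - \<xi> * \<eta> \<xi>) * (t * \<phi>x (t, t * \<xi>)) - \<eta> \<xi> * \<phi> (t, t * \<xi>) \<partial>lborel) \<partial>lborel)"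
    by (rule selfsimilar_weak_integral[OF _ _ \<eta>C qC test]) (simp_all add: \<eta>_def[abs_def] q_def[abs_def])
  also have "\<dots> = (\<integral>t. \<beta> t * ?I \<partial>lborel)"
  proof (rule Bochner_Integration.integral_cong[OF refl])
    fix t :: real
    show "(\<integral>\<xi>. (q \<xi> - \<xi> * \<eta> \<xi>) * (t * \<phi>x (t, t * \<xi>)) - \<eta> \<xi> * \<phi> (t, t * \<xi>) \<partial>lborel) = \<beta> t * ?I"
    proof (cases "t \<le> 1")
      case True
      then show ?thesis using \<beta>0[of t] by (simp add: \<phi>_def \<phi>x_def)
    next
      case False
      then have "(\<integral>\<xi>. (q \<xi> - \<xi> * \<eta> \<xi>) * (t * \<phi>x (t, t * \<xi>)) - \<eta> \<xi> * \<phi> (t, t * \<xi>) \<partial>lborel)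
        = (\<integral>\<xi>. \<beta> t * ((q \<xi> - \<xi> * \<eta> \<xi>) * \<psi>' \<xi> - \<eta> \<xi> * \<psi> \<xi>) \<partial>lborel)"
        by (intro Bochner_Integration.integral_cong) (auto simp: \<phi>_def \<phi>x_def algebra_simps)
      then show ?thesis by simp
    qed
  qed
  also have "\<dots> = (\<integral>t. \<beta> t \<partial>lborel) * ?I" by simp
  finally have "0 \<le> (\<integral>t. \<beta> t \<partial>lborel) * ?I" .
  moreover have "1 \<le> (\<integral>t. \<beta> t \<partial>lborel)"
  proof -
    have "(\<integral>t. indicator {2..3::real} t \<partial>lborel) \<le> (\<integral>t. \<beta> t \<partial>lborel)"
    proof (rule integral_mono)
      show "integrable lborel (indicator {2..3::real} :: real \<Rightarrow> real)" by (simp add: integrable_indicator_iff)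
      show "integrable lborel \<beta>"
        by (rule integrable_lborel_bounded_support[where a = 1 and b = 4 and C = 1])
          (use cont\<beta> \<beta>01 \<beta>0 in \<open>auto intro: borel_measurable_continuous_onI\<close>)
      show "indicator {2..3} t \<le> \<beta> t" for t using \<beta>1 \<beta>01 by (auto simp: indicator_def)
    qed
    then show ?thesis by simp
  qed
  ultimately show ?thesis by (simp add: zero_le_mult_iff)
qed

text \<open>max 0 (y - k) is half of |y - k| + (y - k). The linear half comes from the Kruzhkov
  inequality for a constant below the range of \<omega>, corrected by multiples of the integrals of
  \<psi>' and of the derivative of x \<psi>, which vanish. One-sided pairs permit comparison with a
  single Riemann state.\<close>

lemma riemann_entropy_sol_weak_pos:
  fixes k :: real
  assumes sol: "riemann_entropy_sol F a b \<omega>" and F: "continuous_on UNIV F" and psi: "C1c_nonneg \<psi> \<psi>'"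
  defines "\<eta> \<equiv> \<lambda>x. max 0 (\<omega> x - k)" and "P \<equiv> \<lambda>x. if \<omega> x > k then F (\<omega> x) - F k - x * (\<omega> x - k) else 0"
  shows "0 \<le> (\<integral>x. P x * \<psi>' x - \<eta> x * \<psi> x \<partial>lborel)"
proof -
  from sol obtain C where [measurable]: "\<omega> \<in> borel_measurable borel" and C: "\<And>x. \<bar>\<omega> x\<bar> \<le> C"
    unfolding riemann_entropy_sol_def by blast
  have C0: "C \<ge> 0" using C[of 0] by linarith
  have [measurable]: "F \<in> borel_measurable borel" using F by (rule borel_measurable_continuous_onI)
  have "continuous_on {-C..C} F" using F continuous_on_subset by blast
  from compact_imp_bounded[OF compact_continuous_image[OF this compact_Icc]]
  obtain B where B: "\<And>y. \<bar>y\<bar> \<le> C \<Longrightarrow> \<bar>F y\<bar> \<le> B" by (force simp: bounded_iff abs_le_iff)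
  from psi have d\<psi>: "\<And>x. (\<psi> has_real_derivative \<psi>' x) (at x)" and cont\<psi>': "continuous_on UNIV \<psi>'"
    unfolding C1c_nonneg_def by blast+
  note cont\<psi> = DERIV_imp_continuous_on_UNIV[of \<psi> \<psi>', OF d\<psi>]
  from C1c_nonneg_bounds[OF psi] obtain r where r: "\<And>x. \<bar>x\<bar> > r \<Longrightarrow> \<psi> x = 0 \<and> \<psi>' x = 0" by metis
  have i1: "(\<integral>x. \<psi>' x \<partial>lborel) = 0"
    by (rule integral_deriv_compact_support[OF d\<psi> cont\<psi>' r])
  have i2: "(\<integral>x. \<psi> x + x * \<psi>' x \<partial>lborel) = 0"
  proof (rule integral_deriv_compact_support[of "\<lambda>x. x * \<psi> x"])
    show "((\<lambda>x. x * \<psi> x) has_real_derivative \<psi> x + x * \<psi>' x) (at x)" for x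
      by (rule DERIV_cong[OF DERIV_mult[OF DERIV_ident d\<psi>]]) simp
    show "continuous_on UNIV (\<lambda>x. \<psi> x + x * \<psi>' x)" by (intro continuous_intros cont\<psi> cont\<psi>')
  qed (use r in auto)
  define e where "e c x = (sgn (\<omega> x - c) * (F (\<omega> x) - F c) - x * \<bar>\<omega> x - c\<bar>) * \<psi>' x - \<bar>\<omega> x - c\<bar> * \<psi> x" for c x
  have e0: "0 \<le> (\<integral>x. e c x \<partial>lborel)" for c
    using riemann_entropy_sol_weak[OF sol F psi, of c] by (simp add: e_def)
  have inte: "integrable lborel (e c)" for c
    unfolding e_def
  proof (intro Bochner_Integration.integrable_diff integrable_C1c_mult[OF psi])
    fix x
    show "\<bar>sgn (\<omega> x - c) * (F (\<omega> x) - F c) - x * \<bar>\<omega> x - c\<bar>\<bar> \<le> (B + \<bar>F c\<bar>) + (C + \<bar>c\<bar>) * \<bar>x\<bar>"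
    proof -
      have "\<bar>sgn (\<omega> x - c) * (F (\<omega> x) - F c)\<bar> \<le> B + \<bar>F c\<bar>"
      proof -
        have "\<bar>F (\<omega> x) - F c\<bar> \<le> B + \<bar>F c\<bar>" using B[OF C[of x]] by linarith
        then show ?thesis by (auto simp: abs_mult sgn_if)
      qed
      moreover have "\<bar>x * \<bar>\<omega> x - c\<bar>\<bar> \<le> (C + \<bar>c\<bar>) * \<bar>x\<bar>"
        unfolding abs_mult mult.commute[of "\<bar>x\<bar>"] using C[of x] by (intro mult_right_mono) auto
      ultimately show ?thesis by linarith
    qed
    show "\<bar>\<bar>\<omega> x - c\<bar>\<bar> \<le> (C + \<bar>c\<bar>) + 0 * \<bar>x\<bar>" using C[of x] by simp
  qed measurable
  have int\<psi>: "integrable lborel \<psi>'" "integrable lborel (\<lambda>x. \<psi> x + x * \<psi>' x)"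
    using integrable_C1c_mult[OF psi, of "\<lambda>_. 1" 1 0] integrable_C1c_mult[OF psi, of "\<lambda>x. x" 0 1]
    by (auto intro: Bochner_Integration.integrable_add)
  \<comment> \<open>One more than the bound of |\<omega>|, so that \<omega> + K > 0 everywhere and
    the sign in \<open>e (- K)\<close> is 1.\<close>
  define K where "K = C + 1"
  have "0 \<le> (\<integral>x. e k x \<partial>lborel) + (\<integral>x. e (- K) x \<partial>lborel)" using e0 by (simp add: add_nonneg_nonneg)
  also have "\<dots> = (\<integral>x. e k x + e (- K) x + (F (- K) - F k) * \<psi>' x + (K + k) * (\<psi> x + x * \<psi>' x) \<partial>lborel)"
    using inte int\<psi> i1 i2 by simp
  also have "\<dots> = (\<integral>x. 2 * (P x * \<psi>' x - \<eta> x * \<psi> x) \<partial>lborel)"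
  proof (rule Bochner_Integration.integral_cong[OF refl])
    fix x
    have "\<omega> x + K > 0" using C[of x] by (auto simp: K_def)
    then show "e k x + e (- K) x + (F (- K) - F k) * \<psi>' x + (K + k) * (\<psi> x + x * \<psi>' x) = 2 * (P x * \<psi>' x - \<eta> x * \<psi> x)"
      by (auto simp: e_def P_def \<eta>_def sgn_if abs_if max_def algebra_simps)
  qed
  also have "\<dots> = 2 * (\<integral>x. P x * \<psi>' x - \<eta> x * \<psi> x \<partial>lborel)" by (rule integral_mult_right_zero)
  finally show ?thesis by simp
qed

text \<open>Negation turns the flux F into -F(-u) and the Kruzhkov constant k into -k. It yields
  lower bounds from upper bounds and decreasing data from increasing ones.\<close>

lemma riemann_entropy_sol_uminus:
  assumes "riemann_entropy_sol F a b \<omega>"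
  shows "riemann_entropy_sol (\<lambda>u. - F (- u)) (- a) (- b) (\<lambda>x. - \<omega> x)"
  unfolding riemann_entropy_sol_def
proof (intro conjI allI impI)
  show "(\<lambda>x. - \<omega> x) \<in> borel_measurable borel" "\<exists>C. \<forall>\<xi>. \<bar>- \<omega> \<xi>\<bar> \<le> C"
    using assms unfolding riemann_entropy_sol_def by auto
next
  fix k \<phi> \<phi>t \<phi>x assume "test_fun \<phi> \<phi>t \<phi>x"
  then have "0 \<le> integral\<^sup>L lborel (\<lambda>(t, x). \<bar>\<omega> (x / t) - (- k)\<bar> * \<phi>t (t, x)
           + sgn (\<omega> (x / t) - (- k)) * (F (\<omega> (x / t)) - F (- k)) * \<phi>x (t, x))"
    using assms unfolding riemann_entropy_sol_def by blast
  also have "(\<lambda>(t, x). \<bar>\<omega> (x / t) - (- k)\<bar> * \<phi>t (t, x)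
           + sgn (\<omega> (x / t) - (- k)) * (F (\<omega> (x / t)) - F (- k)) * \<phi>x (t, x)) =
      (\<lambda>(t, x). \<bar>- \<omega> (x / t) - k\<bar> * \<phi>t (t, x)
           + sgn (- \<omega> (x / t) - k) * (- F (- (- \<omega> (x / t))) - - F (- k)) * \<phi>x (t, x))"
  proof -
    have "\<bar>y - (- k)\<bar> = \<bar>- y - k\<bar>"
      "sgn (y - (- k)) * (F y - F (- k)) = sgn (- y - k) * (- F (- (- y)) - - F (- k))" for y
      by (auto simp: sgn_if abs_if)
    then show ?thesis by (simp only:)
  qed
  finally show "0 \<le> integral\<^sup>L lborel (\<lambda>(t, x). \<bar>- \<omega> (x / t) - k\<bar> * \<phi>t (t, x)
           + sgn (- \<omega> (x / t) - k) * (- F (- (- \<omega> (x / t))) - - F (- k)) * \<phi>x (t, x))" .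
next
  fix R :: real assume "R > 0"
  have "\<bar>- \<omega> (x / t) - (if x < 0 then - a else - b)\<bar> = \<bar>\<omega> (x / t) - (if x < 0 then a else b)\<bar>" for x t :: real
    by auto
  then show "((\<lambda>t. LBINT x:{- R..R}. \<bar>- \<omega> (x / t) - (if x < 0 then - a else - b)\<bar>) \<longlongrightarrow> 0) (at_right 0)"
    using assms \<open>R > 0\<close> unfolding riemann_entropy_sol_def by simp
qed

text \<open>The jump data are invariant under scaling, so the initial condition on [-1,1] at time t
  = 1/S becomes, after rescaling x, twice a mean over [-S,S].\<close>

lemma riemann_entropy_sol_average:
  assumes sol: "riemann_entropy_sol F a b \<omega>"
  shows "((\<lambda>S. (1 / S) * (LBINT x:{-S..S}. \<bar>\<omega> x - (if x < 0 then a else b)\<bar>)) \<longlongrightarrow> 0) at_top"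
proof -
  from sol have "((\<lambda>t. LBINT x:{-1..1}. \<bar>\<omega> (x / t) - (if x < 0 then a else b)\<bar>) \<longlongrightarrow> 0) (at_right 0)"
    unfolding riemann_entropy_sol_def by auto
  from filterlim_compose[OF this filterlim_inverse_at_right_top]
  have "((\<lambda>S. LBINT x:{-1..1}. \<bar>\<omega> (x / inverse S) - (if x < 0 then a else b)\<bar>) \<longlongrightarrow> 0) at_top" .
  moreover have "\<forall>\<^sub>F S in at_top. (LBINT x:{-1..1}. \<bar>\<omega> (x / inverse S) - (if x < 0 then a else b)\<bar>)
     = (1 / S) * (LBINT x:{-S..S}. \<bar>\<omega> x - (if x < 0 then a else b)\<bar>)"
    using eventually_gt_at_top[of 0]
  proof eventually_elim
    case (elim S)
    have "(LBINT x:{-S..S}. \<bar>\<omega> x - (if x < 0 then a else b)\<bar>)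
      = \<bar>S\<bar> *\<^sub>R (\<integral>x. indicator {-S..S} (0 + S * x) *\<^sub>R \<bar>\<omega> (0 + S * x) - (if 0 + S * x < 0 then a else b)\<bar> \<partial>lborel)"
      unfolding set_lebesgue_integral_def
      by (rule lborel_integral_real_affine) (use elim in simp)
    also have "(\<integral>x. indicator {-S..S} (0 + S * x) *\<^sub>R \<bar>\<omega> (0 + S * x) - (if 0 + S * x < 0 then a else b)\<bar> \<partial>lborel)
       = (LBINT x:{-1..1}. \<bar>\<omega> (x / inverse S) - (if x < 0 then a else b)\<bar>)"
      unfolding set_lebesgue_integral_def
    proof (rule Bochner_Integration.integral_cong[OF refl])
      fix x
      have "S * x \<le> S \<longleftrightarrow> x \<le> 1" "- S \<le> S * x \<longleftrightarrow> - 1 \<le> x" "S * x < 0 \<longleftrightarrow> x < 0"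
        using mult_le_cancel_left_pos[OF elim, of x 1] mult_le_cancel_left_pos[OF elim, of "-1" x] elim
        by (auto simp: mult_less_0_iff)
      then show "indicator {-S..S} (0 + S * x) *\<^sub>R \<bar>\<omega> (0 + S * x) - (if 0 + S * x < 0 then a else b)\<bar>
        = indicator {-1..1} x *\<^sub>R \<bar>\<omega> (x / inverse S) - (if x < 0 then a else b)\<bar>"
        by (simp add: indicator_def divide_inverse mult.commute)
    qed
    finally show ?case using elim by simp
  qed
  ultimately show ?thesis by (rule Lim_transform_eventually)
qed

subsection \<open>The trace of a Riemann solution\<close>

text \<open>A term with finite integral contributes O(1/S), so domination by D is required only off
  a bounded interval.\<close>

lemma average_tendsto_0_dominated:
  fixes h D :: "real \<Rightarrow> real"
  assumes h: "h \<in> borel_measurable borel" and D: "D \<in> borel_measurable borel"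
    and h0: "\<And>x. 0 \<le> h x" and DB: "\<And>x. \<bar>D x\<bar> \<le> B"
    and le: "\<And>x. h x \<le> D x + c * indicator {-\<delta>..\<delta>} x"
    and avg: "((\<lambda>S. (1 / S) * (LBINT x:{-S..S}. D x)) \<longlongrightarrow> 0) at_top"
  shows "((\<lambda>S. (1 / S) * (LBINT x:{-S..S}. h x)) \<longlongrightarrow> 0) at_top"
proof -
  let ?I = "\<lambda>x. \<bar>c\<bar> * indicator {-\<delta>..\<delta>} x :: real"
  have le': "h x \<le> D x + ?I x" for x using le[of x] by (auto simp: indicator_def split: if_splits)
  have hB: "\<bar>h x\<bar> \<le> B + \<bar>c\<bar>" for x
  proof -
    have "?I x \<le> \<bar>c\<bar>" by (simp add: indicator_def)
    then show ?thesis using le'[of x] h0[of x] DB[of x] by linarith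
  qed
  have intI: "integrable lborel ?I"
    by (rule integrable_lborel_bounded_support[where a = "-\<delta>" and b = \<delta> and C = "\<bar>c\<bar>"]) (auto simp: indicator_def)
  have up: "(LBINT x:{-S..S}. h x) \<le> (LBINT x:{-S..S}. D x) + (\<integral>x. ?I x \<partial>lborel)" for S
  proof -
    note i = set_integrable_bounded[OF h hB, of "-S" S] set_integrable_bounded[OF D DB, of "-S" S]
    have "(LBINT x:{-S..S}. h x) \<le> (\<integral>x. indicator {-S..S} x *\<^sub>R D x + ?I x \<partial>lborel)"
      unfolding set_lebesgue_integral_def
    proof (rule integral_mono)
      show "indicator {-S..S} x *\<^sub>R h x \<le> indicator {-S..S} x *\<^sub>R D x + ?I x" for x
        using le'[of x] by (auto simp: indicator_def split: if_splits)
    qed (use i intI in \<open>auto simp: set_integrable_def intro: Bochner_Integration.integrable_add\<close>)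
    then show ?thesis
      using i intI by (simp add: set_lebesgue_integral_def set_integrable_def)
  qed
  have "((\<lambda>S::real. (1 / S) * (\<integral>x. ?I x \<partial>lborel)) \<longlongrightarrow> 0 * (\<integral>x. ?I x \<partial>lborel)) at_top"
    by (intro tendsto_intros tendsto_divide_0[OF tendsto_const] filterlim_at_top_imp_at_infinity filterlim_ident)
  from tendsto_add[OF avg this]
  have lim: "((\<lambda>S. (1 / S) * (LBINT x:{-S..S}. D x) + (1 / S) * (\<integral>x. ?I x \<partial>lborel)) \<longlongrightarrow> 0) at_top" by simp
  show ?thesis
  proof (rule tendsto_sandwich[OF _ _ tendsto_const lim])
    show "\<forall>\<^sub>F S in at_top. 0 \<le> (1 / S) * (LBINT x:{-S..S}. h x)"
      using eventually_gt_at_top[of 0] by eventually_elim (auto simp: set_lebesgue_integral_def h0)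
    show "\<forall>\<^sub>F S in at_top. (1 / S) * (LBINT x:{-S..S}. h x) \<le> (1 / S) * (LBINT x:{-S..S}. D x) + (1 / S) * (\<integral>x. ?I x \<partial>lborel)"
      using eventually_gt_at_top[of 0]
      by eventually_elim (unfold distrib_left[symmetric], rule mult_left_mono[OF up], simp)
  qed
qed

context weak_entropy_pair
begin

text \<open>The weighted estimate with R = 1 has right side 0, so \<eta> times the positive margin
  integrates to 0 over every \<open>{-n..n}\<close>.\<close>

lemma AE_\<eta>_eq_0:
  assumes D: "D \<in> borel_measurable borel" "\<And>x. \<bar>D x\<bar> \<le> B"
    and le: "\<And>x. \<eta> x \<le> D x"
    and avg: "((\<lambda>S. (1 / S) * (LBINT x:{-S..S}. D x)) \<longlongrightarrow> 0) at_top"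
  shows "AE x in lborel. \<eta> x = 0"
proof -
  let ?d = "\<lambda>x. decay_weight M x - (\<bar>x\<bar> + M) * \<bar>decay_weight' M x\<bar>"
  have d: "0 < ?d x" "?d x \<le> 1" for x
  proof -
    have "0 \<le> (\<bar>x\<bar> + M) * \<bar>decay_weight' M x\<bar>" using M by simp
    then show "0 < ?d x" "?d x \<le> 1" using decay_weight(4,6)[OF M, of x] by linarith+
  qed
  have [measurable]: "decay_weight M \<in> borel_measurable borel" "decay_weight' M \<in> borel_measurable borel"
    using DERIV_imp_continuous_on_UNIV[of "decay_weight M" "decay_weight' M", OF decay_weight(1)[OF M]] decay_weight(2)[OF M]
    by (auto intro: borel_measurable_continuous_onI)
  have avg\<eta>: "((\<lambda>S. (1 / S) * (LBINT x:{-S..S}. \<eta> x * 1)) \<longlongrightarrow> 0) at_top"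
    by (rule average_tendsto_0_dominated[of _ D B 0 0, OF _ D(1) _ D(2) _ avg]) (use \<eta>0 le in auto)
  have "AE x in lborel. indicator {- real n..real n} x *\<^sub>R (\<eta> x * ?d x) = 0" for n
  proof (subst integral_nonneg_eq_0_iff_AE[symmetric])
    have "(LBINT x:{- real n..real n}. \<eta> x * 1 * ?d x) \<le> (\<integral>x. P x * decay_weight M x * 0 \<partial>lborel)"
      by (rule weighted_entropy_estimate[of "\<lambda>_. 1" "\<lambda>_. 0" 0, OF _ _ _ _ _ avg\<eta>]) auto
    moreover have "0 \<le> (LBINT x:{- real n..real n}. \<eta> x * 1 * ?d x)"
      unfolding set_lebesgue_integral_def using \<eta>0 d(1)[THEN less_imp_le]
      by (intro integral_nonneg_AE always_eventually allI scaleR_nonneg_nonneg mult_nonneg_nonneg) auto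
    ultimately show "(\<integral>x. indicator {- real n..real n} x *\<^sub>R (\<eta> x * ?d x) \<partial>lborel) = 0"
      by (simp add: set_lebesgue_integral_def)
    show "AE x in lborel. 0 \<le> indicator {- real n..real n} x *\<^sub>R (\<eta> x * ?d x)"
      using \<eta>0 d(1)[THEN less_imp_le]
      by (intro always_eventually allI scaleR_nonneg_nonneg mult_nonneg_nonneg) auto
    have b: "\<bar>\<eta> x * ?d x\<bar> \<le> C * 1" for x
      unfolding abs_mult using \<eta>0[of x] \<eta>C[of x] d[of x] C0 by (intro mult_mono) auto
    have "(\<lambda>x. \<eta> x * ?d x) \<in> borel_measurable borel" by measurable
    from set_integrable_bounded[OF this b]
    show "integrable lborel (\<lambda>x. indicator {- real n..real n} x *\<^sub>R (\<eta> x * ?d x))" by (simp add: set_integrable_def)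
  qed
  then have "AE x in lborel. \<forall>n. indicator {- real n..real n} x *\<^sub>R (\<eta> x * ?d x) = 0"
    unfolding AE_all_countable by blast
  then show ?thesis
  proof eventually_elim
    case (elim x)
    obtain n where "\<bar>x\<bar> \<le> real n" using real_arch_simple by blast
    then show ?case using elim[rule_format, of n] d(1)[of x] by (auto simp: indicator_def abs_le_iff)
  qed
qed

text \<open>The right side of the weighted estimate is nonnegative; yet R' lives on (0,\<delta>),
  where a strictly negative P R' would make that integral negative.\<close>

lemma no_strict_sign_right:
  assumes D: "D \<in> borel_measurable borel" "\<And>x. \<bar>D x\<bar> \<le> B"
    and avg: "((\<lambda>S. (1 / S) * (LBINT x:{-S..S}. D x)) \<longlongrightarrow> 0) at_top"
    and R: "\<And>x. (R has_real_derivative R' x) (at x)" "continuous_on UNIV R'" "\<And>x. 0 \<le> R x" "\<And>x. R x \<le> 1"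
    and R': "\<And>x. x \<le> 0 \<or> x \<ge> \<delta> \<Longrightarrow> R' x = 0" and \<delta>: "\<delta> > 0"
    and le: "\<And>x. \<eta> x * R x \<le> D x + C * indicator {-\<delta>..\<delta>} x"
    and neg: "AE x in lborel. 0 < x \<and> x < \<delta> \<longrightarrow> P x * R' x < 0"
  shows False
proof -
  have [measurable]: "R \<in> borel_measurable borel"
    using DERIV_imp_continuous_on_UNIV[of R R', OF R(1)] by (rule borel_measurable_continuous_onI)
  have avg\<eta>: "((\<lambda>S. (1 / S) * (LBINT x:{-S..S}. \<eta> x * R x)) \<longlongrightarrow> 0) at_top"
    by (rule average_tendsto_0_dominated[of _ D B C \<delta>, OF _ D(1) _ D(2) le avg]) (use \<eta>0 R in auto)
  have R'0: "R' x = 0" if "\<bar>x\<bar> > \<delta>" for x using that \<delta> R' by (auto simp: abs_if split: if_splits)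
  let ?f = "\<lambda>x. P x * decay_weight M x * R' x"
  \<comment> \<open>With n = 0 the left side is an integral over a point; only the sign of the right
    side is wanted.\<close>
  have "(LBINT x:{-0..0}. \<eta> x * R x * (decay_weight M x - (\<bar>x\<bar> + M) * \<bar>decay_weight' M x\<bar>)) \<le> (\<integral>x. ?f x \<partial>lborel)"
    by (rule weighted_entropy_estimate[of R R' \<delta>, OF R R'0 avg\<eta>])
  moreover have "(LBINT x:{-0..0}. \<eta> x * R x * (decay_weight M x - (\<bar>x\<bar> + M) * \<bar>decay_weight' M x\<bar>)) = 0"
  proof -
    have "AE x in lborel. x \<noteq> (0::real)" by (rule AE_lborel_singleton)
    then have "AE x in lborel. indicator {-0..0} x *\<^sub>R (\<eta> x * R x * (decay_weight M x - (\<bar>x\<bar> + M) * \<bar>decay_weight' M x\<bar>)) = 0"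
      by eventually_elim auto
    then show ?thesis unfolding set_lebesgue_integral_def by (rule integral_eq_zero_AE)
  qed
  ultimately have f0: "0 \<le> (\<integral>x. ?f x \<partial>lborel)" by simp
  have fneg: "AE x in lborel. 0 < x \<and> x < \<delta> \<longrightarrow> ?f x < 0"
    using neg
  proof eventually_elim
    case (elim x)
    have "?f x = P x * R' x * decay_weight M x" by simp
    then show ?case using elim mult_neg_pos[OF _ decay_weight(3)[OF M, of x]] by presburger
  qed
  then have fle: "AE x in lborel. 0 \<le> - ?f x"
  proof eventually_elim
    case (elim x)
    then show ?case using R'[of x] by (cases "0 < x \<and> x < \<delta>") auto
  qed
  have int: "integrable lborel ?f" by (rule integrable_weighted_defect[of R' \<delta>, OF R(2) R'0])
  have "0 \<le> (\<integral>x. - ?f x \<partial>lborel)" by (rule integral_nonneg_AE[OF fle])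
  then have "(\<integral>x. - ?f x \<partial>lborel) = 0" using f0 by simp
  then have "AE x in lborel. - ?f x = 0"
    using integral_nonneg_eq_0_iff_AE[of lborel "\<lambda>x. - ?f x"] int fle by simp
  with fneg have "AE x in lborel. \<not> (0 < x \<and> x < \<delta>)" by eventually_elim auto
  from AE_ex_in_Ioo[OF this \<delta>] show False by blast
qed

text \<open>R descends from 1 to 0 across (0,\<delta>). Beyond \<delta> it switches the estimate
  off, so \<eta> has to be dominated by D only for negative x; on (0,\<delta>) R' < 0, so P > 0
  almost everywhere would give the forbidden sign.\<close>

lemma not_AE_pos_right:
  assumes D: "D \<in> borel_measurable borel" "\<And>x. \<bar>D x\<bar> \<le> B" "\<And>x. 0 \<le> D x"
    and avg: "((\<lambda>S. (1 / S) * (LBINT x:{-S..S}. D x)) \<longlongrightarrow> 0) at_top"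
    and le: "\<And>x. x < 0 \<Longrightarrow> \<eta> x \<le> D x" and \<delta>: "\<delta> > 0"
  shows "\<not> (AE x in lborel. 0 < x \<and> x < \<delta> \<longrightarrow> P x > 0)"
proof
  assume pos: "AE x in lborel. 0 < x \<and> x < \<delta> \<longrightarrow> P x > 0"
  obtain \<sigma> \<sigma>' :: "real \<Rightarrow> real" and S where \<sigma>: "\<And>x. (\<sigma> has_real_derivative \<sigma>' x) (at x)" "continuous_on UNIV \<sigma>'"
    "\<And>x. 0 \<le> \<sigma> x" "\<And>x. \<sigma> x \<le> 1" "\<And>x. x \<le> 0 \<Longrightarrow> \<sigma> x = 0" "\<And>x. 0 < x \<Longrightarrow> x < 1 \<Longrightarrow> 0 < \<sigma>' x"
    "\<And>x. x \<le> 0 \<Longrightarrow> \<sigma>' x = 0" "\<And>x. x \<ge> 1 \<Longrightarrow> \<sigma>' x = 0"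
    using C1_step_function by metis
  define R where "R x = \<sigma> (1 - x / \<delta>)" for x
  define R' where "R' x = - (\<sigma>' (1 - x / \<delta>) / \<delta>)" for x
  show False
  proof (rule no_strict_sign_right[of D B R R' \<delta>, OF D(1,2) avg])
    show "(R has_real_derivative R' x) (at x)" for x
    proof -
      have "((\<lambda>x. \<sigma> (1 - x / \<delta>)) has_real_derivative \<sigma>' (1 - x / \<delta>) * (- (1 / \<delta>))) (at x)"
        by (rule DERIV_chain2[OF \<sigma>(1)]) (use \<delta> in \<open>auto intro!: derivative_eq_intros\<close>)
      then show ?thesis by (simp add: R_def[abs_def] R'_def)
    qed
    show "continuous_on UNIV R'"
      unfolding R'_def[abs_def] using \<delta> by (intro continuous_intros continuous_on_compose2[OF \<sigma>(2)]) auto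
    show "0 \<le> R x" "R x \<le> 1" for x using \<sigma> by (auto simp: R_def)
    show "R' x = 0" if "x \<le> 0 \<or> x \<ge> \<delta>" for x
      using that \<delta> \<sigma>(7,8) by (auto simp: R'_def divide_nonpos_pos)
    show "\<eta> x * R x \<le> D x + C * indicator {-\<delta>..\<delta>} x" for x
    proof (cases "x < 0")
      case True
      have "\<eta> x * R x \<le> \<eta> x" using \<eta>0[of x] \<sigma>(3,4) by (auto simp: R_def intro: mult_left_le)
      also have "\<dots> \<le> D x" by (rule le[OF True])
      finally show ?thesis using C0 by (simp add: indicator_def)
    next
      case False
      show ?thesis
      proof (cases "x \<le> \<delta>")
        case True
        have "\<eta> x * R x \<le> \<eta> x" using \<eta>0[of x] \<sigma>(3,4) by (auto simp: R_def intro: mult_left_le)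
        then show ?thesis using True False \<eta>C[of x] D(3)[of x] \<delta> by simp
      next
        case False
        then have "R x = 0" using \<delta> \<sigma>(5) by (simp add: R_def)
        then show ?thesis using C0 D(3)[of x] by (simp add: indicator_def)
      qed
    qed
    show "AE x in lborel. 0 < x \<and> x < \<delta> \<longrightarrow> P x * R' x < 0"
      using pos
    proof eventually_elim
      case (elim x)
      show ?case
      proof
        assume x: "0 < x \<and> x < \<delta>"
        then have "0 < \<sigma>' (1 - x / \<delta>)" using \<delta> by (intro \<sigma>(6)) auto
        then show "P x * R' x < 0" using elim x \<delta> by (simp add: R'_def mult_pos_neg)
      qed
    qed
  qed (fact \<delta>)
qed

text \<open>Mirror image: R ascends from 0 to 1 across (0,\<delta>), so domination is needed for
  positive x, and P < 0 gives the forbidden sign.\<close>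

lemma not_AE_neg_right:
  assumes D: "D \<in> borel_measurable borel" "\<And>x. \<bar>D x\<bar> \<le> B" "\<And>x. 0 \<le> D x"
    and avg: "((\<lambda>S. (1 / S) * (LBINT x:{-S..S}. D x)) \<longlongrightarrow> 0) at_top"
    and le: "\<And>x. x > 0 \<Longrightarrow> \<eta> x \<le> D x" and \<delta>: "\<delta> > 0"
  shows "\<not> (AE x in lborel. 0 < x \<and> x < \<delta> \<longrightarrow> P x < 0)"
proof
  assume neg: "AE x in lborel. 0 < x \<and> x < \<delta> \<longrightarrow> P x < 0"
  obtain \<sigma> \<sigma>' :: "real \<Rightarrow> real" and S where \<sigma>: "\<And>x. (\<sigma> has_real_derivative \<sigma>' x) (at x)" "continuous_on UNIV \<sigma>'"
    "\<And>x. 0 \<le> \<sigma> x" "\<And>x. \<sigma> x \<le> 1" "\<And>x. x \<le> 0 \<Longrightarrow> \<sigma> x = 0" "\<And>x. 0 < x \<Longrightarrow> x < 1 \<Longrightarrow> 0 < \<sigma>' x"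
    "\<And>x. x \<le> 0 \<Longrightarrow> \<sigma>' x = 0" "\<And>x. x \<ge> 1 \<Longrightarrow> \<sigma>' x = 0"
    using C1_step_function by metis
  define R where "R x = \<sigma> (x / \<delta>)" for x
  define R' where "R' x = \<sigma>' (x / \<delta>) / \<delta>" for x
  show False
  proof (rule no_strict_sign_right[of D B R R' \<delta>, OF D(1,2) avg])
    show "(R has_real_derivative R' x) (at x)" for x
    proof -
      have "((\<lambda>x. \<sigma> (x / \<delta>)) has_real_derivative \<sigma>' (x / \<delta>) * (1 / \<delta>)) (at x)"
        by (rule DERIV_chain2[OF \<sigma>(1)]) (use \<delta> in \<open>auto intro!: derivative_eq_intros\<close>)
      then show ?thesis by (simp add: R_def[abs_def] R'_def)
    qed
    show "continuous_on UNIV R'"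
      unfolding R'_def[abs_def] using \<delta> by (intro continuous_intros continuous_on_compose2[OF \<sigma>(2)]) auto
    show "0 \<le> R x" "R x \<le> 1" for x using \<sigma> by (auto simp: R_def)
    show "R' x = 0" if "x \<le> 0 \<or> x \<ge> \<delta>" for x
      using that \<delta> \<sigma>(7,8) by (auto simp: R'_def divide_nonpos_pos)
    show "\<eta> x * R x \<le> D x + C * indicator {-\<delta>..\<delta>} x" for x
    proof (cases "x > 0")
      case True
      have "\<eta> x * R x \<le> \<eta> x" using \<eta>0[of x] \<sigma>(3,4) by (auto simp: R_def intro: mult_left_le)
      also have "\<dots> \<le> D x" by (rule le[OF True])
      finally show ?thesis using C0 by (simp add: indicator_def)
    next
      case False
      then have "R x = 0" using \<delta> \<sigma>(5) by (simp add: R_def divide_nonpos_pos)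
      then show ?thesis using C0 D(3)[of x] by (simp add: indicator_def)
    qed
    show "AE x in lborel. 0 < x \<and> x < \<delta> \<longrightarrow> P x * R' x < 0"
      using neg
    proof eventually_elim
      case (elim x)
      show ?case
      proof
        assume x: "0 < x \<and> x < \<delta>"
        then have "0 < \<sigma>' (x / \<delta>)" using \<delta> by (intro \<sigma>(6)) auto
        then show "P x * R' x < 0" using elim x \<delta> by (simp add: R'_def mult_neg_pos divide_neg_pos)
      qed
    qed
  qed (fact \<delta>)
qed

end

section \<open>Locally Lipschitz fluxes and one-sided entropies at the trace\<close>

definition locally_lipschitz :: "(real \<Rightarrow> real) \<Rightarrow> bool" where
  "locally_lipschitz F \<longleftrightarrow> (\<forall>c. \<exists>M\<ge>0. \<forall>x y. \<bar>x\<bar> \<le> c \<longrightarrow> \<bar>y\<bar> \<le> c \<longrightarrow> \<bar>F x - F y\<bar> \<le> M * \<bar>x - y\<bar>)"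

lemma locally_lipschitz_continuous:
  assumes "locally_lipschitz F"
  shows "continuous_on UNIV F"
proof (rule continuous_at_imp_continuous_on, rule ballI)
  fix x :: real
  from assms obtain M where M: "M \<ge> 0" "\<And>y z. \<bar>y\<bar> \<le> \<bar>x\<bar> + 1 \<Longrightarrow> \<bar>z\<bar> \<le> \<bar>x\<bar> + 1 \<Longrightarrow> \<bar>F y - F z\<bar> \<le> M * \<bar>y - z\<bar>"
    unfolding locally_lipschitz_def by meson
  have "((\<lambda>y. F y - F x) \<longlongrightarrow> 0) (at x)"
  proof (rule Lim_null_comparison)
    show "\<forall>\<^sub>F y in at x. norm (F y - F x) \<le> M * \<bar>y - x\<bar>"
      using eventually_at_ball[of 1 x UNIV]
    proof (rule eventually_mono)
      fix y assume "y \<in> ball x 1 \<and> y \<in> UNIV"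
      then have "\<bar>y\<bar> \<le> \<bar>x\<bar> + 1" by (auto simp: dist_real_def)
      then show "norm (F y - F x) \<le> M * \<bar>y - x\<bar>" using M(2)[of y x] by simp
    qed simp
    show "((\<lambda>y. M * \<bar>y - x\<bar>) \<longlongrightarrow> 0) (at x)" by (auto intro!: tendsto_eq_intros)
  qed
  then show "isCont F x" unfolding isCont_def using Lim_null by blast
qed

lemma locally_lipschitz_uminus:
  assumes "locally_lipschitz F"
  shows "locally_lipschitz (\<lambda>u. - F (- u))"
  unfolding locally_lipschitz_def
proof
  fix c
  from assms obtain M where M: "M \<ge> 0" "\<And>x y. \<bar>x\<bar> \<le> c \<Longrightarrow> \<bar>y\<bar> \<le> c \<Longrightarrow> \<bar>F x - F y\<bar> \<le> M * \<bar>x - y\<bar>"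
    unfolding locally_lipschitz_def by meson
  have "\<bar>- F (- x) - - F (- y)\<bar> \<le> M * \<bar>x - y\<bar>" if "\<bar>x\<bar> \<le> c" "\<bar>y\<bar> \<le> c" for x y
    using M(2)[of "- x" "- y"] that by (simp add: abs_minus_commute)
  then show "\<exists>M\<ge>0. \<forall>x y. \<bar>x\<bar> \<le> c \<longrightarrow> \<bar>y\<bar> \<le> c \<longrightarrow> \<bar>- F (- x) - - F (- y)\<bar> \<le> M * \<bar>x - y\<bar>"
    using M(1) by blast
qed

text \<open>M is a Lipschitz constant of F on an interval containing k and the range of \<omega>;
  wherever \<omega> > k it bounds |F(\<omega>) - F(k)| by M times the one-sided entropy.\<close>

lemma weak_entropy_pair_pos:
  fixes k :: real
  assumes sol: "riemann_entropy_sol F a b \<omega>" and F: "locally_lipschitz F"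
  obtains C M where
    "weak_entropy_pair (\<lambda>x. if \<omega> x > k then F (\<omega> x) - F k - x * (\<omega> x - k) else 0) (\<lambda>x. max 0 (\<omega> x - k)) C M"
proof -
  note cont = locally_lipschitz_continuous[OF F]
  then have [measurable]: "F \<in> borel_measurable borel" by (rule borel_measurable_continuous_onI)
  from sol obtain C where [measurable]: "\<omega> \<in> borel_measurable borel" and C: "\<And>x. \<bar>\<omega> x\<bar> \<le> C"
    unfolding riemann_entropy_sol_def by blast
  from F obtain M where M: "M \<ge> 0"
    "\<And>y z. \<bar>y\<bar> \<le> max C \<bar>k\<bar> \<Longrightarrow> \<bar>z\<bar> \<le> max C \<bar>k\<bar> \<Longrightarrow> \<bar>F y - F z\<bar> \<le> M * \<bar>y - z\<bar>"
    unfolding locally_lipschitz_def by meson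
  show thesis
  proof (rule that[of "C + \<bar>k\<bar>" M], unfold_locales)
    fix x
    show "max 0 (\<omega> x - k) \<le> C + \<bar>k\<bar>" using C[of x] by auto
    have "\<bar>F (\<omega> x) - F k\<bar> \<le> M * \<bar>\<omega> x - k\<bar>" using C[of x] by (intro M(2)) auto
    moreover have "\<bar>F (\<omega> x) - F k - x * (\<omega> x - k)\<bar> \<le> \<bar>F (\<omega> x) - F k\<bar> + \<bar>x\<bar> * \<bar>\<omega> x - k\<bar>"
      by (metis abs_mult abs_triangle_ineq4)
    ultimately show "\<bar>if \<omega> x > k then F (\<omega> x) - F k - x * (\<omega> x - k) else 0\<bar> \<le> (\<bar>x\<bar> + M) * max 0 (\<omega> x - k)"
      by (auto simp: algebra_simps)
  qed (use M riemann_entropy_sol_weak_pos[OF sol cont] in auto)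
qed

lemma riemann_average_properties:
  assumes sol: "riemann_entropy_sol F a b \<omega>"
  defines "D \<equiv> \<lambda>x. \<bar>\<omega> x - (if x < 0 then a else b)\<bar>"
  obtains B where "D \<in> borel_measurable borel" "\<And>x. \<bar>D x\<bar> \<le> B" "\<And>x. 0 \<le> D x"
    "((\<lambda>S. (1 / S) * (LBINT x:{-S..S}. D x)) \<longlongrightarrow> 0) at_top"
proof -
  from sol obtain C where [measurable]: "\<omega> \<in> borel_measurable borel" and C: "\<And>x. \<bar>\<omega> x\<bar> \<le> C"
    unfolding riemann_entropy_sol_def by blast
  show thesis
  proof (rule that[of "C + \<bar>a\<bar> + \<bar>b\<bar>"])
    show "D \<in> borel_measurable borel" unfolding D_def by measurable
    show "\<bar>D x\<bar> \<le> C + \<bar>a\<bar> + \<bar>b\<bar>" for x using C[of x] by (auto simp: D_def)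
  qed (use riemann_entropy_sol_average[OF sol] in \<open>auto simp: D_def\<close>)
qed

text \<open>For k = max a b the excess of \<omega> over k is at most the distance to a on the left
  and to b on the right, so it averages to 0 and hence vanishes by
  \<open>AE_\<eta>_eq_0\<close>.\<close>

lemma riemann_entropy_sol_AE_le_max:
  assumes sol: "riemann_entropy_sol F a b \<omega>" and F: "locally_lipschitz F"
  shows "AE x in lborel. \<omega> x \<le> max a b"
proof -
  obtain C M where "weak_entropy_pair (\<lambda>x. if \<omega> x > max a b then F (\<omega> x) - F (max a b) - x * (\<omega> x - max a b) else 0)
      (\<lambda>x. max 0 (\<omega> x - max a b)) C M"
    by (rule weak_entropy_pair_pos[OF sol F])
  then interpret weak_entropy_pair "\<lambda>x. if \<omega> x > max a b then F (\<omega> x) - F (max a b) - x * (\<omega> x - max a b) else 0"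
      "\<lambda>x. max 0 (\<omega> x - max a b)" C M .
  obtain B where D: "(\<lambda>x. \<bar>\<omega> x - (if x < 0 then a else b)\<bar>) \<in> borel_measurable borel"
    "\<And>x. \<bar>\<bar>\<omega> x - (if x < 0 then a else b)\<bar>\<bar> \<le> B"
    "((\<lambda>S. (1 / S) * (LBINT x:{-S..S}. \<bar>\<omega> x - (if x < 0 then a else b)\<bar>)) \<longlongrightarrow> 0) at_top"
    using riemann_average_properties[OF sol] by metis
  have "AE x in lborel. max 0 (\<omega> x - max a b) = 0"
    by (rule AE_\<eta>_eq_0[OF D(1,2) _ D(3)]) auto
  then show ?thesis by eventually_elim (auto simp: max_def split: if_splits)
qed

lemma riemann_entropy_sol_AE_ge_min:
  assumes sol: "riemann_entropy_sol F a b \<omega>" and F: "locally_lipschitz F"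
  shows "AE x in lborel. min a b \<le> \<omega> x"
  using riemann_entropy_sol_AE_le_max[OF riemann_entropy_sol_uminus[OF sol] locally_lipschitz_uminus[OF F]]
  by eventually_elim (auto simp: max_def min_def split: if_splits)

text \<open>By a \<le> k the excess over k is at most |\<omega> - a| for negative x, exactly the
  side on which the descending weight stays switched on.\<close>

lemma riemann_not_AE_pos_right:
  fixes k :: real
  assumes sol: "riemann_entropy_sol F a b \<omega>" and F: "locally_lipschitz F" and k: "a \<le> k" and \<delta>: "\<delta> > 0"
  shows "\<not> (AE x in lborel. 0 < x \<and> x < \<delta> \<longrightarrow> \<omega> x > k \<and> F (\<omega> x) - F k - x * (\<omega> x - k) > 0)"
proof
  assume pos: "AE x in lborel. 0 < x \<and> x < \<delta> \<longrightarrow> \<omega> x > k \<and> F (\<omega> x) - F k - x * (\<omega> x - k) > 0"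
  obtain C M where "weak_entropy_pair (\<lambda>x. if \<omega> x > k then F (\<omega> x) - F k - x * (\<omega> x - k) else 0)
      (\<lambda>x. max 0 (\<omega> x - k)) C M"
    by (rule weak_entropy_pair_pos[OF sol F])
  then interpret weak_entropy_pair "\<lambda>x. if \<omega> x > k then F (\<omega> x) - F k - x * (\<omega> x - k) else 0"
      "\<lambda>x. max 0 (\<omega> x - k)" C M .
  obtain B where D: "(\<lambda>x. \<bar>\<omega> x - (if x < 0 then a else b)\<bar>) \<in> borel_measurable borel"
    "\<And>x. \<bar>\<bar>\<omega> x - (if x < 0 then a else b)\<bar>\<bar> \<le> B"
    "((\<lambda>S. (1 / S) * (LBINT x:{-S..S}. \<bar>\<omega> x - (if x < 0 then a else b)\<bar>)) \<longlongrightarrow> 0) at_top"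
    using riemann_average_properties[OF sol] by metis
  have "\<not> (AE x in lborel. 0 < x \<and> x < \<delta> \<longrightarrow> (if \<omega> x > k then F (\<omega> x) - F k - x * (\<omega> x - k) else 0) > 0)"
    by (rule not_AE_pos_right[OF D(1,2) _ D(3) _ \<delta>]) (use k in auto)
  moreover from pos have "AE x in lborel. 0 < x \<and> x < \<delta> \<longrightarrow> (if \<omega> x > k then F (\<omega> x) - F k - x * (\<omega> x - k) else 0) > 0"
    by eventually_elim auto
  ultimately show False by blast
qed

text \<open>Here b \<le> k controls the excess for positive x, the side kept by the ascending
  weight.\<close>

lemma riemann_not_AE_neg_right:
  fixes k :: real
  assumes sol: "riemann_entropy_sol F a b \<omega>" and F: "locally_lipschitz F" and k: "b \<le> k" and \<delta>: "\<delta> > 0"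
  shows "\<not> (AE x in lborel. 0 < x \<and> x < \<delta> \<longrightarrow> \<omega> x > k \<and> F (\<omega> x) - F k - x * (\<omega> x - k) < 0)"
proof
  assume neg: "AE x in lborel. 0 < x \<and> x < \<delta> \<longrightarrow> \<omega> x > k \<and> F (\<omega> x) - F k - x * (\<omega> x - k) < 0"
  obtain C M where "weak_entropy_pair (\<lambda>x. if \<omega> x > k then F (\<omega> x) - F k - x * (\<omega> x - k) else 0)
      (\<lambda>x. max 0 (\<omega> x - k)) C M"
    by (rule weak_entropy_pair_pos[OF sol F])
  then interpret weak_entropy_pair "\<lambda>x. if \<omega> x > k then F (\<omega> x) - F k - x * (\<omega> x - k) else 0"
      "\<lambda>x. max 0 (\<omega> x - k)" C M .
  obtain B where D: "(\<lambda>x. \<bar>\<omega> x - (if x < 0 then a else b)\<bar>) \<in> borel_measurable borel"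
    "\<And>x. \<bar>\<bar>\<omega> x - (if x < 0 then a else b)\<bar>\<bar> \<le> B"
    "((\<lambda>S. (1 / S) * (LBINT x:{-S..S}. \<bar>\<omega> x - (if x < 0 then a else b)\<bar>)) \<longlongrightarrow> 0) at_top"
    using riemann_average_properties[OF sol] by metis
  have "\<not> (AE x in lborel. 0 < x \<and> x < \<delta> \<longrightarrow> (if \<omega> x > k then F (\<omega> x) - F k - x * (\<omega> x - k) else 0) < 0)"
    by (rule not_AE_neg_right[OF D(1,2) _ D(3) _ \<delta>]) (use k in auto)
  moreover from neg have "AE x in lborel. 0 < x \<and> x < \<delta> \<longrightarrow> (if \<omega> x > k then F (\<omega> x) - F k - x * (\<omega> x - k) else 0) < 0"
    by eventually_elim auto
  ultimately show False by blast
qed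

text \<open>Near 0+ the defect F(\<omega>) - F(k) - x(\<omega> - k) is close to F(l) - F(k). If this
  were positive, then for k < l the weight kept on the left excludes it; for k > l the reflected
  problem turns it into a negative defect, excluded by the weight kept on the right.\<close>

lemma riemann_trace_argmin:
  assumes sol: "riemann_entropy_sol F a b \<omega>" and F: "locally_lipschitz F" and ab: "a \<le> b"
    and l: "ess_right_lim0 \<omega> l"
  shows "l \<in> {a..b}" "k \<in> {a..b} \<Longrightarrow> F l \<le> F k" "k \<in> {a..b} \<Longrightarrow> F l = F k \<Longrightarrow> k \<le> l"
proof -
  have range: "AE x in lborel. \<omega> x \<in> {a..b}"
    using riemann_entropy_sol_AE_le_max[OF sol F] riemann_entropy_sol_AE_ge_min[OF sol F]
    by eventually_elim (use ab in auto)
  have near: "\<exists>\<delta>>0. AE x in lborel. 0 < x \<and> x < \<delta> \<longrightarrow> \<bar>\<omega> x - l\<bar> < e" if "e > 0" for e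
    using l that unfolding ess_right_lim0_def by blast
  show lab: "l \<in> {a..b}"
  proof (rule ccontr)
    assume "l \<notin> {a..b}"
    define e where "e = (if l < a then a - l else l - b)"
    have "e > 0" using \<open>l \<notin> {a..b}\<close> by (auto simp: e_def)
    from near[OF this] obtain \<delta> where \<delta>: "\<delta> > 0" "AE x in lborel. 0 < x \<and> x < \<delta> \<longrightarrow> \<bar>\<omega> x - l\<bar> < e" by blast
    from \<delta>(2) range have "AE x in lborel. \<not> (0 < x \<and> x < \<delta>)"
      by eventually_elim (use \<open>l \<notin> {a..b}\<close> in \<open>auto simp: e_def split: if_splits\<close>)
    from AE_ex_in_Ioo[OF this \<delta>(1)] show False by blast
  qed
  obtain C where C: "\<And>x. \<bar>\<omega> x\<bar> \<le> C" using sol unfolding riemann_entropy_sol_def by blast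
  have contF: "isCont F l" using locally_lipschitz_continuous[OF F] by (simp add: continuous_on_eq_continuous_at)
  have close: "\<exists>\<delta>>0. AE x in lborel. 0 < x \<and> x < \<delta> \<longrightarrow> \<bar>\<omega> x - l\<bar> < e \<and> \<bar>F (\<omega> x) - F l\<bar> < g \<and> \<bar>x * (\<omega> x - k)\<bar> < g"
    if e: "e > 0" and g: "g > 0" for e g k
  proof -
    from contF g obtain d where d: "d > 0" "\<And>y. \<bar>y - l\<bar> < d \<Longrightarrow> \<bar>F y - F l\<bar> < g"
      unfolding continuous_at_eps_delta dist_real_def by blast
    from near[of "min e d"] e d obtain \<delta> where \<delta>: "\<delta> > 0" "AE x in lborel. 0 < x \<and> x < \<delta> \<longrightarrow> \<bar>\<omega> x - l\<bar> < min e d"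
      by auto
    \<comment> \<open>A is a positive bound of |\<omega> - k|; x < g/A then makes the first-order
      term smaller than g.\<close>
    define A where "A = C + \<bar>k\<bar> + 1"
    have A: "A > 0" using C[of 0] by (simp add: A_def)
    have A': "\<bar>\<omega> x - k\<bar> \<le> A" for x using C[of x] by (simp add: A_def)
    show ?thesis
    proof (intro exI[of _ "min \<delta> (g / A)"] conjI)
      show "min \<delta> (g / A) > 0" using \<delta> g A by simp
      show "AE x in lborel. 0 < x \<and> x < min \<delta> (g / A) \<longrightarrow> \<bar>\<omega> x - l\<bar> < e \<and> \<bar>F (\<omega> x) - F l\<bar> < g \<and> \<bar>x * (\<omega> x - k)\<bar> < g"
        using \<delta>(2)
      proof (eventually_elim, intro impI)
        fix x assume h: "0 < x \<and> x < \<delta> \<longrightarrow> \<bar>\<omega> x - l\<bar> < min e d" and x: "0 < x \<and> x < min \<delta> (g / A)"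
        have "\<bar>x * (\<omega> x - k)\<bar> \<le> x * A" unfolding abs_mult using x A A' by (intro mult_mono) auto
        also have "\<dots> < g" using x A by (simp add: pos_less_divide_eq)
        finally show "\<bar>\<omega> x - l\<bar> < e \<and> \<bar>F (\<omega> x) - F l\<bar> < g \<and> \<bar>x * (\<omega> x - k)\<bar> < g"
          using h x d(2) by auto
      qed
    qed
  qed
  note sol' = riemann_entropy_sol_uminus[OF sol] and F' = locally_lipschitz_uminus[OF F]
  show min: "F l \<le> F k" if k: "k \<in> {a..b}" for k
  proof (rule ccontr)
    assume "\<not> F l \<le> F k"
    \<comment> \<open>A third of the gap: two errors of that size cannot reverse its sign.\<close>
    then have g: "(F l - F k) / 3 > 0" and "k \<noteq> l" by auto
    then have e: "\<bar>l - k\<bar> > 0" by auto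
    from close[OF e g, of k] obtain \<delta> where \<delta>: "\<delta> > 0"
      "AE x in lborel. 0 < x \<and> x < \<delta> \<longrightarrow> \<bar>\<omega> x - l\<bar> < \<bar>l - k\<bar> \<and> \<bar>F (\<omega> x) - F l\<bar> < (F l - F k) / 3 \<and> \<bar>x * (\<omega> x - k)\<bar> < (F l - F k) / 3"
      by blast
    show False
    proof (cases "k < l")
      case True
      from \<delta>(2) have "AE x in lborel. 0 < x \<and> x < \<delta> \<longrightarrow> \<omega> x > k \<and> F (\<omega> x) - F k - x * (\<omega> x - k) > 0"
        by eventually_elim (use True g in \<open>auto simp: abs_if split: if_splits\<close>)
      then show False using riemann_not_AE_pos_right[OF sol F _ \<delta>(1), of k] k by auto
    next
      case False
      from \<delta>(2) have "AE x in lborel. 0 < x \<and> x < \<delta> \<longrightarrow>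
          - \<omega> x > - k \<and> - F (- (- \<omega> x)) - - F (- (- k)) - x * (- \<omega> x - - k) < 0"
      proof (eventually_elim, intro impI)
        fix x assume *: "0 < x \<and> x < \<delta> \<longrightarrow> \<bar>\<omega> x - l\<bar> < \<bar>l - k\<bar> \<and> \<bar>F (\<omega> x) - F l\<bar> < (F l - F k) / 3 \<and> \<bar>x * (\<omega> x - k)\<bar> < (F l - F k) / 3"
          "0 < x \<and> x < \<delta>"
        define p where "p = x * (\<omega> x - k)"
        from * have "\<bar>\<omega> x - l\<bar> < \<bar>l - k\<bar>" "\<bar>F (\<omega> x) - F l\<bar> < (F l - F k) / 3" "\<bar>p\<bar> < (F l - F k) / 3"
          by (auto simp: p_def)
        then have "\<omega> x < k" "F (\<omega> x) > F l - (F l - F k) / 3" "p < (F l - F k) / 3"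
          using False \<open>k \<noteq> l\<close> by linarith+
        moreover from this g have "F k - F (\<omega> x) + p < 0" by (simp add: field_simps)
        moreover have "x * (- \<omega> x - - k) = - p" by (simp add: p_def algebra_simps)
        ultimately show "- \<omega> x > - k \<and> - F (- (- \<omega> x)) - - F (- (- k)) - x * (- \<omega> x - - k) < 0" by simp
      qed
      then show False using riemann_not_AE_neg_right[OF sol' F' _ \<delta>(1), of "- k"] k by auto
    qed
  qed
  show "k \<le> l" if k: "k \<in> {a..b}" and eq: "F l = F k"
  proof (rule ccontr)
    assume "\<not> k \<le> l"
    then have e: "k - l > 0" by simp
    from near[OF e] obtain \<delta> where \<delta>: "\<delta> > 0" "AE x in lborel. 0 < x \<and> x < \<delta> \<longrightarrow> \<bar>\<omega> x - l\<bar> < k - l" by blast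
    \<comment> \<open>On a tie, continuity gives no sign. But k is itself a minimiser and \<omega>
      takes values in \<open>{a..b}\<close>, so F(k) - F(\<omega>) \<le> 0, and -x(k - \<omega>) < 0
      makes the sum strictly negative.\<close>
    from \<delta>(2) range have "AE x in lborel. 0 < x \<and> x < \<delta> \<longrightarrow>
        - \<omega> x > - k \<and> - F (- (- \<omega> x)) - - F (- (- k)) - x * (- \<omega> x - - k) < 0"
    proof (eventually_elim, intro impI)
      fix x assume x: "0 < x \<and> x < \<delta> \<longrightarrow> \<bar>\<omega> x - l\<bar> < k - l" "\<omega> x \<in> {a..b}" "0 < x \<and> x < \<delta>"
      then have "\<omega> x < k" by (auto simp: abs_if split: if_splits)
      then have "0 < x * (k - \<omega> x)" using x by simp
      moreover have "F k \<le> F (\<omega> x)" using min[OF x(2)] eq by simp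
      ultimately show "- \<omega> x > - k \<and> - F (- (- \<omega> x)) - - F (- (- k)) - x * (- \<omega> x - - k) < 0"
        using \<open>\<omega> x < k\<close> by simp
    qed
    then show False using riemann_not_AE_neg_right[OF sol' F' _ \<delta>(1), of "- k"] k by auto
  qed
qed

subsection \<open>Existence of Riemann solutions and the Godunov flux\<close>

text \<open>The difference quotients are bounded by L and converge almost everywhere, so dominated
  convergence applies; their integrals are difference quotients of an antiderivative H of G at the
  two endpoints, with limits G b and G a. The interval up to b + 1 accommodates steps h \<le>
  1.\<close>

lemma set_integral_deriv_lipschitz:
  fixes G g :: "real \<Rightarrow> real"
  assumes ab: "a \<le> b" and cont: "continuous_on UNIV G"
    and lip: "\<And>x y. x \<in> {a..b + 1} \<Longrightarrow> y \<in> {a..b + 1} \<Longrightarrow> \<bar>G x - G y\<bar> \<le> L * \<bar>x - y\<bar>"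
    and g: "g \<in> borel_measurable borel"
    and der: "AE x in lborel. (G has_real_derivative g x) (at x)"
  shows "(LBINT x:{a..b}. g x) = G b - G a"
proof -
  have [measurable]: "G \<in> borel_measurable borel" "g \<in> borel_measurable borel"
    using cont g by (auto intro: borel_measurable_continuous_onI)
  have L0: "0 \<le> L" using lip[of a "a + 1"] ab by auto
  define h where "h n = inverse (real (Suc n))" for n
  have h: "0 < h n" "h n \<le> 1" for n by (auto simp: h_def inverse_le_1_iff)
  have h0: "h \<longlonglongrightarrow> 0" unfolding h_def by (rule LIMSEQ_inverse_real_of_nat)
  have fh: "filterlim h (at 0) sequentially"
    using h0 h by (auto simp: filterlim_at less_imp_neq[symmetric])
  define q where "q n x = (G (x + h n) - G x) / h n" for n x
  \<comment> \<open>Enlarged so that both x and x + h are interior points for every x in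
    \<open>{a..b}\<close>.\<close>
  have "continuous_on {a - 1..b + 2} G" using cont continuous_on_subset by blast
  then obtain H where "\<And>x. x \<in> {a - 1..b + 2} \<Longrightarrow> (H has_vector_derivative G x) (at x within {a - 1..b + 2})"
    by (rule antiderivative_continuous) blast
  then have H: "(H has_real_derivative G x) (at x)" if "a - 1 < x" "x < b + 2" for x
  proof -
    have "(H has_vector_derivative G x) (at x within {a - 1..b + 2})"
      by (rule \<open>\<And>x. x \<in> {a - 1..b + 2} \<Longrightarrow> _\<close>) (use that in simp)
    then show ?thesis using at_within_Icc_at[OF that] by (simp add: has_real_derivative_iff_has_vector_derivative)
  qed
  have int_q: "(\<integral>x. indicator {a..b} x *\<^sub>R q n x \<partial>lborel) = (H (b + h n) - H b) / h n - (H (a + h n) - H a) / h n" for n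
  proof (rule integral_FTC_atLeastAtMost[OF ab, of "\<lambda>x. (H (x + h n) - H x) / h n"])
    fix x assume x: "a \<le> x" "x \<le> b"
    have "((\<lambda>x. H (x + h n)) has_real_derivative G (x + h n)) (at x)"
      using DERIV_shift[of H "G (x + h n)" x "h n"] H[of "x + h n"] h[of n] x by simp
    from DERIV_cdivide[OF DERIV_diff[OF this H[of x]], of "h n"] x
    show "((\<lambda>x. (H (x + h n) - H x) / h n) has_vector_derivative q n x) (at x within {a..b})"
      by (simp add: q_def has_real_derivative_iff_has_vector_derivative has_vector_derivative_at_within)
  next
    show "continuous_on {a..b} (q n)"
      unfolding q_def using h(1)[of n] by (intro continuous_intros continuous_on_compose2[OF cont] continuous_on_subset[OF cont]) auto
  qed
  have "(\<lambda>n. (H (b + h n) - H b) / h n - (H (a + h n) - H a) / h n) \<longlonglongrightarrow> G b - G a"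
    using H[of a] H[of b] ab unfolding DERIV_def
    by (intro tendsto_diff filterlim_compose[OF _ fh]) auto
  then have lim1: "(\<lambda>n. \<integral>x. indicator {a..b} x *\<^sub>R q n x \<partial>lborel) \<longlonglongrightarrow> G b - G a" by (simp only: int_q)
  have lim2: "(\<lambda>n. \<integral>x. indicator {a..b} x *\<^sub>R q n x \<partial>lborel) \<longlonglongrightarrow> (\<integral>x. indicator {a..b} x *\<^sub>R g x \<partial>lborel)"
  proof (rule integral_dominated_convergence[where w = "\<lambda>x. L * indicator {a..b} x"])
    show "integrable lborel (\<lambda>x. L * indicator {a..b} x)"
      by (rule integrable_lborel_bounded_support[where a = a and b = b and C = L])
        (auto simp: indicator_def L0)
    show "AE x in lborel. (\<lambda>n. indicator {a..b} x *\<^sub>R q n x) \<longlonglongrightarrow> indicator {a..b} x *\<^sub>R g x"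
      using der
    proof eventually_elim
      case (elim x)
      from filterlim_compose[OF elim[unfolded DERIV_def] fh] show ?case
        unfolding q_def by (intro tendsto_intros)
    qed
    show "AE x in lborel. norm (indicator {a..b} x *\<^sub>R q n x) \<le> L * indicator {a..b} x" for n
    proof (intro always_eventually allI)
      fix x
      show "norm (indicator {a..b} x *\<^sub>R q n x) \<le> L * indicator {a..b} x"
      proof (cases "x \<in> {a..b}")
        case True
        have "\<bar>G (x + h n) - G x\<bar> \<le> L * \<bar>x + h n - x\<bar>" using True h[of n] by (intro lip) auto
        then show ?thesis using True h[of n] by (simp add: q_def abs_divide pos_divide_le_eq)
      qed simp
    qed
  qed (simp_all add: q_def)
  show ?thesis unfolding set_lebesgue_integral_def by (rule LIMSEQ_unique[OF lim2 lim1])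
qed

text \<open>The switching point of a downward closed property is a supremum, or -S if the property
  fails throughout. Nothing is asserted at c itself, a null set under the integrals to come.\<close>

lemma split_point:
  fixes S :: real
  assumes S: "0 \<le> S" and down: "\<And>x y. x \<le> y \<Longrightarrow> Q y \<Longrightarrow> Q x"
  obtains c where "-S \<le> c" "c \<le> S" "\<And>x. -S \<le> x \<Longrightarrow> x < c \<Longrightarrow> Q x" "\<And>x. c < x \<Longrightarrow> x \<le> S \<Longrightarrow> \<not> Q x"
proof (cases "\<exists>x\<in>{-S..S}. Q x")
  case False
  then show ?thesis using that[of "-S"] S by auto
next
  case True
  define A where "A = {x \<in> {-S..S}. Q x}"
  have A: "A \<noteq> {}" "bdd_above A" using True by (auto simp: A_def intro!: bdd_aboveI[of _ S])
  have up: "Sup A \<le> S" by (rule cSup_least[OF A(1)]) (auto simp: A_def)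
  obtain z where "z \<in> A" using A by blast
  then have "z \<le> Sup A" "-S \<le> z" using cSup_upper[OF _ A(2)] by (auto simp: A_def)
  then have lo: "-S \<le> Sup A" by linarith
  have below: "Q x" if x: "x < Sup A" for x
  proof -
    obtain y where y: "y \<in> A" "x < y" using less_cSupD[OF A(1) x] by blast
    then show ?thesis using down[OF less_imp_le[OF y(2)]] by (simp add: A_def)
  qed
  have above: "\<not> Q x" if "Sup A < x" "x \<le> S" for x
  proof
    assume "Q x"
    then have "x \<in> A" using that lo by (simp add: A_def)
    then have "x \<le> Sup A" by (rule cSup_upper[OF _ A(2)])
    then show False using that by simp
  qed
  show ?thesis by (rule that[OF lo up below above])
qed

text \<open>The profile of the Riemann solution for \<open>a \<le> b\<close> is a minimiser of \<open>F u - \<xi> * u\<close> over \<open>{a..b}\<close>,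
  that is, it inverts the derivative of the lower convex envelope of \<open>F\<close>; any selection of minimisers will do.\<close>

locale riemann_profile =
  fixes F \<omega> :: "real \<Rightarrow> real" and a b :: real
  assumes ab: "a \<le> b" and F: "locally_lipschitz F"
    and range: "\<omega> x \<in> {a..b}"
    and argmin: "u \<in> {a..b} \<Longrightarrow> F (\<omega> x) - x * \<omega> x \<le> F u - x * u"
begin

text \<open>A concave function: minus the Legendre transform of F restricted to
  \<open>{a..b}\<close>.\<close>

definition m where "m x = F (\<omega> x) - x * \<omega> x"

text \<open>Adding the two minimality inequalities, each minimiser tested against the other, cancels
  F.\<close>

lemma mono: "mono \<omega>"
proof (rule monoI)
  fix x y :: real assume "x \<le> y"
  show "\<omega> x \<le> \<omega> y"
  proof (cases "x = y")
    case False
    with \<open>x \<le> y\<close> have xy: "x < y" by simp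
    have "F (\<omega> x) - x * \<omega> x \<le> F (\<omega> y) - x * \<omega> y" "F (\<omega> y) - y * \<omega> y \<le> F (\<omega> x) - y * \<omega> x"
      using argmin range by blast+
    then have "0 \<le> (y - x) * (\<omega> y - \<omega> x)" by (simp add: algebra_simps)
    then show ?thesis using xy by (simp add: zero_le_mult_iff)
  qed simp
qed

lemma measurable [measurable]: "\<omega> \<in> borel_measurable borel"
  by (rule borel_measurable_mono[OF mono])

lemma bound: "\<bar>\<omega> x\<bar> \<le> \<bar>a\<bar> + \<bar>b\<bar>"
  using range[of x] by auto

text \<open>The minimiser at x competes at y, so \<open>- \<omega> x\<close> is a supergradient of m
  at x.\<close>

lemma m_le: "m y - m x \<le> - ((y - x) * \<omega> x)"
  using argmin[of "\<omega> x" y] range[of x] by (simp add: m_def algebra_simps)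

lemma m_lipschitz: "\<bar>m x - m y\<bar> \<le> (\<bar>a\<bar> + \<bar>b\<bar>) * \<bar>x - y\<bar>"
proof -
  have *: "m y - m x \<le> (\<bar>a\<bar> + \<bar>b\<bar>) * \<bar>x - y\<bar>" for x y
  proof -
    have "- ((y - x) * \<omega> x) \<le> \<bar>\<omega> x\<bar> * \<bar>x - y\<bar>" by (simp add: abs_mult[symmetric] mult.commute) (simp add: abs_if algebra_simps)
    also have "\<dots> \<le> (\<bar>a\<bar> + \<bar>b\<bar>) * \<bar>x - y\<bar>" using bound by (intro mult_right_mono) auto
    finally show ?thesis using m_le[of y x] by linarith
  qed
  show ?thesis using *[of x y] *[of y x] by (simp add: abs_le_iff abs_minus_commute)
qed

text \<open>The supergradient inequalities at x and x + h squeeze the difference quotient between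
  -\<omega>(x) and -\<omega>(x + h). So m is differentiable wherever \<omega> is continuous, and a
  monotone function has at most countably many discontinuities.\<close>

lemma AE_m_deriv: "AE x in lborel. (m has_real_derivative - \<omega> x) (at x)"
proof -
  have "AE x in lborel. x \<notin> {x. \<not> isCont \<omega> x}"
    by (rule AE_not_in[OF countable_imp_null_set_lborel[OF mono_ctble_discont[OF mono]]])
  then show ?thesis
  proof eventually_elim
    case (elim x)
    then have c: "isCont \<omega> x" by simp
    have bd: "\<bar>(m (x + h) - m x) / h - - \<omega> x\<bar> \<le> \<bar>\<omega> (x + h) - \<omega> x\<bar>" if "h \<noteq> 0" for h
    proof -
      have 1: "m (x + h) - m x + h * \<omega> x \<le> 0" using m_le[of "x + h" x] by simp
      have 2: "- (h * (\<omega> (x + h) - \<omega> x)) \<le> m (x + h) - m x + h * \<omega> x"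
        using m_le[of x "x + h"] by (simp add: algebra_simps)
      have "h * (\<omega> (x + h) - \<omega> x) \<le> \<bar>h\<bar> * \<bar>\<omega> (x + h) - \<omega> x\<bar>" by (metis abs_ge_self abs_mult)
      then have "\<bar>m (x + h) - m x + h * \<omega> x\<bar> \<le> \<bar>h\<bar> * \<bar>\<omega> (x + h) - \<omega> x\<bar>" using 1 2 by linarith
      moreover have "(m (x + h) - m x) / h - - \<omega> x = (m (x + h) - m x + h * \<omega> x) / h"
        using that by (simp add: field_simps)
      ultimately show ?thesis using that by (simp add: abs_divide pos_divide_le_eq mult.commute)
    qed
    have "((\<lambda>h. (m (x + h) - m x) / h - - \<omega> x) \<longlongrightarrow> 0) (at 0)"
    proof (rule Lim_null_comparison)
      show "\<forall>\<^sub>F h in at 0. norm ((m (x + h) - m x) / h - - \<omega> x) \<le> \<bar>\<omega> (x + h) - \<omega> x\<bar>"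
        using bd by (simp add: eventually_at_filter)
      have "((\<lambda>h. \<omega> (x + h)) \<longlongrightarrow> \<omega> x) (at 0)" using c by (simp add: isCont_iff)
      from tendsto_rabs[OF tendsto_diff[OF this tendsto_const, of "\<omega> x"]]
      show "((\<lambda>h. \<bar>\<omega> (x + h) - \<omega> x\<bar>) \<longlongrightarrow> 0) (at 0)" by simp
    qed
    then show ?case unfolding DERIV_def using Lim_null by blast
  qed
qed

text \<open>With \<open>E x = F k - x * k - m x\<close>, the entropy defect is \<open>- sgn (\<omega> - k) * (E * \<psi>)'\<close>; only the
  points where \<open>\<omega>\<close> crosses \<open>k\<close> contribute, and there \<open>E \<ge> 0\<close>.\<close>

lemma entropy_weak:
  assumes psi: "C1c_nonneg \<psi> \<psi>'"
  shows "0 \<le> (\<integral>x. (sgn (\<omega> x - k) * (F (\<omega> x) - F k) - x * \<bar>\<omega> x - k\<bar>) * \<psi>' x - \<bar>\<omega> x - k\<bar> * \<psi> x \<partial>lborel)"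
proof -
  from C1c_nonneg_bounds[OF psi] obtain r C where r: "r > 0" "\<And>x. \<bar>x\<bar> > r \<Longrightarrow> \<psi> x = 0 \<and> \<psi>' x = 0"
    and C: "\<And>x. \<bar>\<psi> x\<bar> \<le> C \<and> \<bar>\<psi>' x\<bar> \<le> C" "C \<ge> 0" by metis
  from psi have psi0: "\<And>x. 0 \<le> \<psi> x" and d\<psi>: "\<And>x. (\<psi> has_real_derivative \<psi>' x) (at x)" and cont\<psi>': "continuous_on UNIV \<psi>'"
    unfolding C1c_nonneg_def by blast+
  note cont\<psi> = DERIV_imp_continuous_on_UNIV[of \<psi> \<psi>', OF d\<psi>]
  define E where "E x = F k - x * k - m x" for x
  define G where "G x = E x * \<psi> x" for x
  \<comment> \<open>The almost everywhere derivative of G, as E' = \<omega> - k.\<close>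
  define g where "g x = (\<omega> x - k) * \<psi> x + E x * \<psi>' x" for x
  define A where "A = \<bar>k\<bar> + (\<bar>a\<bar> + \<bar>b\<bar>)"
  have A0: "A \<ge> 0" by (simp add: A_def)
  have Elip: "\<bar>E x - E y\<bar> \<le> A * \<bar>x - y\<bar>" for x y
  proof -
    have "E x - E y = - (k * (x - y)) - (m x - m y)" by (simp add: E_def algebra_simps)
    then have "\<bar>E x - E y\<bar> \<le> \<bar>k\<bar> * \<bar>x - y\<bar> + \<bar>m x - m y\<bar>" by (metis abs_minus abs_mult abs_triangle_ineq4)
    then show ?thesis using m_lipschitz[of x y] by (simp add: A_def algebra_simps)
  qed
  have "continuous_on UNIV m"
    by (rule locally_lipschitz_continuous) (use m_lipschitz in \<open>force simp: locally_lipschitz_def intro: exI[of _ "\<bar>a\<bar> + \<bar>b\<bar>"]\<close>)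
  then have contE: "continuous_on UNIV E" unfolding E_def[abs_def] by (intro continuous_intros)
  have [measurable]: "E \<in> borel_measurable borel" "\<psi> \<in> borel_measurable borel" "\<psi>' \<in> borel_measurable borel"
    using contE cont\<psi> cont\<psi>' by (auto intro: borel_measurable_continuous_onI)
  \<comment> \<open>One beyond the support radius of \<psi>, so that G vanishes at both
    ends.\<close>
  define S where "S = r + 1"
  have S: "S > 0" using r by (simp add: S_def)
  have Eb: "\<bar>E x\<bar> \<le> \<bar>E 0\<bar> + A * (S + 1)" if "\<bar>x\<bar> \<le> S + 1" for x
  proof -
    have "\<bar>E x - E 0\<bar> \<le> A * \<bar>x - 0\<bar>" by (rule Elip)
    also have "\<dots> \<le> A * (S + 1)" using that A0 by (intro mult_left_mono) auto
    finally show ?thesis by linarith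
  qed
  have plip: "\<bar>\<psi> x - \<psi> y\<bar> \<le> C * \<bar>x - y\<bar>" for x y
    using field_differentiable_bound[of UNIV \<psi> \<psi>' C x y] d\<psi> C by simp
  have FTC: "(LBINT x:{p..q}. g x) = G q - G p" if pq: "-S \<le> p" "p \<le> q" "q \<le> S" for p q
  proof (rule set_integral_deriv_lipschitz[OF pq(2), where L = "(\<bar>E 0\<bar> + A * (S + 1)) * C + C * A"])
    show "continuous_on UNIV G" unfolding G_def[abs_def] by (intro continuous_intros contE cont\<psi>)
    show "g \<in> borel_measurable borel" unfolding g_def[abs_def] by measurable
    show "AE x in lborel. (G has_real_derivative g x) (at x)"
      using AE_m_deriv
    proof eventually_elim
      case (elim x)
      have "((\<lambda>x. F k - x * k) has_real_derivative - k) (at x)" by (auto intro!: derivative_eq_intros)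
      from DERIV_mult[OF DERIV_diff[OF this elim] d\<psi>]
      show ?case unfolding G_def[abs_def] E_def[abs_def] by (rule DERIV_cong) (simp add: g_def E_def algebra_simps)
    qed
    fix x y assume xy: "x \<in> {p..q + 1}" "y \<in> {p..q + 1}"
    have "G x - G y = E x * (\<psi> x - \<psi> y) + \<psi> y * (E x - E y)" by (simp add: G_def algebra_simps)
    then have "\<bar>G x - G y\<bar> \<le> \<bar>E x\<bar> * \<bar>\<psi> x - \<psi> y\<bar> + \<bar>\<psi> y\<bar> * \<bar>E x - E y\<bar>" by (metis abs_mult abs_triangle_ineq)
    also have "\<dots> \<le> (\<bar>E 0\<bar> + A * (S + 1)) * (C * \<bar>x - y\<bar>) + C * (A * \<bar>x - y\<bar>)"
      using xy pq C A0 S by (intro add_mono mult_mono Eb plip Elip) auto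
    finally show "\<bar>G x - G y\<bar> \<le> ((\<bar>E 0\<bar> + A * (S + 1)) * C + C * A) * \<bar>x - y\<bar>" by (simp add: algebra_simps)
  qed
  \<comment> \<open>c1 ends the region \<omega> < k and c2 the region \<omega> \<le> k; between them
    \<omega> = k and the integrand vanishes, so a plateau at level k is covered as well.\<close>
  obtain c1 where c1: "-S \<le> c1" "c1 \<le> S" "\<And>x. -S \<le> x \<Longrightarrow> x < c1 \<Longrightarrow> \<omega> x < k" "\<And>x. c1 < x \<Longrightarrow> x \<le> S \<Longrightarrow> \<not> \<omega> x < k"
    by (rule split_point[of S "\<lambda>x. \<omega> x < k"]) (use S in \<open>auto intro: le_less_trans[OF monoD[OF mono]]\<close>)
  obtain c2 where c2: "-S \<le> c2" "c2 \<le> S" "\<And>x. -S \<le> x \<Longrightarrow> x < c2 \<Longrightarrow> \<omega> x \<le> k" "\<And>x. c2 < x \<Longrightarrow> x \<le> S \<Longrightarrow> \<not> \<omega> x \<le> k"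
    by (rule split_point[of S "\<lambda>x. \<omega> x \<le> k"]) (use S in \<open>auto intro: order_trans[OF monoD[OF mono]]\<close>)
  have GS: "G S = 0" "G (-S) = 0" using r by (auto simp: G_def S_def)
  \<comment> \<open>A crossing strictly inside has values of \<omega> on both sides of k, so k lies
    in \<open>{a..b}\<close> and minimality gives E c \<ge> 0; at the two ends G is 0.\<close>
  have Gpos: "0 \<le> G c" if c: "-S \<le> c" "c \<le> S" "\<And>x. -S \<le> x \<Longrightarrow> x < c \<Longrightarrow> \<omega> x \<le> k" "\<And>x. c < x \<Longrightarrow> x \<le> S \<Longrightarrow> k \<le> \<omega> x" for c
  proof (cases "c = S \<or> c = -S")
    case True
    then show ?thesis using GS by auto
  next
    case False
    have "\<omega> (-S) \<le> k" "k \<le> \<omega> S" using c(3)[of "-S"] c(4)[of S] c(1,2) False S by auto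
    then have "k \<in> {a..b}" using range[of S] range[of "-S"] by auto
    from argmin[OF this, of c] show ?thesis using psi0 by (simp add: G_def E_def m_def)
  qed
  have G12: "0 \<le> G c1" "0 \<le> G c2"
    by (rule Gpos; use c1 c2 in force)+
  have gint: "integrable lborel (\<lambda>x. indicator {p..q} x *\<^sub>R g x)" if "-S \<le> p" "q \<le> S" for p q
  proof (rule integrable_lborel_bounded_support[where a = p and b = q and C = "(\<bar>a\<bar> + \<bar>b\<bar> + \<bar>k\<bar>) * C + (\<bar>E 0\<bar> + A * (S + 1)) * C"])
    show "(\<lambda>x. indicator {p..q} x *\<^sub>R g x) \<in> borel_measurable borel" unfolding g_def by measurable
    show "\<bar>indicator {p..q} x *\<^sub>R g x\<bar> \<le> (\<bar>a\<bar> + \<bar>b\<bar> + \<bar>k\<bar>) * C + (\<bar>E 0\<bar> + A * (S + 1)) * C" for x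
    proof (cases "x \<in> {p..q}")
      case True
      have "\<bar>g x\<bar> \<le> \<bar>\<omega> x - k\<bar> * \<bar>\<psi> x\<bar> + \<bar>E x\<bar> * \<bar>\<psi>' x\<bar>" unfolding g_def abs_mult[symmetric] by (rule abs_triangle_ineq)
      also have "\<dots> \<le> (\<bar>a\<bar> + \<bar>b\<bar> + \<bar>k\<bar>) * C + (\<bar>E 0\<bar> + A * (S + 1)) * C"
        using True that C A0 S bound[of x] by (intro add_mono mult_mono Eb) auto
      finally show ?thesis using True by simp
    next
      case False
      then show ?thesis using C A0 S by simp
    qed
  qed (auto simp: indicator_def)
  have "(\<integral>x. (sgn (\<omega> x - k) * (F (\<omega> x) - F k) - x * \<bar>\<omega> x - k\<bar>) * \<psi>' x - \<bar>\<omega> x - k\<bar> * \<psi> x \<partial>lborel)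
     = (\<integral>x. indicator {-S..c1} x *\<^sub>R g x - indicator {c2..S} x *\<^sub>R g x \<partial>lborel)"
  proof (rule integral_cong_AE)
    have [measurable]: "F \<in> borel_measurable borel"
      by (rule borel_measurable_continuous_onI[OF locally_lipschitz_continuous[OF F]])
    show "(\<lambda>x. (sgn (\<omega> x - k) * (F (\<omega> x) - F k) - x * \<bar>\<omega> x - k\<bar>) * \<psi>' x - \<bar>\<omega> x - k\<bar> * \<psi> x) \<in> borel_measurable lborel"
      by measurable
    show "(\<lambda>x. indicator {-S..c1} x *\<^sub>R g x - indicator {c2..S} x *\<^sub>R g x) \<in> borel_measurable lborel"
      unfolding g_def by measurable
    have "AE x in lborel. x \<noteq> c1" "AE x in lborel. x \<noteq> c2" by (rule AE_lborel_singleton)+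
    then show "AE x in lborel. (sgn (\<omega> x - k) * (F (\<omega> x) - F k) - x * \<bar>\<omega> x - k\<bar>) * \<psi>' x - \<bar>\<omega> x - k\<bar> * \<psi> x
        = indicator {-S..c1} x *\<^sub>R g x - indicator {c2..S} x *\<^sub>R g x"
    proof eventually_elim
      case (elim x)
      have e: "(sgn (\<omega> x - k) * (F (\<omega> x) - F k) - x * \<bar>\<omega> x - k\<bar>) * \<psi>' x - \<bar>\<omega> x - k\<bar> * \<psi> x = - sgn (\<omega> x - k) * g x"
        by (auto simp: g_def E_def m_def sgn_if abs_if algebra_simps)
      show ?case
      proof (cases "\<bar>x\<bar> \<le> S")
        case True
        then have x: "-S \<le> x" "x \<le> S" by auto
        consider "\<omega> x < k" | "\<omega> x = k" | "\<omega> x > k" by linarith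
        then show ?thesis unfolding e
        proof cases
          case 1
          then have "x < c1" "x < c2" using c1(4)[of x] c2(4)[of x] c1(3)[of x] elim x by force+
          then show "- sgn (\<omega> x - k) * g x = indicator {-S..c1} x *\<^sub>R g x - indicator {c2..S} x *\<^sub>R g x"
            using 1 x by simp
        next
          case 2
          then have "\<not> x < c1" "\<not> c2 < x" using c1(3)[of x] c2(4)[of x] x by force+
          then show "- sgn (\<omega> x - k) * g x = indicator {-S..c1} x *\<^sub>R g x - indicator {c2..S} x *\<^sub>R g x"
            using 2 elim by simp
        next
          case 3
          then have "c1 < x" "c2 < x" using c1(3)[of x] c2(3)[of x] elim x by force+
          then show "- sgn (\<omega> x - k) * g x = indicator {-S..c1} x *\<^sub>R g x - indicator {c2..S} x *\<^sub>R g x"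
            using 3 x by simp
        qed
      next
        case False
        then have "g x = 0" using r(2)[of x] by (simp add: g_def S_def)
        then show ?thesis unfolding e by simp
      qed
    qed
  qed
  also have "\<dots> = (LBINT x:{-S..c1}. g x) - (LBINT x:{c2..S}. g x)"
    unfolding set_lebesgue_integral_def using gint c1 c2 by (intro Bochner_Integration.integral_diff) auto
  also have "\<dots> = G c1 + G c2" using FTC[of "-S" c1] FTC[of c2 S] c1 c2 GS by simp
  finally show ?thesis using G12 by simp
qed

text \<open>Finite speed of propagation: once |x| exceeds a Lipschitz constant of F on the range,
  the linear term outweighs F and the minimum sits at an endpoint.\<close>

lemma far_field:
  obtains M where "M > 0" "\<And>x. x < - M \<Longrightarrow> \<omega> x = a" "\<And>x. M < x \<Longrightarrow> \<omega> x = b"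
proof -
  from F obtain M where M: "M \<ge> 0"
    "\<And>y z. \<bar>y\<bar> \<le> \<bar>a\<bar> + \<bar>b\<bar> \<Longrightarrow> \<bar>z\<bar> \<le> \<bar>a\<bar> + \<bar>b\<bar> \<Longrightarrow> \<bar>F y - F z\<bar> \<le> M * \<bar>y - z\<bar>"
    unfolding locally_lipschitz_def by meson
  show thesis
  proof (rule that[of "M + 1"])
    show "M + 1 > 0" using M by simp
    show "\<omega> x = a" if x: "x < - (M + 1)" for x
    proof (rule ccontr)
      assume "\<omega> x \<noteq> a"
      then have d: "\<omega> x - a > 0" using range[of x] by auto
      have "F a - F (\<omega> x) \<le> M * (\<omega> x - a)" using M(2)[of a "\<omega> x"] bound[of x] d by simp
      moreover have "F (\<omega> x) - x * \<omega> x \<le> F a - x * a" using argmin ab by simp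
      ultimately have "(- x) * (\<omega> x - a) \<le> M * (\<omega> x - a)" by (simp add: algebra_simps)
      then have "- x \<le> M" using d by (rule mult_right_le_imp_le)
      then show False using x by simp
    qed
    show "\<omega> x = b" if x: "M + 1 < x" for x
    proof (rule ccontr)
      assume "\<omega> x \<noteq> b"
      then have d: "b - \<omega> x > 0" using range[of x] by auto
      have "F b - F (\<omega> x) \<le> M * (b - \<omega> x)" using M(2)[of b "\<omega> x"] bound[of x] d by simp
      moreover have "F (\<omega> x) - x * \<omega> x \<le> F b - x * b" using argmin ab by simp
      ultimately have "x * (b - \<omega> x) \<le> M * (b - \<omega> x)" by (simp add: algebra_simps)
      then have "x \<le> M" using d by (rule mult_right_le_imp_le)
      then show False using x by simp
    qed
  qed
qed

text \<open>For each t the slice of \<phi> along \<xi> -> (t, t \<xi>) is an admissible test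
  function, so the inner similarity integral is nonnegative. The initial condition holds because
  profile and jump differ only for |x| \<le> M t, a set of length 2 M t.\<close>

lemma riemann_entropy_sol: "riemann_entropy_sol F a b \<omega>"
  unfolding riemann_entropy_sol_def
proof (intro conjI allI impI)
  show "\<omega> \<in> borel_measurable borel" by measurable
  show "\<exists>C. \<forall>\<xi>. \<bar>\<omega> \<xi>\<bar> \<le> C" using bound by blast
next
  fix k \<phi> \<phi>t \<phi>x assume test: "test_fun \<phi> \<phi>t \<phi>x"
  have contF: "continuous_on UNIV F" by (rule locally_lipschitz_continuous[OF F])
  then have [measurable]: "F \<in> borel_measurable borel" by (rule borel_measurable_continuous_onI)
  have "continuous_on {- (\<bar>a\<bar> + \<bar>b\<bar>)..\<bar>a\<bar> + \<bar>b\<bar>} F" using contF continuous_on_subset by blast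
  from compact_imp_bounded[OF compact_continuous_image[OF this compact_Icc]]
  obtain B where B: "\<And>y. \<bar>y\<bar> \<le> \<bar>a\<bar> + \<bar>b\<bar> \<Longrightarrow> \<bar>F y\<bar> \<le> B" by (force simp: bounded_iff abs_le_iff)
  have b1: "\<bar>\<bar>\<omega> x - k\<bar>\<bar> \<le> \<bar>a\<bar> + \<bar>b\<bar> + \<bar>k\<bar> + B + \<bar>F k\<bar>" for x
    using bound[of x] B[OF bound[of x]] by simp
  have b2: "\<bar>sgn (\<omega> x - k) * (F (\<omega> x) - F k)\<bar> \<le> \<bar>a\<bar> + \<bar>b\<bar> + \<bar>k\<bar> + B + \<bar>F k\<bar>" for x
  proof -
    have "\<bar>F (\<omega> x) - F k\<bar> \<le> \<bar>a\<bar> + \<bar>b\<bar> + \<bar>k\<bar> + B + \<bar>F k\<bar>" using bound[of x] B[OF bound[of x]] by linarith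
    then show ?thesis by (auto simp: abs_mult sgn_if)
  qed
  from test_fun_support[OF test] obtain t0 T D where t0: "t0 > 0" "T \<ge> 0"
    and zero: "\<And>t x. \<not> (t0 \<le> t \<and> t \<le> T \<and> \<bar>x\<bar> \<le> T) \<Longrightarrow> \<phi> (t, x) = 0 \<and> \<phi>t (t, x) = 0 \<and> \<phi>x (t, x) = 0" by metis
  from test have pos: "\<And>p. 0 \<le> \<phi> p" and contx: "continuous_on UNIV \<phi>x"
    and der: "\<And>p. (\<phi> has_derivative (\<lambda>(dt, dx). \<phi>t p * dt + \<phi>x p * dx)) (at p)"
    unfolding test_fun_def by blast+
  have C1: "C1c_nonneg (\<lambda>\<xi>. \<phi> (t, t * \<xi>)) (\<lambda>\<xi>. t * \<phi>x (t, t * \<xi>))" for t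
    unfolding C1c_nonneg_def
  proof (intro conjI allI)
    show "0 \<le> \<phi> (t, t * \<xi>)" for \<xi> by (rule pos)
    show "((\<lambda>\<xi>. \<phi> (t, t * \<xi>)) has_real_derivative t * \<phi>x (t, t * \<xi>)) (at \<xi>)" for \<xi>
    proof -
      have "((\<lambda>\<xi>. (t, t * \<xi>)) has_derivative (\<lambda>d. (0, t * d))) (at \<xi>)"
        by (auto intro!: derivative_eq_intros)
      from diff_chain_at[OF this der]
      have "((\<lambda>\<xi>. \<phi> (t, t * \<xi>)) has_derivative (\<lambda>d. t * \<phi>x (t, t * \<xi>) * d)) (at \<xi>)"
        by (simp add: o_def mult_ac)
      then show ?thesis by (simp add: has_field_derivative_def)
    qed
    show "continuous_on UNIV (\<lambda>\<xi>. t * \<phi>x (t, t * \<xi>))"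
      by (intro continuous_intros continuous_on_compose2[OF contx]) auto
    have "\<phi> (t, t * \<xi>) = 0" if \<xi>: "\<bar>\<xi>\<bar> > T / t0" for \<xi>
    proof -
      have "T < \<bar>t * \<xi>\<bar>" if "t0 \<le> t"
      proof -
        have "T < t0 * \<bar>\<xi>\<bar>" using \<xi> t0 by (simp add: pos_divide_less_eq mult.commute)
        also have "\<dots> \<le> t * \<bar>\<xi>\<bar>" using that by (intro mult_right_mono) auto
        also have "\<dots> = \<bar>t * \<xi>\<bar>" using that t0 by (simp add: abs_mult)
        finally show ?thesis .
      qed
      then have "\<not> (t0 \<le> t \<and> t \<le> T \<and> \<bar>t * \<xi>\<bar> \<le> T)" by linarith
      then show ?thesis using zero by blast
    qed
    then show "\<exists>r. \<forall>\<xi>. \<bar>\<xi>\<bar> > r \<longrightarrow> \<phi> (t, t * \<xi>) = 0" by blast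
  qed
  have "integral\<^sup>L lborel (\<lambda>(t, x). \<bar>\<omega> (x / t) - k\<bar> * \<phi>t (t, x)
           + sgn (\<omega> (x / t) - k) * (F (\<omega> (x / t)) - F k) * \<phi>x (t, x))
    = (\<integral>t. (\<integral>\<xi>. (sgn (\<omega> \<xi> - k) * (F (\<omega> \<xi>) - F k) - \<xi> * \<bar>\<omega> \<xi> - k\<bar>) * (t * \<phi>x (t, t * \<xi>))
        - \<bar>\<omega> \<xi> - k\<bar> * \<phi> (t, t * \<xi>) \<partial>lborel) \<partial>lborel)"
    by (rule selfsimilar_weak_integral[OF _ _ b1 b2 test]) measurable
  moreover have "0 \<le> \<dots>"
    by (intro integral_nonneg_AE always_eventually allI entropy_weak[OF C1])
  ultimately show "0 \<le> integral\<^sup>L lborel (\<lambda>(t, x). \<bar>\<omega> (x / t) - k\<bar> * \<phi>t (t, x)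
           + sgn (\<omega> (x / t) - k) * (F (\<omega> (x / t)) - F k) * \<phi>x (t, x))" by simp
next
  fix R :: real assume "R > 0"
  obtain M where M: "M > 0" "\<And>x. x < - M \<Longrightarrow> \<omega> x = a" "\<And>x. M < x \<Longrightarrow> \<omega> x = b" using far_field by blast
  have up: "(LBINT x:{- R..R}. \<bar>\<omega> (x / t) - (if x < 0 then a else b)\<bar>) \<le> (b - a) * (2 * M * t)" if t: "t > 0" for t
  proof -
    have "(LBINT x:{- R..R}. \<bar>\<omega> (x / t) - (if x < 0 then a else b)\<bar>) \<le> (\<integral>x. (b - a) * indicator {- (M * t)..M * t} x \<partial>lborel)"
      unfolding set_lebesgue_integral_def
    proof (rule integral_mono)
      have b: "\<bar>\<omega> (x / t) - (if x < 0 then a else b)\<bar> \<le> b - a" for x using range[of "x / t"] by auto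
      show "integrable lborel (\<lambda>x. indicator {- R..R} x *\<^sub>R \<bar>\<omega> (x / t) - (if x < 0 then a else b)\<bar>)"
        using set_integrable_bounded[of "\<lambda>x. \<bar>\<omega> (x / t) - (if x < 0 then a else b)\<bar>" "b - a" "- R" R] b
        by (simp add: set_integrable_def)
      show "integrable lborel (\<lambda>x. (b - a) * indicator {- (M * t)..M * t} x)"
        by (rule integrable_lborel_bounded_support[where a = "- (M * t)" and b = "M * t" and C = "b - a"])
          (use ab in \<open>auto simp: indicator_def\<close>)
      show "indicator {- R..R} x *\<^sub>R \<bar>\<omega> (x / t) - (if x < 0 then a else b)\<bar> \<le> (b - a) * indicator {- (M * t)..M * t} x" for x
      proof (cases "x \<in> {- (M * t)..M * t}")
        case True
        then show ?thesis using b[of x] ab by (auto simp: indicator_def split: if_splits)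
      next
        case False
        then have "x / t < - M \<and> x < 0 \<or> x / t > M \<and> \<not> x < 0"
          using t M(1) mult_pos_pos[OF M(1) t] by (auto simp: pos_divide_less_eq pos_less_divide_eq)
        then show ?thesis using M False by auto
      qed
    qed
    also have "\<dots> = (b - a) * (2 * M * t)" using t M by simp
    finally show ?thesis .
  qed
  show "((\<lambda>t. LBINT x:{- R..R}. \<bar>\<omega> (x / t) - (if x < 0 then a else b)\<bar>) \<longlongrightarrow> 0) (at_right 0)"
  proof (rule tendsto_sandwich[OF _ _ tendsto_const])
    show "\<forall>\<^sub>F t in at_right 0. 0 \<le> (LBINT x:{- R..R}. \<bar>\<omega> (x / t) - (if x < 0 then a else b)\<bar>)"
      by (simp add: set_lebesgue_integral_def)
    show "\<forall>\<^sub>F t in at_right 0. (LBINT x:{- R..R}. \<bar>\<omega> (x / t) - (if x < 0 then a else b)\<bar>) \<le> (b - a) * (2 * M * t)"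
      using eventually_at_right_less[of "0::real"] by eventually_elim (rule up)
    show "((\<lambda>t. (b - a) * (2 * M * t)) \<longlongrightarrow> 0) (at_right 0)" by (auto intro!: tendsto_eq_intros)
  qed
qed

text \<open>Monotonicity makes the infimum over positive arguments a genuine right limit, hence an
  essential one.\<close>

lemma ess_right_lim: "ess_right_lim0 \<omega> (Inf (\<omega> ` {0<..}))"
  unfolding ess_right_lim0_def
proof (intro allI impI)
  fix e :: real assume "e > 0"
  define l where "l = Inf (\<omega> ` {0<..})"
  have bdd: "bdd_below (\<omega> ` {0<..})" using range by (auto intro!: bdd_belowI[of _ a])
  have "\<exists>y\<in>\<omega> ` {0<..}. y < l + e" unfolding l_def
    by (rule cInf_lessD) (use \<open>e > 0\<close> in auto)
  then obtain x0 where x0: "x0 > 0" "\<omega> x0 < l + e" by auto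
  show "\<exists>\<delta>>0. AE \<xi> in lborel. 0 < \<xi> \<and> \<xi> < \<delta> \<longrightarrow> \<bar>\<omega> \<xi> - Inf (\<omega> ` {0<..})\<bar> < e"
  proof (intro exI[of _ x0] conjI always_eventually allI impI)
    fix x assume x: "0 < x \<and> x < x0"
    then have "l \<le> \<omega> x" unfolding l_def by (intro cInf_lower bdd) auto
    moreover have "\<omega> x \<le> \<omega> x0" using x monoD[OF mono] by simp
    ultimately show "\<bar>\<omega> x - Inf (\<omega> ` {0<..})\<bar> < e" using x0 \<open>e > 0\<close> by (simp add: l_def[symmetric])
  qed (rule x0)
qed

end

lemma riemann_entropy_sol_exists:
  assumes "a \<le> b" "locally_lipschitz F"
  obtains \<omega> l where "riemann_entropy_sol F a b \<omega>" "ess_right_lim0 \<omega> l"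
proof -
  have "\<exists>u\<in>{a..b}. \<forall>y\<in>{a..b}. F u - x * u \<le> F y - x * y" for x
    using assms continuous_on_subset[OF locally_lipschitz_continuous[OF assms(2)]]
    by (intro continuous_attains_inf continuous_intros) auto
  then obtain \<omega> where "\<And>x. \<omega> x \<in> {a..b}" "\<And>x y. y \<in> {a..b} \<Longrightarrow> F (\<omega> x) - x * \<omega> x \<le> F y - x * y" by metis
  then interpret riemann_profile F \<omega> a b using assms by unfold_locales
  show thesis by (rule that[OF riemann_entropy_sol ess_right_lim])
qed

lemma ess_right_lim0_uminus: "ess_right_lim0 \<omega> l \<Longrightarrow> ess_right_lim0 (\<lambda>x. - \<omega> x) (- l)"
  unfolding ess_right_lim0_def by (simp add: abs_minus_commute)

section \<open>Evaluation of the Godunov flux\<close>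

lemma godunov_eq:
  assumes ex: "\<exists>\<omega>. riemann_entropy_sol F a b \<omega> \<and> ess_right_lim0 \<omega> l"
    and uniq: "\<And>\<omega> l'. riemann_entropy_sol F a b \<omega> \<Longrightarrow> ess_right_lim0 \<omega> l' \<Longrightarrow> l' = l"
  shows "godunov F a b = F l"
  unfolding godunov_def by (rule arg_cong[of _ _ F], rule the_equality) (use ex uniq in blast)+

text \<open>Any two traces minimise F, and by the clause on ties each is at least as large as the
  other; so they coincide.\<close>

lemma godunov_min:
  assumes ab: "a \<le> b" and F: "locally_lipschitz F"
  obtains l where "l \<in> {a..b}" "godunov F a b = F l" "\<And>k. k \<in> {a..b} \<Longrightarrow> F l \<le> F k"
proof -
  obtain \<omega> l where \<omega>: "riemann_entropy_sol F a b \<omega>" "ess_right_lim0 \<omega> l"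
    by (rule riemann_entropy_sol_exists[OF ab F])
  note l = riemann_trace_argmin[OF \<omega>(1) F ab \<omega>(2)]
  have "godunov F a b = F l"
  proof (rule godunov_eq)
    fix \<omega>' l' assume "riemann_entropy_sol F a b \<omega>'" "ess_right_lim0 \<omega>' l'"
    note l' = riemann_trace_argmin[OF this(1) F ab this(2)]
    have "F l = F l'" using l(2)[OF l'(1)] l'(2)[OF l(1)] by simp
    then show "l' = l" using l(3)[OF l'(1)] l'(3)[OF l(1)] by simp
  qed (use \<omega> in blast)
  then show thesis using that l by blast
qed

text \<open>Reflection maps solutions and traces of the two problems onto each other, so the trace
  is minus the largest minimiser of -F(-u), that is, the smallest maximiser of F on
  \<open>{b..a}\<close>.\<close>

lemma godunov_max:
  assumes ab: "b \<le> a" and F: "locally_lipschitz F"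
  obtains l where "l \<in> {b..a}" "godunov F a b = F l" "\<And>k. k \<in> {b..a} \<Longrightarrow> F k \<le> F l"
proof -
  have ab': "- a \<le> - b" using ab by simp
  note F' = locally_lipschitz_uminus[OF F]
  obtain \<omega> l where \<omega>: "riemann_entropy_sol (\<lambda>u. - F (- u)) (- a) (- b) \<omega>" "ess_right_lim0 \<omega> l"
    by (rule riemann_entropy_sol_exists[OF ab' F'])
  note l = riemann_trace_argmin[OF \<omega>(1) F' ab' \<omega>(2)]
  have "godunov F a b = F (- l)"
  proof (rule godunov_eq)
    have "riemann_entropy_sol F a b (\<lambda>x. - \<omega> x)" using riemann_entropy_sol_uminus[OF \<omega>(1)] by simp
    then show "\<exists>\<omega>. riemann_entropy_sol F a b \<omega> \<and> ess_right_lim0 \<omega> (- l)"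
      using ess_right_lim0_uminus[OF \<omega>(2)] by blast
    fix \<omega>' l' assume "riemann_entropy_sol F a b \<omega>'" "ess_right_lim0 \<omega>' l'"
    note l' = riemann_trace_argmin[OF riemann_entropy_sol_uminus[OF this(1)] F' ab' ess_right_lim0_uminus[OF this(2)]]
    have "- F (- l) = - F (- (- l'))" using l(2)[OF l'(1)] l'(2)[OF l(1)] by simp
    then have "- l' = l" using l(3)[OF l'(1)] l'(3)[OF l(1)] by simp
    then show "l' = - l" by simp
  qed
  moreover have "F k \<le> F (- l)" if "k \<in> {b..a}" for k using l(2)[of "- k"] that by simp
  ultimately show thesis using that[of "- l"] l(1) by auto
qed

subsection \<open>Total variation of piecewise constant functions\<close>

text \<open>Real-valued form of the sums in \<open>pvar\<close>, over lists of any type, so that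
  lists of points and of cell indices are treated alike.\<close>

definition pairs_var :: "('a \<Rightarrow> real) \<Rightarrow> 'a list \<Rightarrow> real" where
  "pairs_var g xs = (\<Sum>(a, b)\<leftarrow>zip xs (tl xs). \<bar>g b - g a\<bar>)"

lemma pairs_var_ereal: "(\<Sum>(a, b)\<leftarrow>zip xs (tl xs). ereal \<bar>g b - g a\<bar>) = ereal (pairs_var g xs)"
proof -
  have "(\<Sum>(a, b)\<leftarrow>zs. ereal \<bar>g b - g a\<bar>) = ereal (\<Sum>(a, b)\<leftarrow>zs. \<bar>g b - g a\<bar>)" for zs
    by (induction zs) auto
  then show ?thesis by (simp add: pairs_var_def)
qed

lemma pairs_var_Nil [simp]: "pairs_var g [] = 0"
  and pairs_var_single [simp]: "pairs_var g [x] = 0"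
  and pairs_var_Cons2 [simp]: "pairs_var g (x # y # xs) = \<bar>g y - g x\<bar> + pairs_var g (y # xs)"
  by (auto simp: pairs_var_def)

lemma pvar_eq: "pvar g = (SUP xs \<in> {xs. sorted xs}. ereal (pairs_var g xs))"
  unfolding pvar_def pairs_var_ereal ..

lemma pairs_var_map: "pairs_var g (map h xs) = pairs_var (g \<circ> h) xs"
  by (induction xs rule: induct_list012) auto

lemma pairs_var_upto:
  "pairs_var g [i..j] = (\<Sum>k\<in>{i..<j}. \<bar>g (k + 1) - g k\<bar>)" for g :: "int \<Rightarrow> real"
proof (induction "nat (j - i)" arbitrary: i)
  case 0
  then have "[i..j] = (if i = j then [i] else [])" by (simp add: upto.simps)
  then show ?case using 0 by auto
next
  case (Suc n)
  then have ij: "i < j" by simp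
  then have *: "[i..j] = i # (i + 1) # [i + 2..j]" "[i + 1..j] = (i + 1) # [i + 2..j]"
    by (simp_all add: upto.simps[of i] upto.simps[of "i + 1"] add.assoc)
  have "{i..<j} = insert i {i + 1..<j}" using ij by auto
  then show ?case using Suc.hyps(1)[of "i + 1"] Suc.hyps(2) * by (simp add: )
qed

text \<open>Each jump is bounded by a telescoping sum over its block of indices, and successive
  blocks are disjoint.\<close>

lemma pairs_var_sorted_int:
  fixes w :: "int \<Rightarrow> real"
  assumes "sorted ks" "set ks \<subseteq> {m..n}"
  shows "pairs_var w ks \<le> (\<Sum>k\<in>{m..<n}. \<bar>w (k + 1) - w k\<bar>)"
  using assms
proof (induction ks arbitrary: m rule: induct_list012)
  case (3 x y ks)
  have tele: "\<bar>w y - w x\<bar> \<le> (\<Sum>k\<in>{x..<y}. \<bar>w (k + 1) - w k\<bar>)" if "x \<le> y" for x y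
    using that
  proof (induction "nat (y - x)" arbitrary: y)
    case (Suc n)
    then have "{x..<y} = insert (y - 1) {x..<y - 1}" by auto
    moreover have "\<bar>w (y - 1) - w x\<bar> \<le> (\<Sum>k\<in>{x..<y - 1}. \<bar>w (k + 1) - w k\<bar>)"
      using Suc by (intro Suc.hyps(1)) auto
    ultimately show ?case by simp
  qed simp
  have xy: "x \<le> y" "m \<le> x" "y \<le> n" using 3 by auto
  have "pairs_var w (y # ks) \<le> (\<Sum>k\<in>{y..<n}. \<bar>w (k + 1) - w k\<bar>)"
    by (rule 3(2)) (use 3(3,4) in auto)
  then have "pairs_var w (x # y # ks) \<le> (\<Sum>k\<in>{x..<y}. \<bar>w (k + 1) - w k\<bar>) + (\<Sum>k\<in>{y..<n}. \<bar>w (k + 1) - w k\<bar>)"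
    using tele[OF xy(1)] by simp
  also have "\<dots> = (\<Sum>k\<in>{x..<y} \<union> {y..<n}. \<bar>w (k + 1) - w k\<bar>)"
    by (rule sum.union_disjoint[symmetric]) auto
  also have "\<dots> \<le> (\<Sum>k\<in>{m..<n}. \<bar>w (k + 1) - w k\<bar>)"
    by (rule sum_mono2) (use xy in auto)
  finally show ?case .
qed (auto intro!: sum_nonneg)

text \<open>For the upper bound the step function itself is a representative, and sorted points fall
  into sorted cells. For the lower bound any representative agrees with it at some point of each
  open cell, and sampling there recovers the jumps.\<close>

lemma TV_piecewise_constant:
  fixes w :: "int \<Rightarrow> real"
  assumes dx: "dx > 0"
  shows "TV (\<lambda>x. w \<lfloor>x / dx + 1/2\<rfloor>) = (SUP N. ereal (\<Sum>j\<in>{- int N..<int N}. \<bar>w (j + 1) - w j\<bar>))"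
    (is "TV ?u = ?S")
proof (rule antisym)
  have "TV ?u \<le> pvar ?u" unfolding TV_def by (rule INF_lower) auto
  also have "\<dots> \<le> ?S"
    unfolding pvar_eq
  proof (rule SUP_least)
    fix xs :: "real list" assume "xs \<in> {xs. sorted xs}"
    then have xs: "sorted xs" by simp
    define h where "h x = \<lfloor>x / dx + 1/2\<rfloor>" for x
    have mono: "mono h" unfolding h_def mono_def using dx by (auto intro!: floor_mono divide_right_mono)
    \<comment> \<open>Bounds every cell index that occurs; the inserted 0 covers the empty
      list.\<close>
    define N where "N = nat (Max (insert 0 (abs ` set (map h xs))))"
    have N: "\<bar>k\<bar> \<le> int N" if "k \<in> set (map h xs)" for k
    proof -
      have "\<bar>k\<bar> \<le> Max (insert 0 (abs ` set (map h xs)))" using that by (intro Max_ge) auto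
      then show ?thesis by (simp add: N_def)
    qed
    have "pairs_var ?u xs = pairs_var w (map h xs)"
      by (simp add: pairs_var_map h_def o_def)
    also have "\<dots> \<le> (\<Sum>j\<in>{- int N..<int N}. \<bar>w (j + 1) - w j\<bar>)"
    proof (rule pairs_var_sorted_int)
      show "sorted (map h xs)"
        using xs mono by (auto simp: sorted_map intro: sorted_wrt_mono_rel dest: monoD)
      show "set (map h xs) \<subseteq> {- int N..int N}" using N by fastforce
    qed
    finally show "ereal (pairs_var ?u xs) \<le> ?S"
      by (intro SUP_upper2[of N]) auto
  qed
  finally show "TV ?u \<le> ?S" .
next
  show "?S \<le> TV ?u"
    unfolding TV_def
  proof (intro SUP_least INF_greatest)
    fix N :: nat and g assume "g \<in> {g. AE x in lborel. g x = ?u x}"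
    then have g: "AE x in lborel. g x = ?u x" by simp
    have "\<exists>x. (real_of_int j - 1/2) * dx < x \<and> x < (real_of_int j + 1/2) * dx \<and> g x = ?u x" for j
      by (rule AE_ex_in_Ioo[OF g]) (use dx in simp)
    then obtain p where p: "\<And>j. (real_of_int j - 1/2) * dx < p j" "\<And>j. p j < (real_of_int j + 1/2) * dx"
      "\<And>j. g (p j) = ?u (p j)" by metis
    have fl: "\<lfloor>p j / dx + 1/2\<rfloor> = j" for j
      using p(1,2)[of j] dx by (auto simp: floor_eq_iff field_simps)
    then have gp: "g \<circ> p = w" using p(3) by auto
    have "mono p"
    proof (rule monoI)
      fix i j :: int assume "i \<le> j"
      show "p i \<le> p j"
      proof (cases "i = j")
        case False
        then have "real_of_int i + 1 \<le> real_of_int j" using \<open>i \<le> j\<close> by linarith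
        then have "(real_of_int i + 1/2) * dx \<le> (real_of_int j - 1/2) * dx" using dx by (intro mult_right_mono) auto
        then show ?thesis using p(1)[of j] p(2)[of i] by linarith
      qed simp
    qed
    then have "sorted (map p [- int N..int N])"
      by (auto simp: sorted_map intro: sorted_wrt_mono_rel[of _ "(\<le>)"] dest: monoD)
    then have "ereal (pairs_var g (map p [- int N..int N])) \<le> pvar g"
      unfolding pvar_eq by (intro SUP_upper) auto
    then show "ereal (\<Sum>j\<in>{- int N..<int N}. \<bar>w (j + 1) - w j\<bar>) \<le> pvar g"
      by (simp add: pairs_var_map gp pairs_var_upto)
  qed
qed

text \<open>The increments of u' combine d(j), d(j+1) and d(j-1) with nonnegative coefficients;
  after shifting indices, |d(j)| carries 1 - C(j) - D(j), C(j) and D(j), of sum 1. C(j) and D(j)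
  belong to the same face, hence the shift in \<open>D (j - 1)\<close>. The window grows by one cell
  on each side, which a supremum over N absorbs.\<close>

lemma Harten_TVD:
  fixes u u' C D :: "int \<Rightarrow> real"
  assumes step: "\<And>j. u' j = u j + C j * (u (j + 1) - u j) - D (j - 1) * (u j - u (j - 1))"
    and C: "\<And>j. 0 \<le> C j" and D: "\<And>j. 0 \<le> D j" and CD: "\<And>j. C j + D j \<le> 1"
  shows "(\<Sum>j\<in>{- int N..<int N}. \<bar>u' (j + 1) - u' j\<bar>)
       \<le> (\<Sum>j\<in>{- int (Suc N)..<int (Suc N)}. \<bar>u (j + 1) - u j\<bar>)"
proof -
  define d where "d j = u (j + 1) - u j" for j
  define I where "I = {- int N..<int N}"
  have 1: "\<bar>u' (j + 1) - u' j\<bar> \<le> (1 - C j - D j) * \<bar>d j\<bar> + C (j + 1) * \<bar>d (j + 1)\<bar> + D (j - 1) * \<bar>d (j - 1)\<bar>" for j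
  proof -
    have "u' (j + 1) - u' j = (1 - C j - D j) * d j + C (j + 1) * d (j + 1) + D (j - 1) * d (j - 1)"
      by (simp add: step d_def algebra_simps)
    also have "\<bar>\<dots>\<bar> \<le> \<bar>(1 - C j - D j) * d j\<bar> + \<bar>C (j + 1) * d (j + 1)\<bar> + \<bar>D (j - 1) * d (j - 1)\<bar>"
      by linarith
    finally show ?thesis using C[of "j + 1"] D[of "j - 1"] CD[of j] by (simp add: abs_mult)
  qed
  have "(\<Sum>j\<in>I. \<bar>u' (j + 1) - u' j\<bar>)
      \<le> (\<Sum>j\<in>I. (1 - C j - D j) * \<bar>d j\<bar>) + (\<Sum>j\<in>I. C (j + 1) * \<bar>d (j + 1)\<bar>) + (\<Sum>j\<in>I. D (j - 1) * \<bar>d (j - 1)\<bar>)"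
    unfolding sum.distrib[symmetric] by (rule sum_mono) (rule 1)
  also have "(\<Sum>j\<in>I. C (j + 1) * \<bar>d (j + 1)\<bar>) = (\<Sum>j\<in>(\<lambda>j. j + 1) ` I. C j * \<bar>d j\<bar>)"
    by (subst sum.reindex) auto
  also have "\<dots> \<le> (\<Sum>j\<in>{- int (Suc N)..<int (Suc N)}. C j * \<bar>d j\<bar>)"
    by (rule sum_mono2) (use C in \<open>auto simp: I_def\<close>)
  also have "(\<Sum>j\<in>I. D (j - 1) * \<bar>d (j - 1)\<bar>) = (\<Sum>j\<in>(\<lambda>j. j - 1) ` I. D j * \<bar>d j\<bar>)"
    by (subst sum.reindex) (auto simp: inj_on_def)
  also have "\<dots> \<le> (\<Sum>j\<in>{- int (Suc N)..<int (Suc N)}. D j * \<bar>d j\<bar>)"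
    by (rule sum_mono2) (use D in \<open>auto simp: I_def\<close>)
  also have "(\<Sum>j\<in>I. (1 - C j - D j) * \<bar>d j\<bar>) \<le> (\<Sum>j\<in>{- int (Suc N)..<int (Suc N)}. (1 - C j - D j) * \<bar>d j\<bar>)"
    by (rule sum_mono2) (use CD in \<open>auto simp: I_def diff_diff_eq intro!: mult_nonneg_nonneg\<close>)
  finally have "(\<Sum>j\<in>I. \<bar>u' (j + 1) - u' j\<bar>) \<le> (\<Sum>j\<in>{- int (Suc N)..<int (Suc N)}. (1 - C j - D j) * \<bar>d j\<bar>)
    + (\<Sum>j\<in>{- int (Suc N)..<int (Suc N)}. C j * \<bar>d j\<bar>) + (\<Sum>j\<in>{- int (Suc N)..<int (Suc N)}. D j * \<bar>d j\<bar>)"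
    by simp
  also have "\<dots> = (\<Sum>j\<in>{- int (Suc N)..<int (Suc N)}. \<bar>d j\<bar>)"
    unfolding sum.distrib[symmetric] by (rule sum.cong) (auto simp: algebra_simps)
  finally show ?thesis by (simp add: I_def d_def)
qed

section \<open>Variation of the cell averages\<close>

lemma AE_lborel_shift:
  fixes c :: real
  assumes "AE x in lborel. P x"
  shows "AE x in lborel. P (c + x)"
proof -
  from AE_E[OF assms] obtain N where N: "{x \<in> space lborel. \<not> P x} \<subseteq> N" "emeasure lborel N = 0" "N \<in> sets lborel" .
  have "AE x in distr lborel borel ((+) c). x \<notin> N"
    unfolding lborel_distr_plus using N by (auto intro!: AE_not_in simp: null_sets_def)
  then have "AE x in lborel. c + x \<notin> N"
    by (subst (asm) AE_distr_iff) (use N in auto)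
  then show ?thesis by eventually_elim (use N in auto)
qed

text \<open>With all cells brought to one reference interval, differences of averages are averages
  of differences.\<close>

lemma cell_avg_eq:
  assumes dx: "dx > 0"
  shows "cell_avg dx w0 j = (1 / dx) * (LBINT x:{- dx/2..dx/2}. w0 (real_of_int j * dx + x))"
proof -
  have "(LBINT x:{(real_of_int j - 1/2) * dx .. (real_of_int j + 1/2) * dx}. w0 x)
     = (\<integral>x. indicator {(real_of_int j - 1/2) * dx .. (real_of_int j + 1/2) * dx} (real_of_int j * dx + 1 * x) *\<^sub>R w0 (real_of_int j * dx + 1 * x) \<partial>lborel)"
    unfolding set_lebesgue_integral_def by (subst lborel_integral_real_affine[where c=1 and t="real_of_int j * dx"]) auto
  also have "\<dots> = (LBINT x:{- dx/2..dx/2}. w0 (real_of_int j * dx + x))"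
    unfolding set_lebesgue_integral_def
    by (rule Bochner_Integration.integral_cong) (auto simp: indicator_def algebra_simps)
  finally show ?thesis by (simp add: cell_avg_def)
qed

text \<open>For a fixed offset x the points j dx + x form an increasing sample, so for almost every
  x the jumps there sum to at most \<open>pvar g\<close>; averaging over x bounds the jumps of the
  cell averages.\<close>

lemma TV_cell_avg_le:
  assumes dx: "dx > 0" and meas: "w0 \<in> borel_measurable borel"
    and bnd: "AE x in lborel. \<bar>w0 x\<bar> \<le> C"
  shows "(\<Sum>j\<in>{- int N..<int N}. \<bar>cell_avg dx w0 (j + 1) - cell_avg dx w0 j\<bar>) \<le> TV w0"
  unfolding TV_def
proof (rule INF_greatest)
  fix g assume "g \<in> {g. AE x in lborel. g x = w0 x}"
  then have g: "AE x in lborel. g x = w0 x" by simp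
  define s where "s j x = w0 (real_of_int j * dx + x)" for j x
  define I where "I = {- int N..<int N}"
  define A where "A = {- dx/2..dx/2}"
  have smeas[measurable]: "s j \<in> borel_measurable borel" for j using meas by (simp add: s_def[abs_def])
  have sint: "set_integrable lborel A (s j)" for j
    unfolding A_def
    by (rule set_integrable_AE_bounded[OF smeas]) (unfold s_def, rule AE_lborel_shift[OF bnd])
  have dint: "set_integrable lborel A (\<lambda>x. \<bar>s (j + 1) x - s j x\<bar>)" for j
    by (intro set_integrable_abs set_integral_diff sint)
  have avg: "\<bar>cell_avg dx w0 (j + 1) - cell_avg dx w0 j\<bar> \<le> (1 / dx) * (LBINT x:A. \<bar>s (j + 1) x - s j x\<bar>)" for j
  proof -
    have "cell_avg dx w0 (j + 1) - cell_avg dx w0 j = (1 / dx) * (LBINT x:A. s (j + 1) x - s j x)"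
      using set_integral_diff(2)[OF sint[of "j + 1"] sint[of j]]
      by (simp add: cell_avg_eq[OF dx] diff_divide_distrib s_def A_def)
    moreover have "\<bar>LBINT x:A. s (j + 1) x - s j x\<bar> \<le> (LBINT x:A. \<bar>s (j + 1) x - s j x\<bar>)"
      using set_integral_norm_bound[OF set_integral_diff(1)[OF sint sint]] by simp
    ultimately show ?thesis using dx by (simp add: abs_mult divide_right_mono)
  qed
  show "ereal (\<Sum>j\<in>{- int N..<int N}. \<bar>cell_avg dx w0 (j + 1) - cell_avg dx w0 j\<bar>) \<le> pvar g"
  proof (cases "pvar g")
    case (real V)
    have pt: "AE x in lborel. (\<Sum>j\<in>I. \<bar>s (j + 1) x - s j x\<bar>) \<le> V"
    proof -
      \<comment> \<open>There are countably many shifts, so one null set of offsets serves all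
        j.\<close>
      have "AE x in lborel. \<forall>j. g (real_of_int j * dx + x) = w0 (real_of_int j * dx + x)"
        unfolding AE_all_countable by (intro allI AE_lborel_shift g)
      then show ?thesis
      proof eventually_elim
        case (elim x)
        let ?p = "\<lambda>j. real_of_int j * dx + x"
        have "sorted (map ?p [- int N..int N])"
          using dx by (auto simp: sorted_map intro: sorted_wrt_mono_rel[of _ "(\<le>)"])
        then have "ereal (pairs_var g (map ?p [- int N..int N])) \<le> pvar g"
          unfolding pvar_eq by (intro SUP_upper) auto
        moreover have "g \<circ> ?p = (\<lambda>j. s j x)" using elim by (auto simp: s_def)
        ultimately show ?case by (simp add: pairs_var_map pairs_var_upto real I_def)
      qed
    qed
    have "(\<Sum>j\<in>I. \<bar>cell_avg dx w0 (j + 1) - cell_avg dx w0 j\<bar>)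
        \<le> (\<Sum>j\<in>I. (1 / dx) * (LBINT x:A. \<bar>s (j + 1) x - s j x\<bar>))"
      by (intro sum_mono avg)
    also have "\<dots> = (1 / dx) * (LBINT x:A. (\<Sum>j\<in>I. \<bar>s (j + 1) x - s j x\<bar>))"
    proof -
      have "(LBINT x:A. (\<Sum>j\<in>I. \<bar>s (j + 1) x - s j x\<bar>)) = (\<Sum>j\<in>I. (LBINT x:A. \<bar>s (j + 1) x - s j x\<bar>))"
        unfolding set_lebesgue_integral_def scaleR_sum_right
        by (rule Bochner_Integration.integral_sum) (use dint in \<open>simp add: set_integrable_def\<close>)
      then show ?thesis by (simp add: sum_distrib_left)
    qed
    also have "(LBINT x:A. (\<Sum>j\<in>I. \<bar>s (j + 1) x - s j x\<bar>)) \<le> (LBINT x:A. V)"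
    proof (rule set_integral_mono_AE)
      show "set_integrable lborel A (\<lambda>x. \<Sum>j\<in>I. \<bar>s (j + 1) x - s j x\<bar>)"
        using dint unfolding set_integrable_def scaleR_sum_right by (intro Bochner_Integration.integrable_sum)
      show "set_integrable lborel A (\<lambda>x. V)"
        by (simp add: A_def set_integrable_def integrable_indicator_iff emeasure_lborel_Icc_eq)
      show "AE x \<in> A in lborel. (\<Sum>j\<in>I. \<bar>s (j + 1) x - s j x\<bar>) \<le> V" using pt by eventually_elim simp
    qed
    also have "(LBINT x:A. V) = dx * V"
      using dx by (simp add: A_def set_lebesgue_integral_def)
    finally show ?thesis using dx by (simp add: real I_def divide_right_mono)
  next
    case MInf
    \<comment> \<open>The empty list gives 0 \<le> \<open>pvar g\<close>, which excludes this
      case.\<close>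
    have "ereal (pairs_var g []) \<le> pvar g" unfolding pvar_eq by (intro SUP_upper) auto
    then show ?thesis using MInf by simp
  qed simp
qed

subsection \<open>The scheme\<close>

lemma C1_locally_lipschitz:
  fixes F F' :: "real \<Rightarrow> real"
  assumes d: "\<And>x. (F has_real_derivative F' x) (at x)" and c: "continuous_on UNIV F'"
  shows "locally_lipschitz F"
  unfolding locally_lipschitz_def
proof
  fix r :: real
  have "continuous_on {-r..r} F'" using c continuous_on_subset by blast
  from compact_imp_bounded[OF compact_continuous_image[OF this compact_Icc]]
  obtain B where B: "\<And>y. \<bar>y\<bar> \<le> r \<Longrightarrow> \<bar>F' y\<bar> \<le> B" by (force simp: bounded_iff abs_le_iff)
  have "\<bar>F x - F y\<bar> \<le> max B 0 * \<bar>x - y\<bar>" if "\<bar>x\<bar> \<le> r" "\<bar>y\<bar> \<le> r" for x y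
    using field_differentiable_bound[of "{-r..r}" F F' "max B 0" x y] that B
    by (auto simp: abs_le_iff le_max_iff_disj intro: has_field_derivative_at_within[OF d])
  then show "\<exists>M\<ge>0. \<forall>x y. \<bar>x\<bar> \<le> r \<longrightarrow> \<bar>y\<bar> \<le> r \<longrightarrow> \<bar>F x - F y\<bar> \<le> M * \<bar>x - y\<bar>"
    by (intro exI[of _ "max B 0"]) auto
qed

text \<open>C is the quotient y/d; for d = 0 the bound forces y = 0 and C = 0 serves.\<close>

lemma incremental_coefficient:
  fixes y d c :: real
  assumes "\<bar>y\<bar> \<le> c * \<bar>d\<bar>" "0 \<le> y * d" "0 \<le> c"
  obtains C where "0 \<le> C" "C \<le> c" "y = C * d"
proof (cases "d = 0")
  case True
  then show ?thesis using assms that[of 0] by simp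
next
  case False
  show ?thesis
  proof (rule that[of "y / d"])
    have "y / d = \<bar>y\<bar> / \<bar>d\<bar>" using assms(2) False by (auto simp: zero_le_mult_iff abs_if)
    then show "0 \<le> y / d" "y / d \<le> c" using assms(1) False by (auto simp: pos_divide_le_eq)
  qed (use False in simp)
qed

text \<open>The flux is F(l) with l between a and b, a minimiser if a \<le> b and a maximiser
  otherwise. So neither F(a) - F(l) nor F(b) - F(l) has the sign opposite to b - a. The CFL bound
  makes lam F Lipschitz with constant 1/2, and l is no farther from a or b than they are from each
  other.\<close>

lemma godunov_increments:
  fixes F F' :: "real \<Rightarrow> real"
  assumes d: "\<And>x. (F has_real_derivative F' x) (at x)" and c: "continuous_on UNIV F'"
    and cfl: "\<And>w. \<bar>w\<bar> \<le> W \<Longrightarrow> lam * \<bar>F' w\<bar> \<le> 1/2" and lam: "0 \<le> lam"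
    and ab: "\<bar>a\<bar> \<le> W" "\<bar>b\<bar> \<le> W"
  shows "\<exists>C. 0 \<le> C \<and> C \<le> 1/2 \<and> - lam * (godunov F a b - F a) = C * (b - a)"
    and "\<exists>D. 0 \<le> D \<and> D \<le> 1/2 \<and> lam * (F b - godunov F a b) = D * (b - a)"
proof -
  note F = C1_locally_lipschitz[OF d c]
  have lip: "lam * \<bar>F x - F y\<bar> \<le> 1/2 * \<bar>x - y\<bar>" if "\<bar>x\<bar> \<le> W" "\<bar>y\<bar> \<le> W" for x y
  proof -
    have "norm (lam * F x - lam * F y) \<le> 1/2 * norm (x - y)"
      by (rule field_differentiable_bound[of "{-W..W}" "\<lambda>x. lam * F x" "\<lambda>x. lam * F' x"])
        (use that cfl lam in \<open>auto simp: abs_mult intro!: has_field_derivative_at_within[OF DERIV_cmult[OF d]]\<close>)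
    then show ?thesis using lam by (simp add: right_diff_distrib[symmetric] abs_mult)
  qed
  obtain l where l: "min a b \<le> l" "l \<le> max a b" "godunov F a b = F l"
    and l1: "0 \<le> (F a - F l) * (b - a)" and l2: "0 \<le> (F b - F l) * (b - a)"
  proof (cases "a \<le> b")
    case True
    obtain l where l: "l \<in> {a..b}" "godunov F a b = F l" "\<And>k. k \<in> {a..b} \<Longrightarrow> F l \<le> F k"
      using godunov_min[OF True F] by blast
    show ?thesis
      by (rule that[of l]) (use l l(3)[of a] l(3)[of b] True in auto)
  next
    case False
    then have "b \<le> a" by simp
    obtain l where l: "l \<in> {b..a}" "godunov F a b = F l" "\<And>k. k \<in> {b..a} \<Longrightarrow> F k \<le> F l"
      using godunov_max[OF \<open>b \<le> a\<close> F] by blast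
    show ?thesis
      by (rule that[of l]) (use l l(3)[of a] l(3)[of b] \<open>b \<le> a\<close> in \<open>auto intro: mult_nonpos_nonpos\<close>)
  qed
  have lW: "\<bar>l\<bar> \<le> W" "\<bar>a - l\<bar> \<le> \<bar>b - a\<bar>" "\<bar>b - l\<bar> \<le> \<bar>b - a\<bar>" using l(1,2) ab by auto
  show "\<exists>C. 0 \<le> C \<and> C \<le> 1/2 \<and> - lam * (godunov F a b - F a) = C * (b - a)"
  proof (rule incremental_coefficient[of "lam * (F a - F l)" "1/2" "b - a"])
    show "\<bar>lam * (F a - F l)\<bar> \<le> 1/2 * \<bar>b - a\<bar>" using lip[OF ab(1) lW(1)] lW(2) lam by (simp add: abs_mult)
    show "0 \<le> lam * (F a - F l) * (b - a)" using l1 lam by (simp add: mult.assoc)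
  qed (auto simp: l(3) algebra_simps)
  show "\<exists>D. 0 \<le> D \<and> D \<le> 1/2 \<and> lam * (F b - godunov F a b) = D * (b - a)"
  proof (rule incremental_coefficient[of "lam * (F b - F l)" "1/2" "b - a"])
    show "\<bar>lam * (F b - F l)\<bar> \<le> 1/2 * \<bar>b - a\<bar>" using lip[OF ab(2) lW(1)] lW(3) lam by (simp add: abs_mult)
    show "0 \<le> lam * (F b - F l) * (b - a)" using l2 lam by (simp add: mult.assoc)
  qed (auto simp: l(3))
qed

text \<open>The infimum is attained because the exceptional sets of the bounds
  \<open>Linf_norm u + inverse (real (Suc n))\<close> have a null union.\<close>

lemma AE_le_Linf_norm:
  assumes "\<exists>C. AE x in lborel. \<bar>u x\<bar> \<le> C"
  shows "AE x in lborel. \<bar>u x\<bar> \<le> Linf_norm u" "0 \<le> Linf_norm u"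
proof -
  let ?A = "{C. AE x in lborel. \<bar>u x\<bar> \<le> C}"
  have nn: "0 \<le> C" if "C \<in> ?A" for C
  proof -
    from that have "AE x in lborel. \<bar>u x\<bar> \<le> C" by simp
    from AE_ex_in_Ioo[OF this, of 0 1] show ?thesis by fastforce
  qed
  have ne: "?A \<noteq> {}" using assms by blast
  show "0 \<le> Linf_norm u" unfolding Linf_norm_def using ne nn by (intro cInf_greatest)
  have "AE x in lborel. \<bar>u x\<bar> \<le> Linf_norm u + inverse (real (Suc n))" for n
  proof -
    have "Inf ?A < Linf_norm u + inverse (real (Suc n))" by (simp add: Linf_norm_def)
    from cInf_lessD[OF ne this] obtain C where "C \<in> ?A" "C < Linf_norm u + inverse (real (Suc n))" by blast
    then show ?thesis by (auto elim!: eventually_mono)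
  qed
  then have "AE x in lborel. \<forall>n. \<bar>u x\<bar> \<le> Linf_norm u + inverse (real (Suc n))"
    unfolding AE_all_countable by blast
  then show "AE x in lborel. \<bar>u x\<bar> \<le> Linf_norm u"
  proof eventually_elim
    case (elim x)
    show ?case
    proof (rule field_le_epsilon)
      fix e :: real assume "e > 0"
      then obtain n where "inverse (real (Suc n)) < e" using reals_Archimedean by blast
      then show "\<bar>u x\<bar> \<le> Linf_norm u + e" using elim[rule_format, of n] by linarith
    qed
  qed
qed

lemma abs_cell_avg_le:
  assumes dx: "dx > 0" and w0: "w0 \<in> borel_measurable borel" and W: "AE x in lborel. \<bar>w0 x\<bar> \<le> W"
  shows "\<bar>cell_avg dx w0 j\<bar> \<le> W"
proof -
  let ?I = "{(real_of_int j - 1/2) * dx .. (real_of_int j + 1/2) * dx}"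
  note i = set_integrable_AE_bounded[OF w0 W]
  have "\<bar>LBINT x:?I. w0 x\<bar> \<le> (LBINT x:?I. \<bar>w0 x\<bar>)"
    using set_integral_norm_bound[OF i] by simp
  also have "\<dots> \<le> (LBINT x:?I. W)"
    by (rule set_integral_mono_AE) (use W set_integrable_abs[OF i] set_integrable_bounded[of "\<lambda>_. W" "\<bar>W\<bar>"] in auto)
  also have "\<dots> = dx * W" using dx by (simp add: set_lebesgue_integral_def algebra_simps)
  finally show ?thesis using dx by (simp add: cell_avg_def abs_mult field_simps)
qed

lemma vface_range:
  assumes dx: "dx > 0" and v: "v \<in> borel_measurable borel" and rng: "AE x in lborel. 0 \<le> v x \<and> v x \<le> 1"
  shows "0 \<le> vface dx v j" "vface dx v j \<le> 1"
proof -
  let ?I = "{real_of_int j * dx .. (real_of_int j + 1) * dx}"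
  have "AE x in lborel. \<bar>v x\<bar> \<le> 1" using rng by eventually_elim auto
  note i = set_integrable_AE_bounded[OF v this]
  have "0 \<le> (LBINT x:?I. v x)" unfolding set_lebesgue_integral_def
    by (rule integral_nonneg_AE) (use rng in \<open>eventually_elim; simp\<close>)
  then show "0 \<le> vface dx v j" using dx by (simp add: vface_def)
  have "(LBINT x:?I. v x) \<le> (LBINT x:?I. 1)"
    by (rule set_integral_mono_AE) (use rng i set_integrable_bounded[of "\<lambda>_. 1" 1] in auto)
  also have "\<dots> = dx" using dx by (simp add: set_lebesgue_integral_def algebra_simps)
  finally show "vface dx v j \<le> 1" using dx by (simp add: vface_def)
qed

text \<open>The new value is a convex combination of three neighbouring values.\<close>

lemma incremental_step_bound:
  fixes u :: "int \<Rightarrow> real"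
  assumes W: "\<And>j. \<bar>u j\<bar> \<le> W" and CD: "0 \<le> C" "0 \<le> D" "C + D \<le> 1"
  shows "\<bar>u j + C * (u (j + 1) - u j) - D * (u j - u (j - 1))\<bar> \<le> W"
proof -
  have "u j + C * (u (j + 1) - u j) - D * (u j - u (j - 1)) = (1 - C - D) * u j + C * u (j + 1) + D * u (j - 1)"
    by (simp add: algebra_simps)
  also have "\<bar>\<dots>\<bar> \<le> (1 - C - D) * W + C * W + D * W"
    using CD W by (intro order_trans[OF abs_triangle_ineq] add_mono) (auto simp: abs_mult intro!: mult_left_mono)
  finally show ?thesis by (simp add: algebra_simps)
qed

lemma TV_wdx:
  assumes "dx > 0"
  shows "TV (wdx fm fp v w0 dt dx n) =
    (SUP N. ereal (\<Sum>j\<in>{- int N..<int N}. \<bar>scheme fm fp v w0 dt dx n (j + 1) - scheme fm fp v w0 dt dx n j\<bar>))"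
  using TV_piecewise_constant[OF assms] by (simp add: wdx_def[abs_def])

theorem theorem5p1:
  fixes fm fp v w0 :: "real \<Rightarrow> real" and dt dx \<epsilon> :: real
  assumes fm_C2: "\<forall>x. fm differentiable (at x)" "\<forall>x. deriv fm differentiable (at x)"
    and fp_C2: "\<forall>x. fp differentiable (at x)" "\<forall>x. deriv fp differentiable (at x)"
    and v_meas: "v \<in> borel_measurable borel"
    and v_range: "AE x in lborel. 0 \<le> v x \<and> v x \<le> 1"
    and w0_meas: "w0 \<in> borel_measurable borel"
    and w0_Linf: "\<exists>C. AE x in lborel. \<bar>w0 x\<bar> \<le> C"
    and w0_BV: "TV w0 < \<infinity>"
    and dt_pos: "dt > 0" and dx_pos: "dx > 0"
    and eps: "0 < \<epsilon>" "\<epsilon> < 1/2"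
    and CFL: "\<forall>w vv. \<bar>w\<bar> \<le> Linf_norm w0 \<longrightarrow> 0 \<le> vv \<longrightarrow> vv \<le> 1 \<longrightarrow>
               dt / dx * \<bar>(1 - vv) * deriv fm w + vv * deriv fp w\<bar> \<le> 1/2 - \<epsilon>"
  shows "\<forall>n. TV (wdx fm fp v w0 dt dx (Suc n)) \<le> TV (wdx fm fp v w0 dt dx n)
            \<and> TV (wdx fm fp v w0 dt dx n) \<le> TV w0"
proof -
  define W where "W = Linf_norm w0"
  note W = AE_le_Linf_norm(1)[OF w0_Linf, folded W_def]
  let ?u = "scheme fm fp v w0 dt dx"
  define V where "V j = vface dx v j" for j
  have V: "0 \<le> V j" "V j \<le> 1" for j using vface_range[OF dx_pos v_meas v_range] by (auto simp: V_def)
  define lam where "lam = dt / dx"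
  have lam: "0 \<le> lam" using dt_pos dx_pos by (simp add: lam_def)
  define f where "f j w = fluxf fm fp w (V j)" for j w
  define f' where "f' j w = (1 - V j) * deriv fm w + V j * deriv fp w" for j w
  have df: "(f j has_real_derivative f' j w) (at w)" for j w
  proof -
    have "(fm has_real_derivative deriv fm w) (at w)" "(fp has_real_derivative deriv fp w) (at w)"
      using fm_C2(1) fp_C2(1) by (simp_all add: DERIV_deriv_iff_real_differentiable)
    then show ?thesis unfolding f_def[abs_def] fluxf_def f'_def by (intro derivative_intros DERIV_add DERIV_cmult)
  qed
  have "continuous_on UNIV (deriv fm)" "continuous_on UNIV (deriv fp)"
    using fm_C2(2) fp_C2(2) by (auto intro!: continuous_at_imp_continuous_on differentiable_imp_continuous_within)
  then have cf: "continuous_on UNIV (f' j)" for j unfolding f'_def by (intro continuous_intros)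
  have cfl: "lam * \<bar>f' j w\<bar> \<le> 1/2" if "\<bar>w\<bar> \<le> W" for j w
  proof -
    have "lam * \<bar>f' j w\<bar> \<le> 1/2 - \<epsilon>"
      unfolding lam_def f'_def using CFL that V by (simp add: W_def)
    then show ?thesis using eps by linarith
  qed
  \<comment> \<open>The CFL condition controls derivatives only for |w| \<le> W, so the incremental
    form at level n presupposes the bound at level n; the bound at the next level then follows from
    that form.\<close>
  have step: "\<exists>C D. (\<forall>j. 0 \<le> C j \<and> C j \<le> 1/2 \<and> 0 \<le> D j \<and> D j \<le> 1/2) \<and>
      (\<forall>j. ?u (Suc n) j = ?u n j + C j * (?u n (j + 1) - ?u n j) - D (j - 1) * (?u n j - ?u n (j - 1)))"
    if u: "\<And>j. \<bar>?u n j\<bar> \<le> W" for n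
  proof -
    have "\<exists>C. 0 \<le> C \<and> C \<le> 1/2 \<and>
        - lam * (godunov (f j) (?u n j) (?u n (j + 1)) - f j (?u n j)) = C * (?u n (j + 1) - ?u n j)" for j
      by (rule godunov_increments(1)[OF df cf cfl lam u u])
    then obtain C where C: "\<And>j. 0 \<le> C j \<and> C j \<le> 1/2"
      "\<And>j. - lam * (godunov (f j) (?u n j) (?u n (j + 1)) - f j (?u n j)) = C j * (?u n (j + 1) - ?u n j)"
      by metis
    have "\<exists>D. 0 \<le> D \<and> D \<le> 1/2 \<and>
        lam * (f j (?u n (j + 1)) - godunov (f j) (?u n j) (?u n (j + 1))) = D * (?u n (j + 1) - ?u n j)" for j
      by (rule godunov_increments(2)[OF df cf cfl lam u u])
    then obtain D where D: "\<And>j. 0 \<le> D j \<and> D j \<le> 1/2"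
      "\<And>j. lam * (f j (?u n (j + 1)) - godunov (f j) (?u n j) (?u n (j + 1))) = D j * (?u n (j + 1) - ?u n j)"
      by metis
    have "?u (Suc n) j = ?u n j + C j * (?u n (j + 1) - ?u n j) - D (j - 1) * (?u n j - ?u n (j - 1))" for j
    proof -
      have "?u (Suc n) j = ?u n j - lam * ((godunov (f j) (?u n j) (?u n (j + 1)) - f j (?u n j))
          - (godunov (f (j - 1)) (?u n (j - 1)) (?u n j) - f (j - 1) (?u n j)))"
        by (simp add: Let_def lam_def f_def[abs_def] V_def)
      \<comment> \<open>The left face of cell j is the face with index j - 1, whence
        \<open>D (j - 1)\<close>.\<close>
      also have "\<dots> = ?u n j + (- lam * (godunov (f j) (?u n j) (?u n (j + 1)) - f j (?u n j)))
          - lam * (f (j - 1) (?u n j) - godunov (f (j - 1)) (?u n (j - 1)) (?u n j))"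
        by (simp add: algebra_simps)
      finally show ?thesis using C(2)[of j] D(2)[of "j - 1"] by simp
    qed
    then show ?thesis using C(1) D(1) by blast
  qed
  have bound: "\<bar>?u n j\<bar> \<le> W" for n j
  proof (induction n arbitrary: j)
    case 0
    show ?case using abs_cell_avg_le[OF dx_pos w0_meas W] by simp
  next
    case (Suc n)
    from step[OF Suc.IH] obtain C D where CD: "\<And>j. 0 \<le> C j \<and> C j \<le> 1/2 \<and> 0 \<le> D j \<and> D j \<le> 1/2"
      and s: "\<And>j. ?u (Suc n) j = ?u n j + C j * (?u n (j + 1) - ?u n j) - D (j - 1) * (?u n j - ?u n (j - 1))"
      by metis
    \<comment> \<open>The coefficients here belong to the two faces of one cell, \<open>C j\<close>
      and \<open>D (j - 1)\<close>; the variation estimate pairs \<open>C j\<close> with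
      \<open>D j\<close> at one face. The bound 1/2 on each serves both.\<close>
    show ?case unfolding s
      by (rule incremental_step_bound[OF Suc.IH]) (use CD[of j] CD[of "j - 1"] in auto)
  qed
  have dec: "TV (wdx fm fp v w0 dt dx (Suc n)) \<le> TV (wdx fm fp v w0 dt dx n)" for n
    unfolding TV_wdx[OF dx_pos]
  proof (rule SUP_mono)
    fix N :: nat
    from step[OF bound] obtain C D where CD: "\<And>j. 0 \<le> C j \<and> C j \<le> 1/2 \<and> 0 \<le> D j \<and> D j \<le> 1/2"
      and s: "\<And>j. ?u (Suc n) j = ?u n j + C j * (?u n (j + 1) - ?u n j) - D (j - 1) * (?u n j - ?u n (j - 1))"
      by metis
    have "C j + D j \<le> 1" for j using CD[of j] by linarith
    with Harten_TVD[of "?u (Suc n)" "?u n" C D N, OF s] CD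
    show "\<exists>M\<in>UNIV. ereal (\<Sum>j\<in>{- int N..<int N}. \<bar>?u (Suc n) (j + 1) - ?u (Suc n) j\<bar>)
        \<le> ereal (\<Sum>j\<in>{- int M..<int M}. \<bar>?u n (j + 1) - ?u n j\<bar>)"
      by (intro bexI[of _ "Suc N"]) auto
  qed
  have "TV (wdx fm fp v w0 dt dx n) \<le> TV w0" for n
  proof (induction n)
    case 0
    show ?case unfolding TV_wdx[OF dx_pos] scheme.simps(1)
      by (intro SUP_least TV_cell_avg_le[OF dx_pos w0_meas W])
  next
    case (Suc n)
    then show ?case using dec[of n] by (rule order_trans[rotated])
  qed
  with dec show ?thesis by blast
qed

end
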